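(* Let $G$ be a compact Lie group of dimension $n$ and $m\in\mathbb R$. Let the symbol $\sigma_A$ of a linear continuous operator $A$ from $C^\infty(G)$ to $\mathcal D'(G)$ satisfy any one of the following conditions: (B) for every left-invariant differential operator $P_x\in\mathrm{Diff}^k(G)$ of order $k$ and every difference operator $Q_\xi\in\mathrm{diff}^\ell(\widehat G)$ of order $\ell$, $\|Q_\xi P_x\sigma_A(x,\xi)\|_{op}\le C_{Q_\xi P_x}\langle\xi\rangle^{m-\ell}$ for all $x\in G$, $[\xi]\in\widehat G$; (C) for any admissible selection $\triangle_1,\ldots,\triangle_n\in\mathrm{diff}^1(\widehat G)$, $\|\triangle_\xi^\alpha\partial_x^\beta\sigma_A(x,\xi)\|_{op}\le C_{\alpha\beta}\langle\xi\rangle^{m-|\alpha|}$ for all $\alpha,\beta\in\mathbb N_0^n$, $x\in G$, $[\xi]\in\widehat G$, and moreover $\operatorname{sing\,supp}R_A(x,\cdot)\subseteq\{e\}$ for all $x$; (D) for a (i.e. for some) strongly admissible selection $\triangle_1,\ldots,\triangle_n\in\mathrm{diff}^1(\widehat G)$, $\|\triangle_\xi^\alpha\partial_x^\beta\sigma_A(x,\xi)\|_{op}\le C_{\alpha\beta}\langle\xi\rangle^{m-|\alpha|}$ for all $\alpha,\beta\in\mathbb N_0^n$, $x\in G$, $[\xi]\in\widehat G$. Then for every $u\in G$ the symbol $\sigma_{A_u}$ of the operator $A_uf:=A(f\circ\phi)\circ\phi^{-1}$, where $\phi(x)=xu$, satisfies the same symbolic estimates.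
   Context: $G$ is a compact Lie group with unit element $e$, normalised Haar measure and bi-invariant Riemannian structure. $\widehat G$ is the set of equivalence classes $[\xi]$ of continuous irreducible unitary representations $\xi:G\to \mathrm U(d_\xi)$. The matrix entries of $\xi$ are eigenfunctions of the Laplacian with a common eigenvalue $-\lambda_\xi^2$, and $\langle\xi\rangle=(1+\lambda_\xi^2)^{1/2}$. $\widehat f(\xi)=\int_G f(x)\xi(x)^*\,dx$, extended to distributions. $\|\cdot\|_{op}$ is the operator norm on $\mathbb C^{d_\xi\times d_\xi}$. The symbol of $A$ is $\sigma_A(x,\xi)=\xi(x)^*(A\xi)(x)$. The right-convolution kernel $R_A$ is determined by $Af(x)=\int_G f(y)R_A(x,y^{-1}x)\,dy$, so that $\sigma_A(x,\xi)=\int_G R_A(x,y)\xi(y)^*\,dy$. Symbol estimates include smoothness of $\sigma_A(\cdot,\xi)$ in $x$. A difference operator of order $k$ is an operator $Q_\xi\widehat f(\xi)=\widehat{q f}(\xi)$ with a (complex-valued) $q\in C^\infty(G)$ vanishing of order $k$ at $e$, i.e. $(Pq)(e)=0$ for all left-invariant differential operators $P$ of order $k-1$. It acts on $\sigma_A(x,\xi)$ in $\xi$ for fixed $x$. The set of these operators is $\mathrm{diff}^k(\widehat G)$. A collection $\triangle_1,\dots,\triangle_K\in\mathrm{diff}^1(\widehat G)$, $K\ge n$, with functions $q_1,\dots,q_K$, is admissible if $dq_j(e)\neq0$ for all $j$ and $\operatorname{rank}(dq_1(e),\dots,dq_K(e))=n$ (over $\mathbb C$). It is strongly admissible if in addition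 $\bigcap_j\{x\in G:q_j(x)=0\}=\{e\}$. $\triangle_\xi^\alpha=\triangle_1^{\alpha_1}\cdots\triangle_n^{\alpha_n}$, and $\partial_x^\beta=\partial_{x_1}^{\beta_1}\cdots\partial_{x_n}^{\beta_n}$ for a fixed linearly independent family of left-invariant vector fields on $G$. *)

theory Defs
  imports
    "HOL-Analysis.Analysis"
    "HOL-Probability.Probability_Measure"
    "HOL-Algebra.Group"
    "Jordan_Normal_Form.Schur_Decomposition"
    "Jordan_Normal_Form.VS_Connect"
begin

section \<open>Smooth maps between relatively open subsets of Euclidean subspaces\<close>

text \<open>The model space of a manifold is a linear subspace \<open>V\<close> of a Euclidean space (rather than
  the whole type, whose dimension is never zero), so that dimension \<open>0\<close> is included.
  Below \<open>U\<close> is relatively open in \<open>V\<close>, and only directions in \<open>V\<close> are differentiated.\<close>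

definition dir_deriv :: "'a::real_normed_vector \<Rightarrow> ('a \<Rightarrow> 'b::real_normed_vector) \<Rightarrow> 'a \<Rightarrow> 'b" where
  "dir_deriv v f x = vector_derivative (\<lambda>t. f (x + t *\<^sub>R v)) (at 0)"

fun Ck_on :: "nat \<Rightarrow> 'a::real_normed_vector set \<Rightarrow> 'a set \<Rightarrow> ('a \<Rightarrow> 'b::real_normed_vector) \<Rightarrow> bool" where
  "Ck_on 0 V U f \<longleftrightarrow> continuous_on U f"
| "Ck_on (Suc k) V U f \<longleftrightarrow> continuous_on U f \<and>
     (\<forall>v\<in>V. (\<forall>x\<in>U. (\<lambda>t::real. f (x + t *\<^sub>R v)) differentiable (at 0)) \<and> Ck_on k V U (dir_deriv v f))"

definition smooth_on :: "'a::real_normed_vector set \<Rightarrow> 'a set \<Rightarrow> ('a \<Rightarrow> 'b::real_normed_vector) \<Rightarrow> bool" where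
  "smooth_on V U f \<longleftrightarrow> (\<forall>k. Ck_on k V U f)"


section \<open>Compact Lie groups\<close>

type_synonym ('g, 'e) chart = "'g set \<times> ('g \<Rightarrow> 'e)"

definition smooth_atlas ::
  "'e::euclidean_space set \<Rightarrow> ('g::topological_space, 'e) chart set \<Rightarrow> bool" where
  "smooth_atlas V \<A> \<longleftrightarrow>
     (\<forall>(U, \<phi>)\<in>\<A>. open U \<and> openin (top_of_set V) (\<phi> ` U) \<and>
        homeomorphism U (\<phi> ` U) \<phi> (inv_into U \<phi>)) \<and>
     (\<Union>(U, \<phi>)\<in>\<A>. U) = UNIV \<and>
     (\<forall>(U, \<phi>)\<in>\<A>. \<forall>(U', \<phi>')\<in>\<A>. smooth_on V (\<phi> ` (U \<inter> U')) (\<phi>' \<circ> inv_into U \<phi>))"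

type_synonym 'g operator = "('g \<Rightarrow> complex) \<Rightarrow> ('g \<Rightarrow> complex)"
type_synonym 'g dist = "('g \<Rightarrow> complex) \<Rightarrow> complex"
type_synonym 'g rep = "'g \<Rightarrow> complex mat"

locale compact_lie_group = group G
  for G :: "'g::{t2_space, second_countable_topology} monoid" (structure) +
  fixes n :: nat
    and V :: "'e::euclidean_space set"
    and \<A> :: "('g, 'e) chart set"
  assumes carrier_UNIV: "carrier G = UNIV"
    and compact_UNIV: "compact (UNIV :: 'g set)"
    and subspace_V: "Real_Vector_Spaces.subspace V"
    and dim_V: "Real_Vector_Spaces.dim V = n"
    and atlas: "smooth_atlas V \<A>"
    and continuous_mult: "continuous_on UNIV (\<lambda>(x, y). x \<otimes> y)"
    and continuous_inv: "continuous_on UNIV (\<lambda>x. inv x)"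
    and smooth_mult: "\<And>U \<phi> U' \<phi>' W \<omega>. (U, \<phi>) \<in> \<A> \<Longrightarrow> (U', \<phi>') \<in> \<A> \<Longrightarrow> (W, \<omega>) \<in> \<A> \<Longrightarrow>
        smooth_on (V \<times> V) {(\<phi> x, \<phi>' y) | x y. x \<in> U \<and> y \<in> U' \<and> x \<otimes> y \<in> W}
          (\<lambda>(a, b). \<omega> (inv_into U \<phi> a \<otimes> inv_into U' \<phi>' b))"
    and smooth_inv: "\<And>U \<phi> W \<omega>. (U, \<phi>) \<in> \<A> \<Longrightarrow> (W, \<omega>) \<in> \<A> \<Longrightarrow>
        smooth_on V (\<phi> ` {x \<in> U. inv x \<in> W}) (\<lambda>a. \<omega> (inv (inv_into U \<phi> a)))"
begin

definition smooth_fun_on :: "'g set \<Rightarrow> ('g \<Rightarrow> complex) \<Rightarrow> bool" where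
  "smooth_fun_on W f \<longleftrightarrow> (\<forall>(U, \<phi>)\<in>\<A>. smooth_on V (\<phi> ` (U \<inter> W)) (f \<circ> inv_into U \<phi>))"

definition Cinf :: "('g \<Rightarrow> complex) set" where
  "Cinf = {f. smooth_fun_on UNIV f}"


subsection \<open>Differential operators\<close>

definition linear_op :: "'g operator \<Rightarrow> bool" where
  "linear_op P \<longleftrightarrow>
     (\<forall>f\<in>Cinf. P f \<in> Cinf) \<and>
     (\<forall>f\<in>Cinf. \<forall>g\<in>Cinf. P (\<lambda>x. f x + g x) = (\<lambda>x. P f x + P g x)) \<and>
     (\<forall>f\<in>Cinf. \<forall>c. P (\<lambda>x. c * f x) = (\<lambda>x. c * P f x))"

definition commutator :: "'g operator \<Rightarrow> ('g \<Rightarrow> complex) \<Rightarrow> 'g operator" where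
  "commutator P g = (\<lambda>f x. P (\<lambda>y. g y * f y) x - g x * P f x)"

text \<open>Differential operators on \<open>C\<^sup>\<infinity>(G)\<close> of order at most \<open>k\<close>, in the coordinate-free form:
  the commutator with multiplication by any smooth function lowers the order, and the operators of
  order \<open>0\<close> are those that commute with all these multiplications.\<close>

fun diff_op :: "nat \<Rightarrow> 'g operator \<Rightarrow> bool" where
  "diff_op 0 P \<longleftrightarrow> linear_op P \<and> (\<forall>g\<in>Cinf. \<forall>f\<in>Cinf. commutator P g f = (\<lambda>x. 0))"
| "diff_op (Suc k) P \<longleftrightarrow> linear_op P \<and> (\<forall>g\<in>Cinf. diff_op k (commutator P g))"

definition left_invariant :: "'g operator \<Rightarrow> bool" where
  "left_invariant P \<longleftrightarrow> (\<forall>f\<in>Cinf. \<forall>a. P (\<lambda>x. f (a \<otimes> x)) = (\<lambda>x. P f (a \<otimes> x)))"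

definition LDiff :: "nat \<Rightarrow> 'g operator set" where
  "LDiff k = {P. diff_op k P \<and> left_invariant P}"

text \<open>The Lie algebra: real left-invariant vector fields, as derivations of \<open>C\<^sup>\<infinity>(G)\<close>.  They
  are set to \<open>0\<close> on functions that are not smooth, so that equality of fields is equality of
  functions.\<close>

definition lie_algebra :: "'g operator set" where
  "lie_algebra = {X. linear_op X \<and> left_invariant X \<and>
     (\<forall>f\<in>Cinf. \<forall>g\<in>Cinf. X (\<lambda>x. f x * g x) = (\<lambda>x. X f x * g x + f x * X g x)) \<and>
     (\<forall>f\<in>Cinf. X (\<lambda>x. cnj (f x)) = (\<lambda>x. cnj (X f x))) \<and>
     (\<forall>f. f \<notin> Cinf \<longrightarrow> X f = (\<lambda>x. 0))}"

definition left_invariant_frame :: "(nat \<Rightarrow> 'g operator) \<Rightarrow> bool" where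
  "left_invariant_frame X \<longleftrightarrow> (\<forall>i<n. X i \<in> lie_algebra) \<and>
     (\<forall>c :: nat \<Rightarrow> real.
        (\<forall>f\<in>Cinf. \<forall>x. (\<Sum>i<n. complex_of_real (c i) * X i f x) = 0) \<longrightarrow> (\<forall>i<n. c i = 0))"

definition partial :: "(nat \<Rightarrow> 'g operator) \<Rightarrow> (nat \<Rightarrow> nat) \<Rightarrow> 'g operator" where
  "partial X \<beta> = foldr (\<lambda>i F. (X i ^^ \<beta> i) \<circ> F) [0..<n] id"


subsection \<open>Haar measure, bi-invariant Riemannian structure and Laplacian\<close>

definition haar_measure :: "'g measure \<Rightarrow> bool" where
  "haar_measure \<mu> \<longleftrightarrow> sets \<mu> = sets borel \<and> prob_space \<mu> \<and>
     (\<forall>a. distr \<mu> borel (\<lambda>x. a \<otimes> x) = \<mu> \<and> distr \<mu> borel (\<lambda>x. x \<otimes> a) = \<mu>)"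

definition right_push :: "'g \<Rightarrow> 'g operator \<Rightarrow> 'g operator" where
  "right_push a X = (\<lambda>f x. X (\<lambda>y. f (y \<otimes> a)) (x \<otimes> inv a))"

text \<open>A left-invariant Riemannian metric is the same as an inner product on the Lie algebra; it is
  right-invariant iff this inner product is invariant under push-forward by right translations.\<close>

definition biinvariant_metric :: "('g operator \<Rightarrow> 'g operator \<Rightarrow> real) \<Rightarrow> bool" where
  "biinvariant_metric ip \<longleftrightarrow>
     (\<forall>X\<in>lie_algebra. \<forall>Y\<in>lie_algebra. ip X Y = ip Y X) \<and>
     (\<forall>X\<in>lie_algebra. \<forall>Y\<in>lie_algebra. \<forall>Z\<in>lie_algebra.
        ip (\<lambda>f x. X f x + Y f x) Z = ip X Z + ip Y Z) \<and>
     (\<forall>X\<in>lie_algebra. \<forall>Z\<in>lie_algebra. \<forall>c::real.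
        ip (\<lambda>f x. complex_of_real c * X f x) Z = c * ip X Z) \<and>
     (\<forall>X\<in>lie_algebra. X \<noteq> (\<lambda>f x. 0) \<longrightarrow> ip X X > 0) \<and>
     (\<forall>X\<in>lie_algebra. \<forall>Y\<in>lie_algebra. \<forall>a. ip (right_push a X) (right_push a Y) = ip X Y)"

definition orthonormal_frame ::
  "('g operator \<Rightarrow> 'g operator \<Rightarrow> real) \<Rightarrow> (nat \<Rightarrow> 'g operator) \<Rightarrow> bool" where
  "orthonormal_frame ip E \<longleftrightarrow> (\<forall>i<n. E i \<in> lie_algebra) \<and>
     (\<forall>i<n. \<forall>j<n. ip (E i) (E j) = (if i = j then 1 else 0))"

text \<open>For a bi-invariant metric the Laplace--Beltrami operator is the sum of the squares of any
  orthonormal frame of left-invariant fields.\<close>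

definition laplacian :: "('g operator \<Rightarrow> 'g operator \<Rightarrow> real) \<Rightarrow> 'g operator" where
  "laplacian ip f = (let E = (SOME E. orthonormal_frame ip E) in (\<lambda>x. \<Sum>i<n. E i (E i f) x))"


subsection \<open>The unitary dual\<close>

definition rep_dim :: "'g rep \<Rightarrow> nat" where
  "rep_dim \<xi> = dim_row (\<xi> \<one>)"

definition irreps :: "'g rep set" where
  "irreps = {\<xi>. rep_dim \<xi> > 0 \<and>
     (\<forall>x. \<xi> x \<in> carrier_mat (rep_dim \<xi>) (rep_dim \<xi>)) \<and>
     \<xi> \<one> = 1\<^sub>m (rep_dim \<xi>) \<and>
     (\<forall>x y. \<xi> (x \<otimes> y) = \<xi> x * \<xi> y) \<and>
     (\<forall>x. mat_adjoint (\<xi> x) * \<xi> x = 1\<^sub>m (rep_dim \<xi>)) \<and>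
     (\<forall>i<rep_dim \<xi>. \<forall>j<rep_dim \<xi>. continuous_on UNIV (\<lambda>x. \<xi> x $$ (i, j))) \<and>
     (\<forall>W. VectorSpace.subspace class_ring W (module_vec TYPE(complex) (rep_dim \<xi>)) \<longrightarrow>
        (\<forall>x. \<forall>w\<in>W. \<xi> x *\<^sub>v w \<in> W) \<longrightarrow>
        W = {0\<^sub>v (rep_dim \<xi>)} \<or> W = carrier_vec (rep_dim \<xi>))}"

definition rep_equiv :: "('g rep \<times> 'g rep) set" where
  "rep_equiv = {(\<xi>, \<eta>). \<xi> \<in> irreps \<and> \<eta> \<in> irreps \<and> rep_dim \<eta> = rep_dim \<xi> \<and>
     (\<exists>T\<in>carrier_mat (rep_dim \<xi>) (rep_dim \<xi>). mat_adjoint T * T = 1\<^sub>m (rep_dim \<xi>) \<and>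
        (\<forall>x. \<eta> x = T * \<xi> x * mat_adjoint T))}"

definition dual :: "'g rep set set" where
  "dual = irreps // rep_equiv"

definition lambda :: "('g operator \<Rightarrow> 'g operator \<Rightarrow> real) \<Rightarrow> 'g rep \<Rightarrow> real" where
  "lambda ip \<xi> = (THE l. l \<ge> 0 \<and> (\<forall>i<rep_dim \<xi>. \<forall>j<rep_dim \<xi>. \<forall>x.
      laplacian ip (\<lambda>y. \<xi> y $$ (i, j)) x = - complex_of_real (l\<^sup>2) * \<xi> x $$ (i, j)))"

definition bracket :: "('g operator \<Rightarrow> 'g operator \<Rightarrow> real) \<Rightarrow> 'g rep \<Rightarrow> real" where
  "bracket ip \<xi> = sqrt (1 + (lambda ip \<xi>)\<^sup>2)"


subsection \<open>Distributions\<close>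

text \<open>Functionals continuous for the usual topology of \<open>C\<^sup>\<infinity>(G)\<close>, i.e. the one given by the
  seminorms \<open>f \<mapsto> sup |P f|\<close> with \<open>P\<close> ranging over the differential operators.  Values on functions
  that are not smooth are irrelevant.  A function \<open>f\<close> is identified with the distribution
  \<open>h \<mapsto> \<integral> f h d\<mu>\<close>.\<close>

definition distribution :: "'g dist \<Rightarrow> bool" where
  "distribution T \<longleftrightarrow>
     (\<forall>f\<in>Cinf. \<forall>g\<in>Cinf. T (\<lambda>x. f x + g x) = T f + T g) \<and>
     (\<forall>f\<in>Cinf. \<forall>c. T (\<lambda>x. c * f x) = c * T f) \<and>
     (\<exists>(C::real) \<P>. finite \<P> \<and> (\<forall>P\<in>\<P>. \<exists>k. diff_op k P) \<and>
        (\<forall>f\<in>Cinf. cmod (T f) \<le> C * (\<Sum>P\<in>\<P>. SUP x. cmod (P f x))))"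

definition times_dist :: "('g \<Rightarrow> complex) \<Rightarrow> 'g dist \<Rightarrow> 'g dist" where
  "times_dist q T = (\<lambda>h. T (\<lambda>x. q x * h x))"

text \<open>The matrix \<open>\<integral> T(x) \<xi>(x)\<^sup>* dx\<close>.\<close>

definition fourier :: "'g dist \<Rightarrow> 'g rep \<Rightarrow> complex mat" where
  "fourier T \<xi> = mat (rep_dim \<xi>) (rep_dim \<xi>) (\<lambda>(i, j). T (\<lambda>x. mat_adjoint (\<xi> x) $$ (i, j)))"

definition sing_supp :: "'g measure \<Rightarrow> 'g dist \<Rightarrow> 'g set" where
  "sing_supp \<mu> T = - \<Union>{W. open W \<and> (\<exists>f. smooth_fun_on W f \<and>
     (\<forall>h\<in>Cinf. closure {x. h x \<noteq> 0} \<subseteq> W \<longrightarrow> T h = (\<integral>x. f x * h x \<partial>\<mu>)))}"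


subsection \<open>Difference operators\<close>

text \<open>\<open>Pq(e) = 0\<close> for all left-invariant \<open>P\<close> of order at most \<open>k - 1\<close>; no condition for \<open>k = 0\<close>.\<close>

definition vanishes_of_order :: "nat \<Rightarrow> ('g \<Rightarrow> complex) \<Rightarrow> bool" where
  "vanishes_of_order k q \<longleftrightarrow> q \<in> Cinf \<and> (\<forall>j<k. \<forall>P\<in>LDiff j. P q \<one> = 0)"

text \<open>The difference operator of \<open>q\<close>, given by its graph \<open>{(\<F> f, \<F> (q f))}\<close>, with \<open>f\<close> ranging over
  all distributions.  Functions on the dual are compared on irreducible representations only; up to
  this the graph is single-valued, the Fourier transform being injective.\<close>

definition difference :: "('g \<Rightarrow> complex) \<Rightarrow> (('g rep \<Rightarrow> complex mat) \<times> ('g rep \<Rightarrow> complex mat)) set" where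
  "difference q = {(\<tau>, \<tau>'). \<exists>f. distribution f \<and>
     (\<forall>\<xi>\<in>irreps. \<tau> \<xi> = fourier f \<xi> \<and> \<tau>' \<xi> = fourier (times_dist q f) \<xi>)}"

definition difference_power ::
  "(nat \<Rightarrow> 'g \<Rightarrow> complex) \<Rightarrow> (nat \<Rightarrow> nat) \<Rightarrow> (('g rep \<Rightarrow> complex mat) \<times> ('g rep \<Rightarrow> complex mat)) set" where
  "difference_power q \<alpha> = foldr (\<lambda>i R. R O (difference (q i) ^^ \<alpha> i)) [0..<n] Id"

text \<open>The differential \<open>dq(e)\<close> is the functional \<open>X \<mapsto> (X q)(e)\<close> on the Lie algebra.\<close>

definition differentials_independent :: "(nat \<Rightarrow> 'g \<Rightarrow> complex) \<Rightarrow> nat set \<Rightarrow> bool" where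
  "differentials_independent q J \<longleftrightarrow>
     (\<forall>c :: nat \<Rightarrow> complex. (\<forall>X\<in>lie_algebra. (\<Sum>j\<in>J. c j * X (q j) \<one>) = 0) \<longrightarrow> (\<forall>j\<in>J. c j = 0))"

definition differentials_rank :: "nat \<Rightarrow> (nat \<Rightarrow> 'g \<Rightarrow> complex) \<Rightarrow> nat" where
  "differentials_rank K q = Max {card J | J. J \<subseteq> {..<K} \<and> differentials_independent q J}"

definition admissible :: "nat \<Rightarrow> (nat \<Rightarrow> 'g \<Rightarrow> complex) \<Rightarrow> bool" where
  "admissible K q \<longleftrightarrow> K \<ge> n \<and> (\<forall>j<K. vanishes_of_order 1 (q j)) \<and>
     (\<forall>j<K. \<exists>X\<in>lie_algebra. X (q j) \<one> \<noteq> 0) \<and> differentials_rank K q = n"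

definition strongly_admissible :: "nat \<Rightarrow> (nat \<Rightarrow> 'g \<Rightarrow> complex) \<Rightarrow> bool" where
  "strongly_admissible K q \<longleftrightarrow> admissible K q \<and> (\<Inter>j<K. {x. q j x = 0}) = {\<one>}"


subsection \<open>Operators, symbols and kernels\<close>

text \<open>Linear continuous maps from \<open>C\<^sup>\<infinity>(G)\<close> to the distributions with the weak-* topology.\<close>

definition continuous_operator :: "(('g \<Rightarrow> complex) \<Rightarrow> 'g dist) \<Rightarrow> bool" where
  "continuous_operator A \<longleftrightarrow>
     (\<forall>f\<in>Cinf. distribution (A f)) \<and> (\<forall>h\<in>Cinf. distribution (\<lambda>f. A f h))"

text \<open>The distribution \<open>\<xi>\<^sup>* (A \<xi>)\<close> is the smooth function \<open>\<sigma>(\<cdot>, \<xi>)\<close>, entry by entry.\<close>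

definition is_symbol ::
  "'g measure \<Rightarrow> (('g \<Rightarrow> complex) \<Rightarrow> 'g dist) \<Rightarrow> ('g \<Rightarrow> 'g rep \<Rightarrow> complex mat) \<Rightarrow> bool" where
  "is_symbol \<mu> A \<sigma> \<longleftrightarrow> (\<forall>\<xi>\<in>irreps.
     (\<forall>x. \<sigma> x \<xi> \<in> carrier_mat (rep_dim \<xi>) (rep_dim \<xi>)) \<and>
     (\<forall>i<rep_dim \<xi>. \<forall>j<rep_dim \<xi>. (\<lambda>x. \<sigma> x \<xi> $$ (i, j)) \<in> Cinf \<and>
        (\<forall>h\<in>Cinf. (\<integral>x. \<sigma> x \<xi> $$ (i, j) * h x \<partial>\<mu>) =
           (\<Sum>k<rep_dim \<xi>. times_dist (\<lambda>x. mat_adjoint (\<xi> x) $$ (i, k)) (A (\<lambda>x. \<xi> x $$ (k, j))) h))))"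

text \<open>\<open>(A f)(x) = \<integral> f(y) R(x, y\<^sup>-\<^sup>1 x) dy\<close>, after the substitution \<open>z = y\<^sup>-\<^sup>1 x\<close>.\<close>

definition right_kernel ::
  "'g measure \<Rightarrow> (('g \<Rightarrow> complex) \<Rightarrow> 'g dist) \<Rightarrow> ('g \<Rightarrow> 'g dist) \<Rightarrow> bool" where
  "right_kernel \<mu> A R \<longleftrightarrow> (\<forall>x. distribution (R x)) \<and>
     (\<forall>f\<in>Cinf. (\<lambda>x. R x (\<lambda>z. f (x \<otimes> inv z))) \<in> Cinf \<and>
        (\<forall>h\<in>Cinf. A f h = (\<integral>x. R x (\<lambda>z. f (x \<otimes> inv z)) * h x \<partial>\<mu>)))"

definition apply_x ::
  "'g operator \<Rightarrow> ('g \<Rightarrow> 'g rep \<Rightarrow> complex mat) \<Rightarrow> 'g \<Rightarrow> 'g rep \<Rightarrow> complex mat" where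
  "apply_x P \<sigma> x \<xi> = mat (rep_dim \<xi>) (rep_dim \<xi>) (\<lambda>(i, j). P (\<lambda>y. \<sigma> y \<xi> $$ (i, j)) x)"

definition op_norm :: "complex mat \<Rightarrow> real" where
  "op_norm M = Sup {L2_set (\<lambda>i. cmod (vec_index (M *\<^sub>v v) i)) {..<dim_row M} | v.
     v \<in> carrier_vec (dim_col M) \<and> L2_set (\<lambda>i. cmod (vec_index v i)) {..<dim_col M} \<le> 1}"

text \<open>\<open>\<parallel>Q\<^sub>\<xi> P\<^sub>x \<sigma>(x, \<xi>)\<parallel> \<le> C \<langle>\<xi>\<rangle>\<^sup>r\<close> for all \<open>x\<close> and \<open>\<xi>\<close>, with the operator \<open>Q\<close> given by its
  graph; in particular \<open>Q\<close> is required to be applicable to \<open>P\<^sub>x \<sigma>(x, \<cdot>)\<close>.\<close>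

definition symbol_estimate ::
  "('g operator \<Rightarrow> 'g operator \<Rightarrow> real) \<Rightarrow> ('g \<Rightarrow> 'g rep \<Rightarrow> complex mat) \<Rightarrow>
   (('g rep \<Rightarrow> complex mat) \<times> ('g rep \<Rightarrow> complex mat)) set \<Rightarrow> 'g operator \<Rightarrow> real \<Rightarrow> bool" where
  "symbol_estimate ip \<sigma> Q P r \<longleftrightarrow> (\<exists>C. \<forall>x. \<exists>\<tau>. (apply_x P \<sigma> x, \<tau>) \<in> Q \<and>
     (\<forall>\<Xi>\<in>dual. \<forall>\<xi>\<in>\<Xi>. op_norm (\<tau> \<xi>) \<le> C * bracket ip \<xi> powr r))"

definition condition_B where
  "condition_B \<mu> ip m A \<longleftrightarrow> (\<exists>\<sigma>. is_symbol \<mu> A \<sigma> \<and>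
     (\<forall>k l P q. P \<in> LDiff k \<longrightarrow> vanishes_of_order l q \<longrightarrow>
        symbol_estimate ip \<sigma> (difference q) P (m - real l)))"

definition condition_C where
  "condition_C \<mu> ip X m A \<longleftrightarrow> (\<exists>\<sigma>. is_symbol \<mu> A \<sigma> \<and>
     (\<forall>q. admissible n q \<longrightarrow> (\<forall>\<alpha> \<beta>.
        symbol_estimate ip \<sigma> (difference_power q \<alpha>) (partial X \<beta>) (m - real (\<Sum>i<n. \<alpha> i))))) \<and>
     (\<exists>R. right_kernel \<mu> A R \<and> (\<forall>x. sing_supp \<mu> (R x) \<subseteq> {\<one>}))"

definition condition_D where
  "condition_D \<mu> ip X m A \<longleftrightarrow> (\<exists>\<sigma>. is_symbol \<mu> A \<sigma> \<and>
     (\<exists>q. strongly_admissible n q \<and> (\<forall>\<alpha> \<beta>.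
        symbol_estimate ip \<sigma> (difference_power q \<alpha>) (partial X \<beta>) (m - real (\<Sum>i<n. \<alpha> i)))))"

text \<open>\<open>A\<^sub>u f = A(f \<circ> \<phi>) \<circ> \<phi>\<^sup>-\<^sup>1\<close> with \<open>\<phi>(x) = x u\<close>.  As \<open>\<phi>\<close> preserves the Haar measure, the
  composition of a distribution \<open>T\<close> with \<open>\<phi>\<^sup>-\<^sup>1\<close> is \<open>h \<mapsto> T (h \<circ> \<phi>)\<close>.\<close>

definition dist_comp_inv :: "'g dist \<Rightarrow> ('g \<Rightarrow> 'g) \<Rightarrow> 'g dist" where
  "dist_comp_inv T \<phi> = (\<lambda>h. T (h \<circ> \<phi>))"

definition translated_operator :: "'g \<Rightarrow> (('g \<Rightarrow> complex) \<Rightarrow> 'g dist) \<Rightarrow> ('g \<Rightarrow> complex) \<Rightarrow> 'g dist" where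
  "translated_operator u A f = dist_comp_inv (A (f \<circ> (\<lambda>x. x \<otimes> u))) (\<lambda>x. x \<otimes> u)"

end

end

theory Submission
  imports Defs
begin

text \<open>The symbol of the translated operator is \<open>\<xi>(u)\<^sup>* \<sigma>(x u\<^sup>-\<^sup>1, \<xi>) \<xi>(u)\<close>.  The conjugation by the unitary
  matrix \<open>\<xi>(u)\<close> does not change operator norms; on the level of distributions it is the pull-back along
  \<open>c(x) = u\<^sup>-\<^sup>1 x u\<close>, so that it turns the difference operator of \<open>q\<close> into that of \<open>q \<circ> c\<close>, and the
  translation in \<open>x\<close> turns a left-invariant operator into its conjugate by a right translation, which is again
  left-invariant.  For conditions (C) and (D) the conjugated frame has to be expressed by the given one:
  the Lie algebra has dimension at most \<open>n\<close> (Hadamard's lemma), and the monomials in the given frame can be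
  put in order modulo monomials of lower degree, as in the easy half of the theorem of Poincare, Birkhoff and
  Witt.  As all functionals involved are linear on smooth functions only, the argument also needs
  that continuous irreducible representations are smooth.\<close>

section \<open>Calculus on relatively open subsets of a subspace\<close>

text \<open>In (C) and (D) only ordered monomials in one fixed frame are controlled, and translating
  in x turns such a monomial into one in another frame. Expanding it over \<open>X\<close> produces
  words in arbitrary order, so linear algebra on fields is not enough: the commutators have to be
  absorbed by induction on the degree. Nothing is lost in this, because the exponent m - |\<alpha>|
  does not depend on the derivatives in x; for a fixed \<alpha> the operators satisfying the
  estimate form a vector space, and the estimates for all \<beta> are used together. A difference
  operator is a relation between families of matrices that are determined on irreducible
  representations only. Identities between such operators are therefore not rewritten; instead a
  relation between arguments is carried to one between values, step by step along the composition.
  Smoothness is defined by iterated directional derivatives on relatively open subsets of a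
  subspace. The chain rule, differentiation under the integral and Hadamard's lemma are established
  in this form, since charts, averages over the group and tangent vectors at the unit rest on
  them.\<close>

lemma open_line_preimage:
  fixes V :: "'a::real_normed_vector set"
  assumes "Real_Vector_Spaces.subspace V" "openin (top_of_set V) U" "x \<in> V" "v \<in> V"
  shows "open {t::real. x + t *\<^sub>R v \<in> U}"
proof -
  obtain T where T: "open T" "U = V \<inter> T"
    using assms(2) openin_open by blast
  have "{t::real. x + t *\<^sub>R v \<in> U} = (\<lambda>t. x + t *\<^sub>R v) -` T"
    using T assms by (auto simp: Real_Vector_Spaces.subspace_add Real_Vector_Spaces.subspace_scale)
  moreover have "open ((\<lambda>t. x + t *\<^sub>R v) -` T)"
    by (intro open_vimage T continuous_intros)
  ultimately show ?thesis by simp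
qed

lemma eventually_line:
  fixes V :: "'a::real_normed_vector set"
  assumes "Real_Vector_Spaces.subspace V" "openin (top_of_set V) U" "x \<in> U" "v \<in> V"
  shows "eventually (\<lambda>t::real. x + t *\<^sub>R v \<in> U) (nhds 0)"
proof -
  have "x \<in> V" using assms openin_imp_subset by blast
  with open_line_preimage[OF assms(1,2) this assms(4)] show ?thesis
    unfolding eventually_nhds using assms(3) by (intro exI[of _ "{t::real. x + t *\<^sub>R v \<in> U}"]) auto
qed

lemma dir_deriv_works:
  "(\<lambda>t::real. f (x + t *\<^sub>R v)) differentiable (at 0) \<longleftrightarrow>
   ((\<lambda>t. f (x + t *\<^sub>R v)) has_vector_derivative dir_deriv v f x) (at 0)"
  unfolding dir_deriv_def by (rule vector_derivative_works)

lemma dir_deriv_eqI: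
  "((\<lambda>t. f (x + t *\<^sub>R v)) has_vector_derivative D) (at 0) \<Longrightarrow> dir_deriv v f x = D"
  unfolding dir_deriv_def by (rule vector_derivative_at)

text \<open>\<open>dir_deriv\<close> differentiates at parameter 0 only. Moving the base point along
  the line gives the derivative at every parameter s, as mean value arguments on a segment
  require.\<close>

lemma dir_deriv_shift:
  fixes v :: "'a::real_normed_vector"
  assumes "((\<lambda>t. f (x + s *\<^sub>R v + t *\<^sub>R v)) has_vector_derivative D) (at 0)"
  shows "((\<lambda>t. f (x + t *\<^sub>R v)) has_vector_derivative D) (at s)"
proof -
  have "((\<lambda>t. f (x + s *\<^sub>R v + t *\<^sub>R v)) \<circ> (\<lambda>r. r - s) has_vector_derivative 1 *\<^sub>R D) (at s)"
    by (rule vector_diff_chain_at) (auto intro!: derivative_eq_intros assms)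
  moreover have "(\<lambda>t. f (x + s *\<^sub>R v + t *\<^sub>R v)) \<circ> (\<lambda>r. r - s) = (\<lambda>t. f (x + t *\<^sub>R v))"
    by (simp add: o_def add.assoc flip: scaleR_add_left)
  ultimately show ?thesis by simp
qed

lemma dir_deriv_cong:
  fixes V :: "'a::real_normed_vector set"
  assumes "Real_Vector_Spaces.subspace V" "openin (top_of_set V) U" "x \<in> U" "v \<in> V"
    and "\<And>y. y \<in> U \<Longrightarrow> f y = g y"
    and "((\<lambda>t. f (x + t *\<^sub>R v)) has_vector_derivative D) (at 0)"
  shows "((\<lambda>t. g (x + t *\<^sub>R v)) has_vector_derivative D) (at 0)"
proof -
  have "x \<in> V" using assms(2,3) openin_imp_subset by blast
  show ?thesis
    by (rule has_vector_derivative_transform_within_open[OF assms(6)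
          open_line_preimage[OF assms(1,2) \<open>x \<in> V\<close> assms(4)]])
       (use assms in auto)
qed

lemma Ck_on_continuous: "Ck_on k V U f \<Longrightarrow> continuous_on U f"
  by (cases k) auto

lemma Ck_on_Suc_imp: "Ck_on (Suc k) V U f \<Longrightarrow> Ck_on k V U f"
  by (induction k arbitrary: f) auto

lemma Ck_on_has_dir_deriv:
  "Ck_on (Suc k) V U f \<Longrightarrow> v \<in> V \<Longrightarrow> x \<in> U \<Longrightarrow>
   ((\<lambda>t. f (x + t *\<^sub>R v)) has_vector_derivative dir_deriv v f x) (at 0)"
  by (simp add: dir_deriv_works[symmetric])

lemma Ck_on_subset: "Ck_on k V U f \<Longrightarrow> U' \<subseteq> U \<Longrightarrow> Ck_on k V U' f"
proof (induction k arbitrary: f)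
  case 0 then show ?case by (auto intro: continuous_on_subset)
next
  case (Suc k) then show ?case
    by (auto intro: continuous_on_subset)
qed

text \<open>Continuity on U and the difference quotients see only points of U: for x in U and v in V
  the line stays in U for small t. This matters because maps such as
  \<open>inv_into U \<phi>\<close> have arbitrary values elsewhere.\<close>

lemma Ck_on_cong:
  assumes V: "Real_Vector_Spaces.subspace V" "openin (top_of_set V) U"
    and "Ck_on k V U f" "\<And>y. y \<in> U \<Longrightarrow> f y = g y"
  shows "Ck_on k V U g"
  using assms(3,4)
proof (induction k arbitrary: f g)
  case 0 then show ?case using continuous_on_cong by fastforce
next
  case (Suc k)
  have *: "((\<lambda>t. g (x + t *\<^sub>R v)) has_vector_derivative dir_deriv v f x) (at 0)"
    if "x \<in> U" "v \<in> V" for x v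
    by (rule dir_deriv_cong[OF V that _ Ck_on_has_dir_deriv[OF Suc.prems(1)]]) (use that Suc.prems(2) in auto)
  show ?case
    unfolding Ck_on.simps
  proof (intro conjI ballI)
    show "continuous_on U g"
      using Suc.prems continuous_on_cong[of U U f g] by auto
    fix v assume v: "v \<in> V"
    show "(\<lambda>t. g (x + t *\<^sub>R v)) differentiable at 0" if "x \<in> U" for x
      using *[OF that v] by (rule differentiableI_vector)
    show "Ck_on k V U (dir_deriv v g)"
      by (rule Suc.IH[of "dir_deriv v f"]) (use Suc.prems v * dir_deriv_eqI in \<open>fastforce+\<close>)
  qed
qed

text \<open>Any formula \<open>D\<close> for the derivatives may be supplied;
  \<open>dir_deriv v f\<close> agrees with it on U and inherits its regularity by
  congruence.\<close>

lemma Ck_on_SucI: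
  assumes V: "Real_Vector_Spaces.subspace V" "openin (top_of_set V) U"
    and "continuous_on U f"
    and "\<And>v x. v \<in> V \<Longrightarrow> x \<in> U \<Longrightarrow> ((\<lambda>t. f (x + t *\<^sub>R v)) has_vector_derivative D v x) (at 0)"
    and "\<And>v. v \<in> V \<Longrightarrow> Ck_on k V U (D v)"
  shows "Ck_on (Suc k) V U f"
  unfolding Ck_on.simps
proof (intro conjI ballI)
  show "continuous_on U f" by fact
  fix v assume v: "v \<in> V"
  show "(\<lambda>t. f (x + t *\<^sub>R v)) differentiable at 0" if "x \<in> U" for x
    using assms(4)[OF v that] by (rule differentiableI_vector)
  show "Ck_on k V U (dir_deriv v f)"
    by (rule Ck_on_cong[OF V assms(5)[OF v]]) (use assms(4)[OF v] dir_deriv_eqI in fastforce)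
qed

text \<open>The function \<open>dir_deriv v f\<close> does not refer to a domain, so the
  neighbourhoods given for \<open>f\<close> serve for its derivatives too, and the induction only
  has to glue continuity.\<close>

lemma Ck_on_local:
  assumes "\<And>x. x \<in> U \<Longrightarrow> \<exists>N. openin (top_of_set V) N \<and> x \<in> N \<and> Ck_on k V N f"
    and U: "openin (top_of_set V) U"
  shows "Ck_on k V U f"
  using assms(1)
proof (induction k arbitrary: f)
  have cont: "continuous_on U f"
    if *: "\<And>x. x \<in> U \<Longrightarrow> \<exists>N. openin (top_of_set V) N \<and> x \<in> N \<and> Ck_on k V N f" 
    for k and f :: "'a \<Rightarrow> 'b"
    unfolding continuous_on_eq_continuous_within
  proof
    fix x assume x: "x \<in> U"
    obtain N where N: "openin (top_of_set V) N" "x \<in> N" "Ck_on k V N f" using *[OF x] by blast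
    obtain T where T: "open T" "N = V \<inter> T" using N(1) openin_open by blast
    have "U \<subseteq> V" using U openin_imp_subset by blast
    then have "at x within U = at x within (N \<inter> U)"
      by (intro at_within_nhd[of x T]) (use T N x in auto)
    moreover have "continuous_on (N \<inter> U) f"
      using Ck_on_continuous[OF N(3)] continuous_on_subset by blast
    ultimately show "continuous (at x within U) f"
      using x N(2) unfolding continuous_on_eq_continuous_within by auto
  qed
  {
    case 0 then show ?case using cont[of 0] by simp
  next
    case (Suc k)
    show ?case
      unfolding Ck_on.simps
    proof (intro conjI ballI)
      show "continuous_on U f" using cont Suc.prems by blast
      fix v assume v: "v \<in> V"
      show "(\<lambda>t. f (x + t *\<^sub>R v)) differentiable at 0" if "x \<in> U" for x
        using Suc.prems[OF that] v by auto
      show "Ck_on k V U (dir_deriv v f)"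
        by (rule Suc.IH) (use Suc.prems v in \<open>fastforce\<close>)
    qed
  }
qed

lemma Ck_on_const: "Ck_on k V U (\<lambda>_. c)"
proof (induction k arbitrary: c)
  case (Suc k)
  have "dir_deriv v (\<lambda>_. c) = (\<lambda>_. 0)" for v :: 'a
    by (intro ext dir_deriv_eqI) simp
  with Suc show ?case by simp
qed simp

lemma Ck_on_add:
  assumes V: "Real_Vector_Spaces.subspace V" "openin (top_of_set V) U"
  shows "Ck_on k V U f \<Longrightarrow> Ck_on k V U g \<Longrightarrow> Ck_on k V U (\<lambda>x. f x + g x)"
proof (induction k arbitrary: f g)
  case 0 then show ?case by (auto intro: continuous_intros)
next
  case (Suc k)
  show ?case
  proof (rule Ck_on_SucI[OF V, where D = "\<lambda>v x. dir_deriv v f x + dir_deriv v g x"])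
    show "continuous_on U (\<lambda>x. f x + g x)"
      using Suc.prems by (auto intro: continuous_intros)
  next
    fix v x assume "v \<in> V" "x \<in> U"
    then show "((\<lambda>t. f (x + t *\<^sub>R v) + g (x + t *\<^sub>R v)) has_vector_derivative
        dir_deriv v f x + dir_deriv v g x) (at 0)"
      using Suc.prems by (intro has_vector_derivative_add Ck_on_has_dir_deriv)
  next
    fix v assume "v \<in> V"
    then show "Ck_on k V U (\<lambda>x. dir_deriv v f x + dir_deriv v g x)"
      using Suc by auto
  qed
qed

lemma Ck_on_sum:
  assumes V: "Real_Vector_Spaces.subspace V" "openin (top_of_set V) U"
    and "\<And>i. i \<in> I \<Longrightarrow> Ck_on k V U (f i)"
  shows "Ck_on k V U (\<lambda>x. \<Sum>i\<in>I. f i x)"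
  using assms(3)
proof (induction I rule: infinite_finite_induct)
  case (insert i I)
  then show ?case by (simp add: Ck_on_add[OF V])
qed (auto intro: Ck_on_const)

lemma Ck_on_bounded_linear:
  assumes V: "Real_Vector_Spaces.subspace V" "openin (top_of_set V) U" and "bounded_linear L"
  shows "Ck_on k V U f \<Longrightarrow> Ck_on k V U (\<lambda>x. L (f x))"
proof (induction k arbitrary: f)
  case 0 then show ?case using assms(3) by (auto intro: bounded_linear.continuous_on)
next
  case (Suc k)
  show ?case
  proof (rule Ck_on_SucI[OF V, where D = "\<lambda>v x. L (dir_deriv v f x)"])
    show "continuous_on U (\<lambda>x. L (f x))"
      using Suc.prems assms(3) by (auto intro: bounded_linear.continuous_on)
  next
    fix v x assume "v \<in> V" "x \<in> U"
    then show "((\<lambda>t. L (f (x + t *\<^sub>R v))) has_vector_derivative L (dir_deriv v f x)) (at 0)"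
      using Suc.prems by (intro bounded_linear.has_vector_derivative[OF assms(3)] Ck_on_has_dir_deriv)
  next
    fix v assume "v \<in> V"
    then show "Ck_on k V U (\<lambda>x. L (dir_deriv v f x))"
      using Suc by auto
  qed
qed

lemma Ck_on_bilinear:
  assumes V: "Real_Vector_Spaces.subspace V" "openin (top_of_set V) U" and "bounded_bilinear prd"
  shows "Ck_on k V U f \<Longrightarrow> Ck_on k V U g \<Longrightarrow> Ck_on k V U (\<lambda>x. prd (f x) (g x))"
proof (induction k arbitrary: f g)
  case 0 then show ?case using assms(3) by (auto intro: bounded_bilinear.continuous_on)
next
  case (Suc k)
  show ?case
  proof (rule Ck_on_SucI[OF V, where D = "\<lambda>v x. prd (f x) (dir_deriv v g x) + prd (dir_deriv v f x) (g x)"])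
    show "continuous_on U (\<lambda>x. prd (f x) (g x))"
      using Suc.prems assms(3) by (auto intro: bounded_bilinear.continuous_on)
  next
    fix v x assume vx: "v \<in> V" "x \<in> U"
    show "((\<lambda>t. prd (f (x + t *\<^sub>R v)) (g (x + t *\<^sub>R v))) has_vector_derivative
       prd (f x) (dir_deriv v g x) + prd (dir_deriv v f x) (g x)) (at 0)"
      using bounded_bilinear.has_vector_derivative[OF assms(3)
          Ck_on_has_dir_deriv[OF Suc.prems(1) vx] Ck_on_has_dir_deriv[OF Suc.prems(2) vx]] by simp
  next
    fix v assume "v \<in> V"
    then have "Ck_on k V U f" "Ck_on k V U (dir_deriv v f)" "Ck_on k V U g" "Ck_on k V U (dir_deriv v g)"
      using Suc.prems Ck_on_Suc_imp by auto
    then show "Ck_on k V U (\<lambda>x. prd (f x) (dir_deriv v g x) + prd (dir_deriv v f x) (g x))"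
      by (intro Ck_on_add[OF V] Suc.IH)
  qed
qed

text \<open>Used for the slices b to (b, c) and b to (c, b) of a product, which reduce one-sided
  translations to multiplication, and for coordinates centred at a point.\<close>

lemma Ck_on_affine:
  assumes V: "Real_Vector_Spaces.subspace V" "openin (top_of_set V) U" and L: "bounded_linear L"
  shows "Ck_on k V U (\<lambda>x. c + L x)"
proof (cases k)
  case 0
  then show ?thesis
    by (simp add: continuous_on_add continuous_on_const linear_continuous_on[OF L])
next
  case (Suc k')
  show ?thesis unfolding Suc
  proof (rule Ck_on_SucI[OF V, where D = "\<lambda>v x. L v"])
    show "continuous_on U (\<lambda>x. c + L x)"
      by (simp add: continuous_on_add continuous_on_const linear_continuous_on[OF L])
    show "((\<lambda>t. c + L (x + t *\<^sub>R v)) has_vector_derivative L v) (at 0)" for v x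
    proof -
      have "(\<lambda>t. c + L (x + t *\<^sub>R v)) = (\<lambda>t. c + (L x + t *\<^sub>R L v))"
        using L by (auto simp: linear_simps)
      moreover have "((\<lambda>t. c + (L x + t *\<^sub>R L v)) has_vector_derivative L v) (at 0)"
        by (auto intro!: derivative_eq_intros)
      ultimately show ?thesis by simp
    qed
  qed (rule Ck_on_const)
qed

section \<open>Orthonormal coordinates, total derivatives and the chain rule\<close>

definition orthonormal_basis :: "'a::euclidean_space set \<Rightarrow> 'a set \<Rightarrow> bool" where
  "orthonormal_basis V B \<longleftrightarrow> B \<subseteq> V \<and> finite B \<and> card B = Real_Vector_Spaces.dim V \<and>
     (\<forall>a\<in>B. \<forall>b\<in>B. inner a b = (if a = b then 1 else 0)) \<and> (\<forall>h\<in>V. (\<Sum>b\<in>B. (inner h b) *\<^sub>R b) = h)"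

lemma orthonormal_basis_exists:
  fixes V :: "'a::euclidean_space set"
  assumes "Real_Vector_Spaces.subspace V"
  obtains B where "orthonormal_basis V B"
proof -
  obtain B where B: "B \<subseteq> V" "pairwise Linear_Algebra.orthogonal B" "\<And>b. b \<in> B \<Longrightarrow> norm b = 1"
      "Real_Vector_Spaces.independent B" "card B = Real_Vector_Spaces.dim V" "Real_Vector_Spaces.span B = V"
    using orthonormal_basis_subspace[OF assms] by metis
  have fB: "finite B" using B(4) independent_imp_finite by blast
  have "(\<Sum>b\<in>B. (inner h b) *\<^sub>R b) = h" if "h \<in> V" for h
    by (rule orthonormal_basis_expand) (use B fB that in auto)
  moreover have "inner a b = (if a = b then 1 else 0)" if "a \<in> B" "b \<in> B" for a b
    using B(2,3) that by (auto simp: pairwise_def Linear_Algebra.orthogonal_def norm_eq_1)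
  ultimately show thesis using that[of B] B fB unfolding orthonormal_basis_def by auto
qed

text \<open>Continuous partial derivatives give a total derivative. \<open>Ck_on\<close> mentions
  derivatives along lines only, while the chain rule needs them along curves.\<close>

lemma Ck_on_imp_has_derivative:
  fixes V :: "'a::euclidean_space set" and f :: "'a \<Rightarrow> 'b::real_normed_vector"
  assumes V: "Real_Vector_Spaces.subspace V" "openin (top_of_set V) U" and f: "Ck_on 1 V U f"
    and B: "orthonormal_basis V B"
    and x: "x \<in> U"
  shows "(f has_derivative (\<lambda>h. \<Sum>b\<in>B. (inner h b) *\<^sub>R dir_deriv b f x)) (at x within U)"
proof -
  have UV: "U \<subseteq> V" using V openin_imp_subset by blast
  have BV: "B \<subseteq> V" "finite B" and nB: "norm b = 1" if "b \<in> B" for b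
    using B that by (auto simp: orthonormal_basis_def norm_eq_1)
  have fB: "finite B" using B by (auto simp: orthonormal_basis_def)
  have dd: "((\<lambda>t. f (y + t *\<^sub>R v)) has_vector_derivative dir_deriv v f y) (at 0)"
    if "y \<in> U" "v \<in> V" for y v
    using Ck_on_has_dir_deriv[OF _ that(2,1), of 0] f by simp
  have cont: "continuous_on U (dir_deriv v f)" if "v \<in> V" for v
    using f that by auto
  obtain r where r: "r > 0" "\<And>y. y \<in> V \<Longrightarrow> dist y x < r \<Longrightarrow> y \<in> U"
    using V(2) x unfolding openin_euclidean_subtopology_iff by blast
  text \<open>Telescoping along the coordinate axes in \<open>S\<close>, with the mean value inequality on each.\<close>
  have main: "\<exists>d>0. \<forall>y\<in>V. dist y x < d \<longrightarrow> (\<forall>c. (\<forall>b\<in>S. \<bar>c b\<bar> < d) \<longrightarrow>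
      norm (f (y + (\<Sum>b\<in>S. c b *\<^sub>R b)) - f y - (\<Sum>b\<in>S. c b *\<^sub>R dir_deriv b f x)) \<le> e * (\<Sum>b\<in>S. \<bar>c b\<bar>))"
    if "finite S" "S \<subseteq> B" "e > 0" for S e
    using that
  proof (induction S rule: finite_induct)
    case empty
    then show ?case by (auto intro!: exI[of _ 1])
  next
    case (insert a S)
    then obtain d where d: "d > 0" "\<And>y c. y \<in> V \<Longrightarrow> dist y x < d \<Longrightarrow> (\<forall>b\<in>S. \<bar>c b\<bar> < d) \<Longrightarrow>
      norm (f (y + (\<Sum>b\<in>S. c b *\<^sub>R b)) - f y - (\<Sum>b\<in>S. c b *\<^sub>R dir_deriv b f x)) \<le> e * (\<Sum>b\<in>S. \<bar>c b\<bar>)"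
      by auto
    have a: "a \<in> V" "norm a = 1" using insert BV nB by auto
    obtain d1 where d1: "d1 > 0" "\<And>y. y \<in> U \<Longrightarrow> dist y x < d1 \<Longrightarrow> norm (dir_deriv a f y - dir_deriv a f x) < e"
      using cont[OF a(1)] x \<open>e > 0\<close> unfolding continuous_on_iff dist_norm by metis
    \<comment> \<open>One move along the axis \<open>a\<close> at most doubles the distance to x.
      Half of \<open>d\<close> leaves room for the induction hypothesis at \<open>?z\<close>, half
      of \<open>d1\<close> for the continuity of the derivative, half of \<open>r\<close> for
      staying in U.\<close>
    define \<delta> where "\<delta> = min (d/2) (min (d1/2) (r/2))"
    have \<delta>: "\<delta> > 0" "2 * \<delta> \<le> d" "2 * \<delta> \<le> d1" "2 * \<delta> \<le> r" using d d1 r by (auto simp: \<delta>_def)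
    show ?case
    proof (intro exI[of _ \<delta>] conjI ballI impI allI)
      show "\<delta> > 0" by (rule \<delta>)
      fix y c assume y: "y \<in> V" "dist y x < \<delta>" and c: "\<forall>b\<in>insert a S. \<bar>c b\<bar> < \<delta>"
      let ?z = "y + c a *\<^sub>R a"
      have seg: "y + t *\<^sub>R a \<in> V" "dist (y + t *\<^sub>R a) x < 2 * \<delta>" if "t \<in> closed_segment 0 (c a)" for t
      proof -
        show "y + t *\<^sub>R a \<in> V" using y a V by (simp add: Real_Vector_Spaces.subspace_add Real_Vector_Spaces.subspace_scale)
        have "\<bar>t\<bar> \<le> \<bar>c a\<bar>" using that by (auto simp: closed_segment_eq_real_ivl split: if_splits)
        then have "\<bar>t\<bar> < \<delta>" using c by auto
        then have "norm (t *\<^sub>R a) < \<delta>" using a by simp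
        have "dist (y + t *\<^sub>R a) x \<le> dist y x + norm (t *\<^sub>R a)"
          by (metis add.commute add_diff_eq dist_norm norm_triangle_ineq)
        then show "dist (y + t *\<^sub>R a) x < 2 * \<delta>" using \<open>norm (t *\<^sub>R a) < \<delta>\<close> y by simp
      qed
      have segU: "y + t *\<^sub>R a \<in> U" if "t \<in> closed_segment 0 (c a)" for t
        using seg[OF that] r(2) \<delta> by force
      have 1: "norm (f ?z - f y - c a *\<^sub>R dir_deriv a f x) \<le> \<bar>c a\<bar> * e"
      proof -
        define g where "g t = f (y + t *\<^sub>R a) - t *\<^sub>R dir_deriv a f x" for t
        have "norm (g (c a) - g 0) \<le> e * norm (c a - 0)"
        proof (rule differentiable_bound[of "closed_segment 0 (c a)" g
              "\<lambda>t h. h *\<^sub>R (dir_deriv a f (y + t *\<^sub>R a) - dir_deriv a f x)"])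
          fix t assume t: "t \<in> closed_segment 0 (c a)"
          have "((\<lambda>t. f (y + t *\<^sub>R a)) has_vector_derivative dir_deriv a f (y + t *\<^sub>R a)) (at t)"
            by (rule dir_deriv_shift) (rule dd[OF segU[OF t] a(1)])
          then have "(g has_vector_derivative (dir_deriv a f (y + t *\<^sub>R a) - dir_deriv a f x)) (at t)"
            unfolding g_def by (auto intro!: derivative_eq_intros)
          then show "(g has_derivative (\<lambda>h. h *\<^sub>R (dir_deriv a f (y + t *\<^sub>R a) - dir_deriv a f x)))
              (at t within closed_segment 0 (c a))"
            unfolding has_vector_derivative_def by (rule has_derivative_at_withinI)
          show "onorm (\<lambda>h. h *\<^sub>R (dir_deriv a f (y + t *\<^sub>R a) - dir_deriv a f x)) \<le> e"
          proof (rule onorm_le)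
            fix h :: real
            have "norm (dir_deriv a f (y + t *\<^sub>R a) - dir_deriv a f x) \<le> e"
              using d1(2)[OF segU[OF t]] seg(2)[OF t] \<delta> by force
            then show "norm (h *\<^sub>R (dir_deriv a f (y + t *\<^sub>R a) - dir_deriv a f x)) \<le> e * norm h"
              by (simp add: mult.commute[of e] mult_left_mono)
          qed
        qed auto
        then show ?thesis by (simp add: g_def algebra_simps)
      qed
      have z: "?z \<in> V" "dist ?z x < d" using seg[of "c a"] \<delta> by auto
      have "\<forall>b\<in>S. \<bar>c b\<bar> < d" using c \<delta> by force
      then have 2: "norm (f (?z + (\<Sum>b\<in>S. c b *\<^sub>R b)) - f ?z - (\<Sum>b\<in>S. c b *\<^sub>R dir_deriv b f x)) \<le> e * (\<Sum>b\<in>S. \<bar>c b\<bar>)"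
        using d(2)[OF z] by blast
      have "f (y + (\<Sum>b\<in>insert a S. c b *\<^sub>R b)) - f y - (\<Sum>b\<in>insert a S. c b *\<^sub>R dir_deriv b f x)
        = (f ?z - f y - c a *\<^sub>R dir_deriv a f x) +
          (f (?z + (\<Sum>b\<in>S. c b *\<^sub>R b)) - f ?z - (\<Sum>b\<in>S. c b *\<^sub>R dir_deriv b f x))"
        using insert by (simp add: algebra_simps)
      also have "norm \<dots> \<le> \<bar>c a\<bar> * e + e * (\<Sum>b\<in>S. \<bar>c b\<bar>)"
        by (rule norm_triangle_le) (use 1 2 in simp)
      finally show "norm (f (y + (\<Sum>b\<in>insert a S. c b *\<^sub>R b)) - f y - (\<Sum>b\<in>insert a S. c b *\<^sub>R dir_deriv b f x))
          \<le> e * (\<Sum>b\<in>insert a S. \<bar>c b\<bar>)"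
        using insert by (simp add: algebra_simps)
    qed
  qed
  have exp: "(\<Sum>b\<in>B. (inner h b) *\<^sub>R b) = h" if "h \<in> V" for h
    using B that by (auto simp: orthonormal_basis_def)
  show ?thesis
    unfolding has_derivative_within_alt
  proof (intro conjI allI impI)
    show "bounded_linear (\<lambda>h. \<Sum>b\<in>B. (inner h b) *\<^sub>R dir_deriv b f x)"
      by (intro bounded_linear_sum bounded_linear_compose[OF bounded_linear_scaleR_left] bounded_linear_inner_left)
    fix e :: real assume e: "e > 0"
    \<comment> \<open>The sum of the absolute coordinates is at most \<open>card B\<close> times the
      norm; the summand 1 covers an empty \<open>B\<close>.\<close>
    define e' where "e' = e / (1 + real (card B))"
    have e': "e' > 0" using e by (simp add: e'_def)
    from main[OF fB order_refl e'] obtain d where d: "d > 0" 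
      "\<And>y c. y \<in> V \<Longrightarrow> dist y x < d \<Longrightarrow> (\<forall>b\<in>B. \<bar>c b\<bar> < d) \<Longrightarrow>
      norm (f (y + (\<Sum>b\<in>B. c b *\<^sub>R b)) - f y - (\<Sum>b\<in>B. c b *\<^sub>R dir_deriv b f x)) \<le> e' * (\<Sum>b\<in>B. \<bar>c b\<bar>)"
      by blast
    show "\<exists>d>0. \<forall>y\<in>U. norm (y - x) < d \<longrightarrow>
         norm (f y - f x - (\<Sum>b\<in>B. (inner (y - x) b) *\<^sub>R dir_deriv b f x)) \<le> e * norm (y - x)"
    proof (intro exI[of _ d] conjI ballI impI d)
      fix y assume y: "y \<in> U" "norm (y - x) < d"
      have yx: "y - x \<in> V" using y x UV V(1) by (auto intro: Real_Vector_Spaces.subspace_diff)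
      have le: "\<bar>inner (y - x) b\<bar> \<le> norm (y - x)" if "b \<in> B" for b
        using Cauchy_Schwarz_ineq2[of "y - x" b] nB[OF that] by simp
      have "norm (f (x + (\<Sum>b\<in>B. (inner (y - x) b) *\<^sub>R b)) - f x - (\<Sum>b\<in>B. (inner (y - x) b) *\<^sub>R dir_deriv b f x))
         \<le> e' * (\<Sum>b\<in>B. \<bar>inner (y - x) b\<bar>)"
        by (rule d(2)) (use x UV d(1) le y(2) in \<open>fastforce+\<close>)
      also have "\<dots> \<le> e' * (real (card B) * norm (y - x))"
        using le e' by (intro mult_left_mono sum_bounded_above) auto
      also have "\<dots> \<le> e * norm (y - x)"
      proof -
        have "e' * real (card B) \<le> e" using e by (simp add: e'_def field_simps)
        then show ?thesis by (metis mult.assoc mult_right_mono norm_ge_zero)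
      qed
      finally show "norm (f y - f x - (\<Sum>b\<in>B. (inner (y - x) b) *\<^sub>R dir_deriv b f x)) \<le> e * norm (y - x)"
        using exp[OF yx] by simp
    qed
  qed
qed

text \<open>The derivative of f o g in direction v is the sum over b of the coordinates of
  \<open>dir_deriv v g\<close> times \<open>dir_deriv b f \<circ> g\<close>. The second factors are
  compositions of lower order with the same inner map, hence the induction with \<open>f\<close>
  arbitrary and \<open>g\<close> fixed.\<close>

lemma Ck_on_compose:
  fixes V :: "'a::real_normed_vector set" and V' :: "'b::euclidean_space set"
    and f :: "'b \<Rightarrow> 'c::real_normed_vector"
  assumes V: "Real_Vector_Spaces.subspace V" "openin (top_of_set V) U"
    and V': "Real_Vector_Spaces.subspace V'" "openin (top_of_set V') U'"
    and "Ck_on k V U g" "Ck_on k V' U' f" "g ` U \<subseteq> U'"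
  shows "Ck_on k V U (f \<circ> g)"
  using assms(5,6)
proof (induction k arbitrary: f)
  case 0
  then show ?case using continuous_on_compose[of U g f] continuous_on_subset assms(7) by auto
next
  case (Suc k)
  obtain B where B: "orthonormal_basis V' B"
    using orthonormal_basis_exists[OF V'(1)] by metis
  have BV: "B \<subseteq> V'" using B by (simp add: orthonormal_basis_def)
  have C1: "Ck_on 1 V' U' f" using Suc.prems(2) by (cases k) (auto intro: Ck_on_continuous)
  have gk: "Ck_on k V U g" using Suc.prems(1) Ck_on_Suc_imp by blast
  have cg: "continuous_on U g" "continuous_on U' f" using Suc.prems by auto
  show ?case
  proof (rule Ck_on_SucI[OF V, where
        D = "\<lambda>v x. \<Sum>b\<in>B. (inner (dir_deriv v g x) b) *\<^sub>R (dir_deriv b f \<circ> g) x"])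
    show "continuous_on U (f \<circ> g)"
      by (rule continuous_on_compose[OF cg(1) continuous_on_subset[OF cg(2) assms(7)]])
  next
    fix v x assume vx: "v \<in> V" "x \<in> U"
    let ?S = "{t::real. x + t *\<^sub>R v \<in> U}"
    have "x \<in> V" using V vx openin_imp_subset by blast
    have oS: "open ?S" by (rule open_line_preimage[OF V \<open>x \<in> V\<close> vx(1)])
    have 0: "0 \<in> ?S" using vx by simp
    have gd: "((\<lambda>t. g (x + t *\<^sub>R v)) has_vector_derivative dir_deriv v g x) (at 0)"
      using Ck_on_has_dir_deriv[OF Suc.prems(1) vx] .
    have "((\<lambda>t. g (x + t *\<^sub>R v)) has_derivative (\<lambda>t. t *\<^sub>R dir_deriv v g x)) (at 0 within ?S)"
      using gd unfolding has_vector_derivative_def by (rule has_derivative_at_withinI)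
    moreover have "(f has_derivative (\<lambda>h. \<Sum>b\<in>B. (inner h b) *\<^sub>R dir_deriv b f (g (x + 0 *\<^sub>R v))))
        (at (g (x + 0 *\<^sub>R v)) within ((\<lambda>t. g (x + t *\<^sub>R v)) ` ?S))"
      by (rule has_derivative_subset[OF Ck_on_imp_has_derivative[OF V' C1 B]])
         (use assms(7) vx in auto)
    ultimately have "(f \<circ> (\<lambda>t. g (x + t *\<^sub>R v)) has_derivative
       (\<lambda>h. \<Sum>b\<in>B. (inner h b) *\<^sub>R dir_deriv b f (g (x + 0 *\<^sub>R v))) \<circ> (\<lambda>t. t *\<^sub>R dir_deriv v g x)) (at 0 within ?S)"
      by (rule diff_chain_within)
    then have "(f \<circ> (\<lambda>t. g (x + t *\<^sub>R v)) has_derivative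
       (\<lambda>t. t *\<^sub>R (\<Sum>b\<in>B. (inner (dir_deriv v g x) b) *\<^sub>R dir_deriv b f (g x)))) (at 0)"
      using at_within_open[OF 0 oS] by (simp add: o_def scaleR_sum_right)
    then show "((\<lambda>t. (f \<circ> g) (x + t *\<^sub>R v)) has_vector_derivative
        (\<Sum>b\<in>B. (inner (dir_deriv v g x) b) *\<^sub>R (dir_deriv b f \<circ> g) x)) (at 0)"
      unfolding has_vector_derivative_def by (simp add: o_def)
  next
    fix v assume v: "v \<in> V"
    show "Ck_on k V U (\<lambda>x. \<Sum>b\<in>B. (inner (dir_deriv v g x) b) *\<^sub>R (dir_deriv b f \<circ> g) x)"
    proof (rule Ck_on_sum[OF V])
      fix b assume b: "b \<in> B"
      have "Ck_on k V U (dir_deriv b f \<circ> g)"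
        by (rule Suc.IH[OF gk]) (use Suc.prems(2) b BV in auto)
      moreover have "Ck_on k V U (\<lambda>x. inner (dir_deriv v g x) b)"
        by (rule Ck_on_bounded_linear[OF V bounded_linear_inner_left]) (use Suc.prems(1) v in auto)
      ultimately show "Ck_on k V U (\<lambda>x. (inner (dir_deriv v g x) b) *\<^sub>R (dir_deriv b f \<circ> g) x)"
        using Ck_on_bilinear[OF V bounded_bilinear_scaleR] by blast
    qed
  qed
qed

text \<open>Linearity in the direction is not visible in the definition of \<open>dir_deriv\<close>;
  it comes from composing the total derivative with the line.\<close>

lemma dir_deriv_basis_expand:
  fixes V :: "'a::euclidean_space set"
  assumes V: "Real_Vector_Spaces.subspace V" "openin (top_of_set V) U" and f: "Ck_on 1 V U f"
    and B: "orthonormal_basis V B"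
    and x: "x \<in> U" and v: "v \<in> V"
  shows "dir_deriv v f x = (\<Sum>b\<in>B. (inner v b) *\<^sub>R dir_deriv b f x)"
proof (rule dir_deriv_eqI)
  let ?S = "{t::real. x + t *\<^sub>R v \<in> U}"
  have "x \<in> V" using V x openin_imp_subset by blast
  have oS: "open ?S" by (rule open_line_preimage[OF V \<open>x \<in> V\<close> v])
  have 0: "0 \<in> ?S" using x by simp
  have "((\<lambda>t. x + t *\<^sub>R v) has_derivative (\<lambda>t. t *\<^sub>R v)) (at 0 within ?S)"
    by (auto intro!: derivative_eq_intros)
  moreover have "(f has_derivative (\<lambda>h. \<Sum>b\<in>B. (inner h b) *\<^sub>R dir_deriv b f (x + 0 *\<^sub>R v)))
      (at (x + 0 *\<^sub>R v) within ((\<lambda>t. x + t *\<^sub>R v) ` ?S))"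
    by (rule has_derivative_subset[OF Ck_on_imp_has_derivative[OF V f B]]) (use x in auto)
  ultimately have "(f \<circ> (\<lambda>t. x + t *\<^sub>R v) has_derivative
       (\<lambda>h. \<Sum>b\<in>B. (inner h b) *\<^sub>R dir_deriv b f (x + 0 *\<^sub>R v)) \<circ> (\<lambda>t. t *\<^sub>R v)) (at 0 within ?S)"
    by (rule diff_chain_within)
  then show "((\<lambda>t. f (x + t *\<^sub>R v)) has_vector_derivative (\<Sum>b\<in>B. (inner v b) *\<^sub>R dir_deriv b f x)) (at 0)"
    using at_within_open[OF 0 oS] by (simp add: o_def scaleR_sum_right has_vector_derivative_def)
qed

section \<open>Differentiation under the integral sign\<close>

text \<open>Regularity in the first variable with derivatives jointly continuous in both, prepared
  for integration over y in a compact \<open>K\<close>. The derivative is existential so that a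
  closed formula can be supplied; values at y outside \<open>K\<close> are unconstrained.\<close>

fun Ck_param :: "nat \<Rightarrow> 'a::real_normed_vector set \<Rightarrow> 'a set \<Rightarrow> 'y::topological_space set \<Rightarrow>
    ('a \<Rightarrow> 'y \<Rightarrow> 'b::real_normed_vector) \<Rightarrow> bool" where
  "Ck_param 0 V U K F \<longleftrightarrow> continuous_on (U \<times> K) (\<lambda>(a, y). F a y)"
| "Ck_param (Suc k) V U K F \<longleftrightarrow> continuous_on (U \<times> K) (\<lambda>(a, y). F a y) \<and>
     (\<forall>v\<in>V. \<exists>D. (\<forall>x\<in>U. \<forall>y\<in>K. ((\<lambda>t::real. F (x + t *\<^sub>R v) y) has_vector_derivative D x y) (at 0)) \<and>
        Ck_param k V U K D)"

lemma Ck_param_continuous: "Ck_param k V U K F \<Longrightarrow> continuous_on (U \<times> K) (\<lambda>(a, y). F a y)"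
  by (cases k) auto

lemma norm_integral_le_const:
  fixes f :: "'y \<Rightarrow> 'b::{banach, second_countable_topology}"
  assumes "finite_measure M" "integrable M f" "\<And>y. y \<in> space M \<Longrightarrow> norm (f y) \<le> e"
  shows "norm (integral\<^sup>L M f) \<le> e * measure M (space M)"
proof -
  interpret finite_measure M by fact
  have "norm (integral\<^sup>L M f) \<le> (\<integral>y. norm (f y) \<partial>M)"
    by (rule integral_norm_bound)
  also have "\<dots> \<le> (\<integral>y. e \<partial>M)"
    using assms by (intro integral_mono) auto
  finally show ?thesis by (simp add: mult.commute)
qed

text \<open>The form of the assumption on \<open>sets M\<close> covers both Lebesgue measure
  restricted to the unit interval and, with \<open>K = UNIV\<close>, Haar measure.\<close>

lemma integrable_continuous_compact:
  fixes f :: "'y::t2_space \<Rightarrow> 'b::{banach, second_countable_topology}"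
  assumes "finite_measure M" "sets M = sets (restrict_space borel K)" "compact K" "continuous_on K f"
  shows "integrable M f"
proof -
  interpret finite_measure M by fact
  have sp: "space M = K"
    using sets_eq_imp_space_eq[OF assms(2)] by (simp add: space_restrict_space)
  have "f \<in> borel_measurable (restrict_space borel K)"
    by (rule borel_measurable_continuous_on_restrict) fact
  then have m: "f \<in> borel_measurable M"
    using measurable_cong_sets[OF assms(2) refl] by blast
  have "bounded (f ` K)"
    using assms by (intro compact_imp_bounded compact_continuous_image)
  then obtain b where "\<And>y. y \<in> K \<Longrightarrow> norm (f y) \<le> b"
    unfolding bounded_iff by auto
  then show ?thesis
    by (intro integrable_const_bound[where B = b]) (use m sp in auto)
qed

text \<open>Compactness of \<open>K\<close> makes continuity in the parameter uniform in y. The mean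
  value inequality on a segment turns this into a bound for the linearisation error that is uniform
  in y and can be integrated.\<close>

lemma Ck_on_integral:
  fixes F :: "'a::real_normed_vector \<Rightarrow> 'y::t2_space \<Rightarrow> 'b::{banach, second_countable_topology}"
  assumes V: "Real_Vector_Spaces.subspace V" "openin (top_of_set V) U"
    and M: "finite_measure M" "sets M = sets (restrict_space borel K)" and K: "compact K"
    and "Ck_param k V U K F"
  shows "Ck_on k V U (\<lambda>a. \<integral>y. F a y \<partial>M)"
  using assms(6)
proof (induction k arbitrary: F)
  have sp: "space M = K"
    using sets_eq_imp_space_eq[OF M(2)] by (simp add: space_restrict_space)
  have int: "integrable M (F a)" if "continuous_on (U \<times> K) (\<lambda>(a, y). F a y)" "a \<in> U" 
    for F :: "'a \<Rightarrow> 'y \<Rightarrow> 'b" and a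
  proof (rule integrable_continuous_compact[OF M K])
    have "continuous_on K ((\<lambda>(a, y). F a y) \<circ> (\<lambda>y. (a, y)))"
      by (rule continuous_on_compose) (use that in \<open>auto intro!: continuous_intros intro: continuous_on_subset\<close>)
    then show "continuous_on K (F a)" by (simp add: o_def)
  qed
  \<comment> \<open>The added 1 allows division by \<open>c\<close> even for a measure of mass
    zero.\<close>
  define c where "c = 1 + measure M (space M)"
  have c: "c > 0" "measure M (space M) \<le> c" unfolding c_def by (auto simp: add_pos_nonneg)
  have cont: "continuous_on U (\<lambda>a. \<integral>y. F a y \<partial>M)" if F: "continuous_on (U \<times> K) (\<lambda>(a, y). F a y)"
    for F :: "'a \<Rightarrow> 'y \<Rightarrow> 'b"
    unfolding continuous_on_topological
  proof (intro ballI allI impI)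
    fix x O' assume x: "x \<in> U" and O': "open O'" "(\<integral>y. F x y \<partial>M) \<in> O'"
    obtain e where e: "e > 0" "ball (\<integral>y. F x y \<partial>M) e \<subseteq> O'" using O' openE by blast
    define e' where "e' = e / (2 * c)"
    have e': "e' > 0" using e c by (simp add: e'_def)
    obtain X0 where X0: "x \<in> X0" "open X0"
      "\<forall>a\<in>X0 \<inter> U. \<forall>y\<in>K. dist (case (a, y) of (a, y) \<Rightarrow> F a y) (case (x, y) of (a, y) \<Rightarrow> F a y) \<le> e'"
      using continuous_on_prod_compactE[OF F K x e'] by metis
    show "\<exists>A. open A \<and> x \<in> A \<and> (\<forall>y\<in>U. y \<in> A \<longrightarrow> (\<integral>z. F y z \<partial>M) \<in> O')"
    proof (intro exI[of _ X0] conjI ballI impI X0)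
      fix a assume a: "a \<in> U" "a \<in> X0"
      have "norm (\<integral>y. F a y - F x y \<partial>M) \<le> e' * measure M (space M)"
        by (rule norm_integral_le_const[OF M(1)])
           (use X0(3) a sp int[OF F] x in \<open>auto simp: dist_norm\<close>)
      also have "\<dots> \<le> e' * c" using c e' by (intro mult_left_mono) auto
      also have "\<dots> < e" using c e by (simp add: e'_def)
      finally have "dist (\<integral>y. F x y \<partial>M) (\<integral>y. F a y \<partial>M) < e"
        using int[OF F] a x by (simp add: dist_norm norm_minus_commute)
      then show "(\<integral>y. F a y \<partial>M) \<in> O'" using e by auto
    qed
  qed
  {
    case 0
    then show ?case using cont by simp
  next
    case (Suc k)
    then have "\<forall>v\<in>V. \<exists>D. (\<forall>x\<in>U. \<forall>y\<in>K. ((\<lambda>t::real. F (x + t *\<^sub>R v) y) has_vector_derivative D x y) (at 0)) \<and>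
        Ck_param k V U K D" by simp
    then obtain D where D: "\<And>v x y. v \<in> V \<Longrightarrow> x \<in> U \<Longrightarrow> y \<in> K \<Longrightarrow>
         ((\<lambda>t::real. F (x + t *\<^sub>R v) y) has_vector_derivative D v x y) (at 0)"
      and Dk: "\<And>v. v \<in> V \<Longrightarrow> Ck_param k V U K (D v)"
      by metis
    have contF: "continuous_on (U \<times> K) (\<lambda>(a, y). F a y)" using Suc.prems by simp
    show ?case
    proof (rule Ck_on_SucI[OF V, where D = "\<lambda>v x. \<integral>y. D v x y \<partial>M"])
      show "continuous_on U (\<lambda>a. \<integral>y. F a y \<partial>M)" by (rule cont[OF contF])
      show "Ck_on k V U (\<lambda>x. \<integral>y. D v x y \<partial>M)" if "v \<in> V" for v
        using Suc.IH[OF Dk[OF that]] .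
      fix v x assume v: "v \<in> V" and x: "x \<in> U"
      have contD: "continuous_on (U \<times> K) (\<lambda>(a, y). D v a y)"
        using Ck_param_continuous[OF Dk[OF v]] .
      show "((\<lambda>t. \<integral>y. F (x + t *\<^sub>R v) y \<partial>M) has_vector_derivative (\<integral>y. D v x y \<partial>M)) (at 0)"
        unfolding has_vector_derivative_def has_derivative_within_alt
      proof (intro conjI allI impI)
        show "bounded_linear (\<lambda>t. t *\<^sub>R (\<integral>y. D v x y \<partial>M))" by (rule bounded_linear_scaleR_left)
        fix e :: real assume e: "e > 0"
        define e' where "e' = e / c"
        have e': "e' > 0" using e c by (simp add: e'_def)
        obtain X0 where X0: "x \<in> X0" "open X0"
          "\<forall>a\<in>X0 \<inter> U. \<forall>y\<in>K. dist (case (a, y) of (a, y) \<Rightarrow> D v a y) (case (x, y) of (a, y) \<Rightarrow> D v a y) \<le> e'"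
          using continuous_on_prod_compactE[OF contD K x e'] by metis
        have "eventually (\<lambda>t::real. x + t *\<^sub>R v \<in> U) (nhds 0)" by (rule eventually_line[OF V x v])
        moreover have "eventually (\<lambda>t::real. x + t *\<^sub>R v \<in> X0) (nhds 0)"
        proof -
          have "open ((\<lambda>t::real. x + t *\<^sub>R v) -` X0)"
            by (intro open_vimage X0 continuous_intros)
          then show ?thesis using X0(1) unfolding eventually_nhds
            by (intro exI[of _ "(\<lambda>t::real. x + t *\<^sub>R v) -` X0"]) auto
        qed
        ultimately have "eventually (\<lambda>t::real. x + t *\<^sub>R v \<in> X0 \<inter> U) (nhds 0)"
          by eventually_elim auto
        then obtain d where d: "d > 0" "\<And>t::real. \<bar>t\<bar> < d \<Longrightarrow> x + t *\<^sub>R v \<in> X0 \<inter> U"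
          unfolding eventually_nhds_metric by auto
        show "\<exists>d>0. \<forall>t\<in>UNIV. norm (t - 0) < d \<longrightarrow>
           norm ((\<integral>y. F (x + t *\<^sub>R v) y \<partial>M) - (\<integral>y. F (x + 0 *\<^sub>R v) y \<partial>M) - (t - 0) *\<^sub>R (\<integral>y. D v x y \<partial>M))
             \<le> e * norm (t - 0)"
        proof (intro exI[of _ d] conjI ballI impI d(1))
          fix t :: real assume "norm (t - 0) < d"
          then have t: "\<bar>t\<bar> < d" by simp
          have seg: "x + s *\<^sub>R v \<in> X0 \<inter> U" if "s \<in> closed_segment 0 t" for s
            using that t by (intro d(2)) (auto simp: closed_segment_eq_real_ivl split: if_splits)
          have pt: "norm (F (x + t *\<^sub>R v) y - F x y - t *\<^sub>R D v x y) \<le> \<bar>t\<bar> * e'" if y: "y \<in> K" for y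
          proof -
            have "norm (F (x + t *\<^sub>R v) y - F (x + 0 *\<^sub>R v) y - (t - 0) *\<^sub>R D v (x + 0 *\<^sub>R v) y) \<le> norm (t - 0) * e'"
            proof (rule vector_differentiable_bound_linearization[where S = "closed_segment 0 t"])
              fix s assume s: "s \<in> closed_segment 0 t"
              have "((\<lambda>t. F (x + t *\<^sub>R v) y) has_vector_derivative D v (x + s *\<^sub>R v) y) (at s)"
                by (rule dir_deriv_shift[where f = "\<lambda>a. F a y"]) (use D[OF v _ y] seg[OF s] in auto)
              then show "((\<lambda>t. F (x + t *\<^sub>R v) y) has_vector_derivative D v (x + s *\<^sub>R v) y)
                  (at s within closed_segment 0 t)"
                by (rule has_vector_derivative_at_within)
              show "norm (D v (x + s *\<^sub>R v) y - D v (x + 0 *\<^sub>R v) y) \<le> e'"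
                using X0(3) seg[OF s] y by (auto simp: dist_norm)
            qed auto
            then show ?thesis by simp
          qed
          have "x + t *\<^sub>R v \<in> U" using d(2)[OF t] by auto
          then have i: "integrable M (F (x + t *\<^sub>R v))" "integrable M (F x)" "integrable M (D v x)"
            using int[OF contF] int[OF contD] x by auto
          have "norm (\<integral>y. F (x + t *\<^sub>R v) y - F x y - t *\<^sub>R D v x y \<partial>M) \<le> (\<bar>t\<bar> * e') * measure M (space M)"
            by (rule norm_integral_le_const[OF M(1)]) (use pt sp i in auto)
          also have "\<dots> \<le> (\<bar>t\<bar> * e') * c" using c e' by (intro mult_left_mono) auto
          also have "\<dots> = e * \<bar>t\<bar>" using c by (simp add: e'_def)
          finally show "norm ((\<integral>y. F (x + t *\<^sub>R v) y \<partial>M) - (\<integral>y. F (x + 0 *\<^sub>R v) y \<partial>M) - (t - 0) *\<^sub>R (\<integral>y. D v x y \<partial>M))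
             \<le> e * norm (t - 0)"
            using i by simp
        qed
      qed
    qed
  }
qed

section \<open>A flat function\<close>

text \<open>The functions p(1/t) exp(-1/t), extended by 0, form a family closed under
  differentiation; the polynomial factor is there to make the induction on the order of
  differentiability possible.\<close>

definition flat_poly :: "real poly \<Rightarrow> real \<Rightarrow> real" where
  "flat_poly p t = (if t > 0 then poly p (1 / t) * exp (- (1 / t)) else 0)"

lemma flat_poly_tendsto_0: "(flat_poly p \<longlongrightarrow> 0) (at 0)"
proof (rule filterlim_split_at_real)
  have "eventually (\<lambda>t::real. t < 0) (at_left 0)"
    by (simp add: eventually_at_filter)
  then have "eventually (\<lambda>t. flat_poly p t = 0) (at_left 0)"
    by eventually_elim (simp add: flat_poly_def)
  then show "(flat_poly p \<longlongrightarrow> 0) (at_left 0)"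
    by (rule tendsto_eventually)
  have "((\<lambda>s. \<Sum>i\<le>degree p. coeff p i * (s ^ i / exp s)) \<longlongrightarrow> (\<Sum>i\<le>degree p. coeff p i * 0)) at_top"
    by (intro tendsto_sum tendsto_mult tendsto_const tendsto_power_div_exp_0)
  then have "((\<lambda>s. poly p s * exp (- s)) \<longlongrightarrow> 0) at_top"
    by (simp add: poly_altdef sum_divide_distrib exp_minus divide_inverse sum_distrib_right mult.assoc)
  moreover have "filterlim (\<lambda>t::real. 1 / t) at_top (at_right 0)"
    using filterlim_inverse_at_top_right by (simp add: inverse_eq_divide)
  ultimately have "((\<lambda>t. poly p (1 / t) * exp (- (1 / t))) \<longlongrightarrow> 0) (at_right 0)"
    by (rule filterlim_compose)
  moreover have "eventually (\<lambda>t::real. poly p (1 / t) * exp (- (1 / t)) = flat_poly p t) (at_right 0)"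
    unfolding eventually_at_filter by (auto simp: flat_poly_def)
  ultimately show "(flat_poly p \<longlongrightarrow> 0) (at_right 0)"
    by (rule Lim_transform_eventually)
qed

text \<open>For t > 0 the derivative of p(1/t) exp(-1/t) is s^2 (p - p')(s) exp(-s) at s = 1/t,
  whence the factor \<open>[:0, 0, 1:]\<close>. At 0 the difference quotient is again a member of
  the family, with polynomial s p(s), and tends to 0.\<close>

lemma flat_poly_deriv:
  "(flat_poly p has_real_derivative flat_poly ([:0, 0, 1:] * (p - pderiv p)) t) (at t)"
proof -
  consider "t > 0" | "t < 0" | "t = 0" by linarith
  then show ?thesis
  proof cases
    case 1
    have "((\<lambda>t. poly p (1 / t) * exp (- (1 / t))) has_real_derivative
       flat_poly ([:0, 0, 1:] * (p - pderiv p)) t) (at t)"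
      using 1
      by (auto intro!: derivative_eq_intros DERIV_chain2[OF poly_DERIV]
          simp: flat_poly_def field_simps power2_eq_square)
    moreover have "eventually (\<lambda>s::real. s > 0) (nhds t)"
      using 1 eventually_nhds_in_open[of "{0<..}" t] by auto
    ultimately show ?thesis
      using 1 by (subst DERIV_cong_ev[OF refl _ refl, of _ "\<lambda>t. poly p (1 / t) * exp (- (1 / t))"])
         (auto elim!: eventually_mono simp: flat_poly_def)
  next
    case 2
    have "((\<lambda>t::real. 0) has_real_derivative flat_poly ([:0, 0, 1:] * (p - pderiv p)) t) (at t)"
      using 2 by (simp add: flat_poly_def)
    moreover have "eventually (\<lambda>s::real. s < 0) (nhds t)"
      using 2 eventually_nhds_in_open[of "{..<0}" t] by auto
    ultimately show ?thesis
      by (subst DERIV_cong_ev[OF refl _ refl, of _ "\<lambda>t. 0"])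
         (auto elim!: eventually_mono simp: flat_poly_def)
  next
    case 3
    have "eventually (\<lambda>h. flat_poly ([:0, 1:] * p) h = (flat_poly p (0 + h) - flat_poly p 0) / h) (at 0)"
      unfolding eventually_at_filter by (auto simp: flat_poly_def)
    then have "((\<lambda>h. (flat_poly p (0 + h) - flat_poly p 0) / h) \<longlongrightarrow> 0) (at 0)"
      by (rule Lim_transform_eventually[OF flat_poly_tendsto_0])
    then show ?thesis using 3 by (simp add: DERIV_def flat_poly_def)
  qed
qed

lemma Ck_on_flat_poly: "Ck_on k UNIV UNIV (flat_poly p)"
proof (induction k arbitrary: p)
  have cont: "continuous_on UNIV (flat_poly p)" for p
    by (rule DERIV_continuous_on) (rule has_field_derivative_at_within[OF flat_poly_deriv])
  {
    case 0 then show ?case using cont by simp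
  next
    case (Suc k)
    show ?case
    proof (rule Ck_on_SucI[where D = "\<lambda>v x. v * flat_poly ([:0, 0, 1:] * (p - pderiv p)) x"])
      fix v x :: real
      have "((\<lambda>t. x + t *\<^sub>R v) has_vector_derivative v) (at 0)"
        by (auto intro!: derivative_eq_intros)
      moreover have "(flat_poly p has_vector_derivative flat_poly ([:0, 0, 1:] * (p - pderiv p)) x) (at (x + 0 *\<^sub>R v))"
        using flat_poly_deriv[of p x] by (simp add: has_real_derivative_iff_has_vector_derivative)
      ultimately show "((\<lambda>t. flat_poly p (x + t *\<^sub>R v)) has_vector_derivative
          v * flat_poly ([:0, 0, 1:] * (p - pderiv p)) x) (at 0)"
        using vector_diff_chain_at by (fastforce simp: o_def)
      show "Ck_on k UNIV UNIV (\<lambda>x. v * flat_poly ([:0, 0, 1:] * (p - pderiv p)) x)"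
        by (rule Ck_on_bounded_linear[OF _ _ bounded_linear_mult_right Suc.IH]) auto
    qed (use cont in auto)
  }
qed

section \<open>Hadamard's lemma\<close>

lemma openin_Int_ball: "openin (top_of_set V) (V \<inter> ball p R)"
  by (simp add: openin_open_Int)

lemma segment_in_ball:
  fixes V :: "'a::real_normed_vector set"
  assumes "Real_Vector_Spaces.subspace V" "p \<in> V" "a \<in> V \<inter> ball p R" "0 \<le> t" "t \<le> 1"
  shows "p + t *\<^sub>R (a - p) \<in> V \<inter> ball p R"
proof -
  have "norm (t *\<^sub>R (a - p)) \<le> 1 * norm (a - p)"
    unfolding norm_scaleR using assms by (intro mult_right_mono) auto
  then have "dist p (p + t *\<^sub>R (a - p)) \<le> dist p a"
    by (simp add: dist_norm norm_minus_commute)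
  then show ?thesis
    using assms by (auto intro!: Real_Vector_Spaces.subspace_add Real_Vector_Spaces.subspace_scale
        Real_Vector_Spaces.subspace_diff)
qed

text \<open>Each derivative in a brings out one factor t, so the induction carries the power
  \<open>t ^ j\<close>. The ball contains the segments to its centre, which keeps the argument of
  \<open>G\<close> inside its domain.\<close>

lemma Ck_param_dilation:
  fixes V :: "'a::real_normed_vector set"
  assumes V: "Real_Vector_Spaces.subspace V" and p: "p \<in> V"
  shows "Ck_on k V (V \<inter> ball p R) G \<Longrightarrow>
    Ck_param k V (V \<inter> ball p R) {0..1} (\<lambda>a t::real. t ^ j *\<^sub>R G (p + t *\<^sub>R (a - p)))"
proof (induction k arbitrary: j G)
  let ?U = "V \<inter> ball p R"
  have cont: "continuous_on (?U \<times> {0..1}) (\<lambda>(a, t::real). t ^ j *\<^sub>R G (p + t *\<^sub>R (a - p)))"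
    if "continuous_on ?U G" for G :: "'a \<Rightarrow> 'b" and j
  proof -
    have "continuous_on (?U \<times> {0..1}) (\<lambda>x. G (p + snd x *\<^sub>R (fst x - p)))"
      by (rule continuous_on_compose2[OF that])
         (use segment_in_ball[OF V p] in \<open>auto intro!: continuous_intros\<close>)
    then show ?thesis unfolding split_beta by (intro continuous_intros)
  qed
  {
    case 0 then show ?case using cont by simp
  next
    case (Suc k)
    show ?case
      unfolding Ck_param.simps
    proof (intro conjI ballI exI)
      show "continuous_on (?U \<times> {0..1}) (\<lambda>(a, t::real). t ^ j *\<^sub>R G (p + t *\<^sub>R (a - p)))"
        using cont Suc.prems by simp
      fix v assume v: "v \<in> V"
      show "Ck_param k V ?U {0..1} (\<lambda>a t::real. t ^ Suc j *\<^sub>R dir_deriv v G (p + t *\<^sub>R (a - p)))"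
        by (rule Suc.IH) (use Suc.prems v in auto)
      fix x and t :: real assume x: "x \<in> ?U" and t: "t \<in> {0..1}"
      let ?z = "p + t *\<^sub>R (x - p)"
      have z: "?z \<in> ?U" using segment_in_ball[OF V p x] t by auto
      have "((\<lambda>s. G (?z + s *\<^sub>R v)) has_vector_derivative dir_deriv v G ?z) (at (0 * t))"
        using Ck_on_has_dir_deriv[OF Suc.prems v z] by simp
      moreover have "((\<lambda>s. s * t) has_vector_derivative t) (at 0)"
        by (auto intro!: derivative_eq_intros simp: has_real_derivative_iff_has_vector_derivative[symmetric])
      ultimately have "((\<lambda>s. G (?z + s *\<^sub>R v)) \<circ> (\<lambda>s. s * t) has_vector_derivative t *\<^sub>R dir_deriv v G ?z) (at 0)"
        using vector_diff_chain_at by blast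
      then have "((\<lambda>s. t ^ j *\<^sub>R ((\<lambda>s. G (?z + s *\<^sub>R v)) \<circ> (\<lambda>s. s * t)) s) has_vector_derivative
            t ^ j *\<^sub>R (t *\<^sub>R dir_deriv v G ?z)) (at 0)"
        by (rule bounded_linear.has_vector_derivative[OF bounded_linear_scaleR_right])
      moreover have "?z + (s * t) *\<^sub>R v = p + t *\<^sub>R (x + s *\<^sub>R v - p)" for s
        by (simp add: algebra_simps)
      ultimately show "((\<lambda>s. t ^ j *\<^sub>R G (p + t *\<^sub>R (x + s *\<^sub>R v - p))) has_vector_derivative
          t ^ Suc j *\<^sub>R dir_deriv v G ?z) (at 0)"
        by (simp add: o_def mult.commute)
    qed
  }
qed

text \<open>The factor g_b(a) is the integral over t in [0, 1] of the derivative of \<open>F\<close>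
  in direction b at p + t (a - p). Integrating the derivative of F(p + t (a - p)) in t gives F(a) -
  F(p), and the direction a - p is expanded over \<open>B\<close>.\<close>

lemma hadamard:
  fixes V :: "'a::euclidean_space set" and F :: "'a \<Rightarrow> 'b::euclidean_space"
  assumes V: "Real_Vector_Spaces.subspace V" and p: "p \<in> V" and B: "orthonormal_basis V B"
    and F: "smooth_on V (V \<inter> ball p R) F"
  obtains g where "\<And>b. b \<in> B \<Longrightarrow> smooth_on V (V \<inter> ball p R) (g b)"
    "\<And>a. a \<in> V \<inter> ball p R \<Longrightarrow> F a = F p + (\<Sum>b\<in>B. inner (a - p) b *\<^sub>R g b a)"
proof -
  let ?U = "V \<inter> ball p R"
  let ?M = "restrict_space lborel {0..1::real}"
  have U: "openin (top_of_set V) ?U" by (rule openin_Int_ball)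
  have BV: "B \<subseteq> V" using B by (simp add: orthonormal_basis_def)
  define g where "g b a = (\<integral>t. dir_deriv b F (p + t *\<^sub>R (a - p)) \<partial>?M)" for b a
  have M: "finite_measure ?M" "sets ?M = sets (restrict_space borel {0..1::real})"
  proof -
    show "finite_measure ?M"
      by (rule finite_measureI) (simp add: emeasure_restrict_space space_restrict_space)
    show "sets ?M = sets (restrict_space borel {0..1::real})"
      by (rule sets_restrict_space_cong) simp
  qed
  have CF: "Ck_on k V ?U F" for k using F by (simp add: smooth_on_def)
  have Cd: "Ck_on k V ?U (dir_deriv v F)" if "v \<in> V" for v k
    using CF[of "Suc k"] that by simp
  have "smooth_on V ?U (g b)" if "b \<in> B" for b
    unfolding smooth_on_def g_def
  proof
    fix k
    show "Ck_on k V ?U (\<lambda>a. \<integral>t. dir_deriv b F (p + t *\<^sub>R (a - p)) \<partial>?M)"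
      by (rule Ck_on_integral[OF V U M])
         (use Ck_param_dilation[OF V p Cd[of b], where j = 0] that BV in auto)
  qed
  moreover have "F a = F p + (\<Sum>b\<in>B. inner (a - p) b *\<^sub>R g b a)" if a: "a \<in> ?U" for a
  proof -
    have ap: "a - p \<in> V" using a p V by (auto intro: Real_Vector_Spaces.subspace_diff)
    have seg: "p + t *\<^sub>R (a - p) \<in> ?U" if "0 \<le> t" "t \<le> 1" for t
      using segment_in_ball[OF V p a that] .
    have contd: "continuous_on {0..1} (\<lambda>t. dir_deriv v F (p + t *\<^sub>R (a - p)))" if "v \<in> V" for v
      by (rule continuous_on_compose2[OF Ck_on_continuous[OF Cd[OF that, of 0]]])
         (use seg in \<open>auto intro!: continuous_intros\<close>)
    have int: "integrable ?M (\<lambda>t. dir_deriv v F (p + t *\<^sub>R (a - p)))" if "v \<in> V" for v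
      by (rule integrable_continuous_compact[OF M]) (use contd[OF that] in auto)
    have "(\<integral>t. indicator {0..1} t *\<^sub>R dir_deriv (a - p) F (p + t *\<^sub>R (a - p)) \<partial>lborel)
        = F (p + 1 *\<^sub>R (a - p)) - F (p + 0 *\<^sub>R (a - p))"
    proof (rule integral_FTC_Icc)
      fix t :: real assume t: "0 \<le> t" "t \<le> 1"
      have "((\<lambda>t. F (p + t *\<^sub>R (a - p))) has_vector_derivative dir_deriv (a - p) F (p + t *\<^sub>R (a - p))) (at t)"
        by (rule dir_deriv_shift) (rule Ck_on_has_dir_deriv[OF CF[of "Suc 0"] ap seg[OF t]])
      then show "((\<lambda>t. F (p + t *\<^sub>R (a - p))) has_vector_derivative dir_deriv (a - p) F (p + t *\<^sub>R (a - p)))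
          (at t within {0..1})"
        by (rule has_vector_derivative_at_within)
    qed (use contd[OF ap] in auto)
    then have "F a - F p = (\<integral>t. dir_deriv (a - p) F (p + t *\<^sub>R (a - p)) \<partial>?M)"
      by (subst integral_restrict_space) auto
    also have "\<dots> = (\<integral>t. (\<Sum>b\<in>B. inner (a - p) b *\<^sub>R dir_deriv b F (p + t *\<^sub>R (a - p))) \<partial>?M)"
      by (rule Bochner_Integration.integral_cong)
         (use dir_deriv_basis_expand[OF V U CF B seg ap] in \<open>auto simp: space_restrict_space\<close>)
    also have "\<dots> = (\<Sum>b\<in>B. inner (a - p) b *\<^sub>R g b a)"
      unfolding g_def using int BV by (subst Bochner_Integration.integral_sum) auto
    finally show ?thesis by (simp add: algebra_simps)
  qed
  ultimately show thesis by (rule that)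
qed

section \<open>Smooth functions on the group\<close>

context compact_lie_group
begin

section \<open>Charts, and smoothness of functions as a local property\<close>

lemma closed_G [simp]: "x \<in> carrier G"
  by (simp add: carrier_UNIV)

lemma chart_open: "(U, \<phi>) \<in> \<A> \<Longrightarrow> open U"
  using atlas by (auto simp: smooth_atlas_def)

lemma chart_homeo: "(U, \<phi>) \<in> \<A> \<Longrightarrow> homeomorphism U (\<phi> ` U) \<phi> (inv_into U \<phi>)"
  using atlas by (auto simp: smooth_atlas_def)

lemma chart_image_open: "(U, \<phi>) \<in> \<A> \<Longrightarrow> openin (top_of_set V) (\<phi> ` U)"
  using atlas by (auto simp: smooth_atlas_def)

lemma chart_image_V: "(U, \<phi>) \<in> \<A> \<Longrightarrow> \<phi> ` U \<subseteq> V"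
  using chart_image_open openin_imp_subset by blast

lemma chart_continuous: "(U, \<phi>) \<in> \<A> \<Longrightarrow> continuous_on U \<phi>"
  and chart_inv_continuous: "(U, \<phi>) \<in> \<A> \<Longrightarrow> continuous_on (\<phi> ` U) (inv_into U \<phi>)"
  using chart_homeo by (auto simp: homeomorphism_def)

lemma chart_inv [simp]: "(U, \<phi>) \<in> \<A> \<Longrightarrow> x \<in> U \<Longrightarrow> inv_into U \<phi> (\<phi> x) = x"
  using chart_homeo by (auto simp: homeomorphism_def)

lemma chart_cover: obtains U \<phi> where "(U, \<phi>) \<in> \<A>" "x \<in> U"
proof -
  have "x \<in> (\<Union>(U, \<phi>)\<in>\<A>. U)" using atlas by (auto simp: smooth_atlas_def)
  then show thesis using that by auto
qed

lemma chart_transition: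
  "(U, \<phi>) \<in> \<A> \<Longrightarrow> (U', \<phi>') \<in> \<A> \<Longrightarrow> smooth_on V (\<phi> ` (U \<inter> U')) (\<phi>' \<circ> inv_into U \<phi>)"
  using atlas unfolding smooth_atlas_def by fast

lemma chart_image_openin:
  assumes "(U, \<phi>) \<in> \<A>" "open N" "N \<subseteq> U"
  shows "openin (top_of_set V) (\<phi> ` N)"
proof -
  have "openin (top_of_set U) N" using assms by (simp add: open_subset)
  then have "openin (top_of_set (\<phi> ` U)) (\<phi> ` N)"
    using homeomorphism_imp_open_map[OF chart_homeo[OF assms(1)]] by blast
  then show ?thesis using chart_image_open[OF assms(1)] openin_trans by blast
qed

text \<open>One chart around each point suffices: in any other chart the function is the given local
  representative composed with a transition map.\<close>

lemma smooth_fun_on_local: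
  assumes W: "open W"
    and loc: "\<And>p. p \<in> W \<Longrightarrow> \<exists>U \<phi> N. (U, \<phi>) \<in> \<A> \<and> open N \<and> p \<in> N \<and> N \<subseteq> U \<inter> W \<and>
       smooth_on V (\<phi> ` N) (f \<circ> inv_into U \<phi>)"
  shows "smooth_fun_on W f"
  unfolding smooth_fun_on_def smooth_on_def
proof (clarify, rule Ck_on_local)
  fix U1 \<phi>1 k assume c1: "(U1, \<phi>1) \<in> \<A>"
  show "openin (top_of_set V) (\<phi>1 ` (U1 \<inter> W))"
    using c1 W chart_open by (intro chart_image_openin) auto
  fix a assume "a \<in> \<phi>1 ` (U1 \<inter> W)"
  then obtain p where p: "p \<in> U1" "p \<in> W" "a = \<phi>1 p" by auto
  obtain U \<phi> N where c: "(U, \<phi>) \<in> \<A>" and N: "open N" "p \<in> N" "N \<subseteq> U \<inter> W"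
    and sm: "smooth_on V (\<phi> ` N) (f \<circ> inv_into U \<phi>)"
    using loc[OF p(2)] by blast
  have o1: "openin (top_of_set V) (\<phi>1 ` (U1 \<inter> N))"
    using c1 N chart_open by (intro chart_image_openin) auto
  have o2: "openin (top_of_set V) (\<phi> ` N)"
    using c N by (intro chart_image_openin) auto
  have "Ck_on k V (\<phi>1 ` (U1 \<inter> U)) (\<phi> \<circ> inv_into U1 \<phi>1)"
    using chart_transition[OF c1 c] by (simp add: smooth_on_def)
  then have "Ck_on k V (\<phi>1 ` (U1 \<inter> N)) (\<phi> \<circ> inv_into U1 \<phi>1)"
    by (rule Ck_on_subset) (use N in auto)
  moreover have "Ck_on k V (\<phi> ` N) (f \<circ> inv_into U \<phi>)" using sm by (simp add: smooth_on_def)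
  moreover have "(\<phi> \<circ> inv_into U1 \<phi>1) ` (\<phi>1 ` (U1 \<inter> N)) \<subseteq> \<phi> ` N" using c1 by auto
  ultimately have "Ck_on k V (\<phi>1 ` (U1 \<inter> N)) ((f \<circ> inv_into U \<phi>) \<circ> (\<phi> \<circ> inv_into U1 \<phi>1))"
    by (rule Ck_on_compose[OF subspace_V o1 subspace_V o2])
  then have "Ck_on k V (\<phi>1 ` (U1 \<inter> N)) (f \<circ> inv_into U1 \<phi>1)"
    by (rule Ck_on_cong[OF subspace_V o1]) (use c c1 N in auto)
  then show "\<exists>N. openin (top_of_set V) N \<and> a \<in> N \<and> Ck_on k V N (f \<circ> inv_into U1 \<phi>1)"
    using o1 p N by blast
qed

lemma smooth_fun_on_chart:
  "smooth_fun_on W f \<Longrightarrow> (U, \<phi>) \<in> \<A> \<Longrightarrow> Ck_on k V (\<phi> ` (U \<inter> W)) (f \<circ> inv_into U \<phi>)"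
  unfolding smooth_fun_on_def smooth_on_def by fast

lemma smooth_fun_onI:
  "(\<And>U \<phi> k. (U, \<phi>) \<in> \<A> \<Longrightarrow> Ck_on k V (\<phi> ` (U \<inter> W)) (f \<circ> inv_into U \<phi>)) \<Longrightarrow> smooth_fun_on W f"
  unfolding smooth_fun_on_def smooth_on_def by fast

lemma chart_openin_Int: "(U, \<phi>) \<in> \<A> \<Longrightarrow> open W \<Longrightarrow> openin (top_of_set V) (\<phi> ` (U \<inter> W))"
  by (rule chart_image_openin) (use chart_open in auto)

lemma smooth_fun_on_imp_continuous:
  assumes "open W" "smooth_fun_on W f"
  shows "continuous_on W f"
  unfolding continuous_on_eq_continuous_at[OF assms(1)]
proof
  fix x assume x: "x \<in> W"
  obtain U \<phi> where c: "(U, \<phi>) \<in> \<A>" "x \<in> U" using chart_cover .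
  have o: "open (U \<inter> W)" using chart_open[OF c(1)] assms(1) by auto
  have "continuous_on (\<phi> ` (U \<inter> W)) (f \<circ> inv_into U \<phi>)"
    using smooth_fun_on_chart[OF assms(2) c(1)] Ck_on_continuous by blast
  moreover have "continuous_on (U \<inter> W) \<phi>"
    using chart_continuous[OF c(1)] continuous_on_subset by blast
  ultimately have "continuous_on (U \<inter> W) ((f \<circ> inv_into U \<phi>) \<circ> \<phi>)"
    by (rule continuous_on_compose[rotated])
  then have "continuous_on (U \<inter> W) f"
    using c(1) by (subst continuous_on_cong[OF refl, of _ _ "(f \<circ> inv_into U \<phi>) \<circ> \<phi>"]) auto
  then show "isCont f x"
    using continuous_on_eq_continuous_at[OF o] x c by auto
qed

lemma Cinf_continuous: "f \<in> Cinf \<Longrightarrow> continuous_on UNIV f"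
  unfolding Cinf_def using smooth_fun_on_imp_continuous by auto

lemma Cinf_chart: "f \<in> Cinf \<Longrightarrow> (U, \<phi>) \<in> \<A> \<Longrightarrow> Ck_on k V (\<phi> ` U) (f \<circ> inv_into U \<phi>)"
  unfolding Cinf_def using smooth_fun_on_chart[of UNIV] by auto

lemma CinfI: "(\<And>U \<phi> k. (U, \<phi>) \<in> \<A> \<Longrightarrow> Ck_on k V (\<phi> ` U) (f \<circ> inv_into U \<phi>)) \<Longrightarrow> f \<in> Cinf"
  unfolding Cinf_def using smooth_fun_onI[of UNIV] by auto

lemma Cinf_const [simp]: "(\<lambda>x. c) \<in> Cinf"
  by (rule CinfI) (simp add: o_def Ck_on_const)

lemma Cinf_add: "f \<in> Cinf \<Longrightarrow> g \<in> Cinf \<Longrightarrow> (\<lambda>x. f x + g x) \<in> Cinf"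
proof (rule CinfI)
  fix U \<phi> k assume a: "f \<in> Cinf" "g \<in> Cinf" and c: "(U, \<phi>) \<in> \<A>"
  show "Ck_on k V (\<phi> ` U) ((\<lambda>x. f x + g x) \<circ> inv_into U \<phi>)"
    using Ck_on_add[OF subspace_V chart_image_open[OF c] Cinf_chart[OF a(1) c] Cinf_chart[OF a(2) c]]
    by (simp add: o_def)
qed

lemma Cinf_mult: "f \<in> Cinf \<Longrightarrow> g \<in> Cinf \<Longrightarrow> (\<lambda>x. f x * g x) \<in> Cinf"
proof (rule CinfI)
  fix U \<phi> k assume a: "f \<in> Cinf" "g \<in> Cinf" and c: "(U, \<phi>) \<in> \<A>"
  show "Ck_on k V (\<phi> ` U) ((\<lambda>x. f x * g x) \<circ> inv_into U \<phi>)"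
    using Ck_on_bilinear[OF subspace_V chart_image_open[OF c] bounded_bilinear_mult Cinf_chart[OF a(1) c] Cinf_chart[OF a(2) c]]
    by (simp add: o_def)
qed

lemma Cinf_cnj: "f \<in> Cinf \<Longrightarrow> (\<lambda>x. cnj (f x)) \<in> Cinf"
proof (rule CinfI)
  fix U \<phi> k assume a: "f \<in> Cinf" and c: "(U, \<phi>) \<in> \<A>"
  show "Ck_on k V (\<phi> ` U) ((\<lambda>x. cnj (f x)) \<circ> inv_into U \<phi>)"
    using Ck_on_bounded_linear[OF subspace_V chart_image_open[OF c] bounded_linear_cnj Cinf_chart[OF a c]]
    by (simp add: o_def)
qed

lemma Cinf_cmult: "f \<in> Cinf \<Longrightarrow> (\<lambda>x. c * f x) \<in> Cinf"
  using Cinf_mult[OF Cinf_const] by simp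

lemma Cinf_diff: "f \<in> Cinf \<Longrightarrow> g \<in> Cinf \<Longrightarrow> (\<lambda>x. f x - g x) \<in> Cinf"
  using Cinf_add[OF _ Cinf_cmult[of g "-1"], of f] by simp

lemma Cinf_sum: "(\<And>i. i \<in> I \<Longrightarrow> f i \<in> Cinf) \<Longrightarrow> (\<lambda>x. \<Sum>i\<in>I. f i x) \<in> Cinf"
  by (induction I rule: infinite_finite_induct) (auto intro: Cinf_add)

section \<open>Smoothness of multiplication and of translations\<close>

lemma mult_domain_openin:
  assumes c: "(U, \<phi>) \<in> \<A>" "(U', \<phi>') \<in> \<A>" and W: "open W"
  shows "openin (top_of_set (V \<times> V)) {(\<phi> x, \<phi>' y) | x y. x \<in> U \<and> y \<in> U' \<and> x \<otimes> y \<in> W}"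
proof -
  let ?m = "\<lambda>z. inv_into U \<phi> (fst z) \<otimes> inv_into U' \<phi>' (snd z)"
  let ?D = "\<phi> ` U \<times> \<phi>' ` U'"
  have eq: "{(\<phi> x, \<phi>' y) | x y. x \<in> U \<and> y \<in> U' \<and> x \<otimes> y \<in> W} = ?D \<inter> ?m -` W"
    using c by force
  have "continuous_on ?D (\<lambda>z. (inv_into U \<phi> (fst z), inv_into U' \<phi>' (snd z)))"
    by (intro continuous_intros continuous_on_compose2[OF chart_inv_continuous[OF c(1)]]
        continuous_on_compose2[OF chart_inv_continuous[OF c(2)]]) auto
  then have "continuous_on ?D (\<lambda>z. (\<lambda>(x, y). x \<otimes> y) (inv_into U \<phi> (fst z), inv_into U' \<phi>' (snd z)))"
    by (rule continuous_on_compose2[OF continuous_mult]) auto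
  then have "continuous_on ?D ?m" by simp
  then have "openin (top_of_set ?D) (?D \<inter> ?m -` W)"
    using W by (rule continuous_openin_preimage_gen)
  moreover have "openin (top_of_set (V \<times> V)) ?D"
    by (intro openin_Times chart_image_open c)
  ultimately show ?thesis unfolding eq using openin_trans by blast
qed

text \<open>The axiom on multiplication involves a chart \<omega> of the target. Near a given pair
  one such chart is fixed, and f composed with the inverse of \<omega> is the outer map of a
  composition.\<close>

lemma smooth_on_mult:
  assumes c: "(U, \<phi>) \<in> \<A>" "(U', \<phi>') \<in> \<A>" and W: "open W" and f: "smooth_fun_on W f"
  shows "Ck_on k (V \<times> V) {(\<phi> x, \<phi>' y) | x y. x \<in> U \<and> y \<in> U' \<and> x \<otimes> y \<in> W}
      (\<lambda>(a, b). f (inv_into U \<phi> a \<otimes> inv_into U' \<phi>' b))"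
proof (rule Ck_on_local)
  show "openin (top_of_set (V \<times> V)) {(\<phi> x, \<phi>' y) | x y. x \<in> U \<and> y \<in> U' \<and> x \<otimes> y \<in> W}"
    by (rule mult_domain_openin[OF c W])
  fix z assume "z \<in> {(\<phi> x, \<phi>' y) | x y. x \<in> U \<and> y \<in> U' \<and> x \<otimes> y \<in> W}"
  then obtain x y where xy: "x \<in> U" "y \<in> U'" "x \<otimes> y \<in> W" "z = (\<phi> x, \<phi>' y)" by blast
  obtain Z \<omega> where cz: "(Z, \<omega>) \<in> \<A>" "x \<otimes> y \<in> Z" using chart_cover .
  let ?N = "{(\<phi> x, \<phi>' y) | x y. x \<in> U \<and> y \<in> U' \<and> x \<otimes> y \<in> Z \<inter> W}"
  have oN: "openin (top_of_set (V \<times> V)) ?N"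
    using mult_domain_openin[OF c, of "Z \<inter> W"] W chart_open[OF cz(1)] by auto
  have VV: "Real_Vector_Spaces.subspace (V \<times> V)"
    by (rule subspace_Times[OF subspace_V subspace_V])
  have "Ck_on k (V \<times> V) {(\<phi> x, \<phi>' y) | x y. x \<in> U \<and> y \<in> U' \<and> x \<otimes> y \<in> Z}
      (\<lambda>(a, b). \<omega> (inv_into U \<phi> a \<otimes> inv_into U' \<phi>' b))"
    using smooth_mult[OF c cz(1)] by (simp add: smooth_on_def)
  then have 1: "Ck_on k (V \<times> V) ?N (\<lambda>(a, b). \<omega> (inv_into U \<phi> a \<otimes> inv_into U' \<phi>' b))"
    by (rule Ck_on_subset) auto
  have "Ck_on k (V \<times> V) ?N ((f \<circ> inv_into Z \<omega>) \<circ> (\<lambda>(a, b). \<omega> (inv_into U \<phi> a \<otimes> inv_into U' \<phi>' b)))"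
    by (rule Ck_on_compose[OF VV oN subspace_V chart_openin_Int[OF cz(1) W] 1
          smooth_fun_on_chart[OF f cz(1)]])
       (use c in auto)
  then have "Ck_on k (V \<times> V) ?N (\<lambda>(a, b). f (inv_into U \<phi> a \<otimes> inv_into U' \<phi>' b))"
    by (rule Ck_on_cong[OF VV oN]) (use c cz in auto)
  moreover have "z \<in> ?N" using xy cz by blast
  ultimately show "\<exists>N. openin (top_of_set (V \<times> V)) N \<and> z \<in> N \<and>
      Ck_on k (V \<times> V) N (\<lambda>(a, b). f (inv_into U \<phi> a \<otimes> inv_into U' \<phi>' b))"
    using oN by blast
qed

lemma continuous_right: "continuous_on UNIV (\<lambda>x. x \<otimes> a)"
  and continuous_left: "continuous_on UNIV (\<lambda>x. a \<otimes> x)"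
proof -
  have "continuous_on UNIV (\<lambda>x. (\<lambda>(x, y). x \<otimes> y) (x, a))"
    by (rule continuous_on_compose2[OF continuous_mult]) (auto intro!: continuous_intros)
  then show "continuous_on UNIV (\<lambda>x. x \<otimes> a)" by simp
  have "continuous_on UNIV (\<lambda>x. (\<lambda>(x, y). x \<otimes> y) (a, x))"
    by (rule continuous_on_compose2[OF continuous_mult]) (auto intro!: continuous_intros)
  then show "continuous_on UNIV (\<lambda>x. a \<otimes> x)" by simp
qed

lemma open_right: "open W \<Longrightarrow> open {x. x \<otimes> a \<in> W}"
  and open_left: "open W \<Longrightarrow> open {x. a \<otimes> x \<in> W}"
  using open_vimage[OF _ continuous_right, of W a] open_vimage[OF _ continuous_left, of W a]
  by (auto simp: vimage_def)

text \<open>Right translation is multiplication restricted to the slice b to (b, \<phi>'(a)). The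
  version for an open set \<open>W\<close> is the one that singular supports require.\<close>

lemma smooth_fun_on_right:
  assumes W: "open W" and f: "smooth_fun_on W f"
  shows "smooth_fun_on {x. x \<otimes> a \<in> W} (\<lambda>x. f (x \<otimes> a))"
proof (rule smooth_fun_onI)
  fix U \<phi> k assume c: "(U, \<phi>) \<in> \<A>"
  obtain U' \<phi>' where c': "(U', \<phi>') \<in> \<A>" "a \<in> U'" using chart_cover .
  let ?S = "\<phi> ` (U \<inter> {x. x \<otimes> a \<in> W})"
  have o: "openin (top_of_set V) ?S" by (rule chart_openin_Int[OF c open_right[OF W]])
  have "bounded_linear (\<lambda>b::'e. (b, 0::'e))" by (intro bounded_linear_Pair bounded_linear_ident bounded_linear_zero)
  then have 1: "Ck_on k V ?S (\<lambda>b. (0, \<phi>' a) + (b, 0))"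
    by (rule Ck_on_affine[OF subspace_V o])
  have "Ck_on k V ?S ((\<lambda>(a, b). f (inv_into U \<phi> a \<otimes> inv_into U' \<phi>' b)) \<circ> (\<lambda>b. (0, \<phi>' a) + (b, 0)))"
    by (rule Ck_on_compose[OF subspace_V o subspace_Times[OF subspace_V subspace_V]
          mult_domain_openin[OF c c'(1) W] 1 smooth_on_mult[OF c c'(1) W f]])
       (use c' in auto)
  then show "Ck_on k V ?S ((\<lambda>x. f (x \<otimes> a)) \<circ> inv_into U \<phi>)"
    by (rule Ck_on_cong[OF subspace_V o]) (use c c' in auto)
qed

lemma smooth_fun_on_left:
  assumes W: "open W" and f: "smooth_fun_on W f"
  shows "smooth_fun_on {x. a \<otimes> x \<in> W} (\<lambda>x. f (a \<otimes> x))"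
proof (rule smooth_fun_onI)
  fix U \<phi> k assume c: "(U, \<phi>) \<in> \<A>"
  obtain U' \<phi>' where c': "(U', \<phi>') \<in> \<A>" "a \<in> U'" using chart_cover .
  let ?S = "\<phi> ` (U \<inter> {x. a \<otimes> x \<in> W})"
  have o: "openin (top_of_set V) ?S" by (rule chart_openin_Int[OF c open_left[OF W]])
  have "bounded_linear (\<lambda>b::'e. (0::'e, b))" by (intro bounded_linear_Pair bounded_linear_ident bounded_linear_zero)
  then have 1: "Ck_on k V ?S (\<lambda>b. (\<phi>' a, 0) + (0, b))"
    by (rule Ck_on_affine[OF subspace_V o])
  have "Ck_on k V ?S ((\<lambda>(a, b). f (inv_into U' \<phi>' a \<otimes> inv_into U \<phi> b)) \<circ> (\<lambda>b. (\<phi>' a, 0) + (0, b)))"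
    by (rule Ck_on_compose[OF subspace_V o subspace_Times[OF subspace_V subspace_V]
          mult_domain_openin[OF c'(1) c W] 1 smooth_on_mult[OF c'(1) c W f]])
       (use c' in auto)
  then show "Ck_on k V ?S ((\<lambda>x. f (a \<otimes> x)) \<circ> inv_into U \<phi>)"
    by (rule Ck_on_cong[OF subspace_V o]) (use c c' in auto)
qed

lemma Cinf_right: "f \<in> Cinf \<Longrightarrow> (\<lambda>x. f (x \<otimes> a)) \<in> Cinf"
  and Cinf_left: "f \<in> Cinf \<Longrightarrow> (\<lambda>x. f (a \<otimes> x)) \<in> Cinf"
  using smooth_fun_on_right[OF open_UNIV, of f a] smooth_fun_on_left[OF open_UNIV, of f a]
  by (auto simp: Cinf_def)

section \<open>Cutoff functions exp(-1/(r^2 - |a - p|^2)) and extension by zero from a chart to the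
  group\<close>

definition cutoff :: "'e \<Rightarrow> real \<Rightarrow> 'e \<Rightarrow> real" where
  "cutoff p r a = flat_poly 1 (r\<^sup>2 - inner (a - p) (a - p))"

lemma cutoff_nonneg: "cutoff p r a \<ge> 0"
  by (simp add: cutoff_def flat_poly_def)

lemma cutoff_pos: "r > 0 \<Longrightarrow> cutoff p r p > 0"
  by (simp add: cutoff_def flat_poly_def)

lemma cutoff_eq_0:
  assumes "dist p a \<ge> r" "r > 0"
  shows "cutoff p r a = 0"
proof -
  have "r\<^sup>2 \<le> (dist p a)\<^sup>2" using assms by (intro power_mono) auto
  then show ?thesis
    by (simp add: cutoff_def flat_poly_def dist_norm norm_minus_commute power2_norm_eq_inner)
qed

lemma Ck_on_cutoff:
  assumes "openin (top_of_set V) S"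
  shows "Ck_on k V S (cutoff p r)"
proof -
  have d: "Ck_on k V S (\<lambda>a. a - p)"
    using Ck_on_affine[OF subspace_V assms bounded_linear_ident, of k "- p"] by (simp add: algebra_simps)
  have "Ck_on k V S (\<lambda>a. inner (a - p) (a - p))"
    by (rule Ck_on_bilinear[OF subspace_V assms bounded_bilinear_inner d d])
  then have "Ck_on k V S (\<lambda>a. - inner (a - p) (a - p))"
    by (rule Ck_on_bounded_linear[OF subspace_V assms bounded_linear_minus[OF bounded_linear_ident]])
  then have "Ck_on k V S (\<lambda>a. r\<^sup>2 + - inner (a - p) (a - p))"
    by (rule Ck_on_add[OF subspace_V assms Ck_on_const])
  then have "Ck_on k V S (\<lambda>a. r\<^sup>2 - inner (a - p) (a - p))" by simp
  then have "Ck_on k V S (flat_poly 1 \<circ> (\<lambda>a. r\<^sup>2 - inner (a - p) (a - p)))"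
    by (intro Ck_on_compose[OF subspace_V assms, where V' = UNIV and U' = UNIV] Ck_on_flat_poly) auto
  moreover have "flat_poly 1 \<circ> (\<lambda>a. r\<^sup>2 - inner (a - p) (a - p)) = cutoff p r"
    by (auto simp: cutoff_def)
  ultimately show ?thesis by simp
qed

text \<open>The chart preimage of the larger ball and the complement of \<open>?K\<close> are open
  and cover the group: \<open>?K\<close> is compact, hence closed, and off it the function vanishes.
  The gap between r and R puts \<open>?K\<close> inside the region where \<open>g\<close> is
  smooth.\<close>

lemma Cinf_cutoff:
  fixes g :: "'e \<Rightarrow> complex"
  assumes c: "(U, \<phi>) \<in> \<A>" "p \<in> U" and r: "0 < r" "r < R" and ball: "V \<inter> ball (\<phi> p) R \<subseteq> \<phi> ` U"
    and g: "smooth_on V (V \<inter> ball (\<phi> p) R) g"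
  shows "(\<lambda>x. if x \<in> U then cutoff (\<phi> p) r (\<phi> x) *\<^sub>R g (\<phi> x) else 0) \<in> Cinf" (is "?f \<in> Cinf")
  unfolding Cinf_def mem_Collect_eq
proof (rule smooth_fun_on_local[OF open_UNIV])
  let ?K = "inv_into U \<phi> ` (V \<inter> cball (\<phi> p) r)"
  have cb: "V \<inter> cball (\<phi> p) r \<subseteq> \<phi> ` U" using ball r by force
  have "compact (V \<inter> cball (\<phi> p) r)"
    using closed_subspace[OF subspace_V] by (simp add: closed_Int_compact)
  then have "compact ?K"
    using chart_inv_continuous[OF c(1)] cb by (meson compact_continuous_image continuous_on_subset)
  then have K: "closed ?K" by (rule compact_imp_closed)
  fix q :: 'g
  show "\<exists>U1 \<phi>1 N. (U1, \<phi>1) \<in> \<A> \<and> open N \<and> q \<in> N \<and> N \<subseteq> U1 \<inter> UNIV \<and>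
       smooth_on V (\<phi>1 ` N) (?f \<circ> inv_into U1 \<phi>1)"
  proof (cases "q \<in> ?K")
    case True
    let ?N = "U \<inter> \<phi> -` ball (\<phi> p) R"
    have oN: "open ?N"
      using chart_continuous[OF c(1)] chart_open[OF c(1)] by (intro continuous_open_preimage) auto
    have o: "openin (top_of_set V) (\<phi> ` ?N)" using c oN by (intro chart_image_openin) auto
    have "\<phi> ` ?N \<subseteq> V \<inter> ball (\<phi> p) R" using chart_image_V[OF c(1)] by auto
    then have gk: "Ck_on k V (\<phi> ` ?N) g" for k using g Ck_on_subset unfolding smooth_on_def by blast
    have "Ck_on k V (\<phi> ` ?N) (\<lambda>a. cutoff (\<phi> p) r a *\<^sub>R g a)" for k
      by (rule Ck_on_bilinear[OF subspace_V o bounded_bilinear_scaleR Ck_on_cutoff[OF o] gk])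
    then have "Ck_on k V (\<phi> ` ?N) (?f \<circ> inv_into U \<phi>)" for k
      by (rule Ck_on_cong[OF subspace_V o]) (use c in auto)
    moreover have "q \<in> ?N"
    proof -
      obtain a where a: "a \<in> V \<inter> cball (\<phi> p) r" "q = inv_into U \<phi> a" using True by blast
      then have "\<phi> q = a" "q \<in> U" using cb by (auto simp: f_inv_into_f inv_into_into subset_iff)
      then show ?thesis using a r by auto
    qed
    ultimately show ?thesis using c(1) oN unfolding smooth_on_def by blast
  next
    case False
    obtain U1 \<phi>1 where c1: "(U1, \<phi>1) \<in> \<A>" "q \<in> U1" using chart_cover .
    let ?N = "U1 \<inter> - ?K"
    have oN: "open ?N" using chart_open[OF c1(1)] K by auto
    have o: "openin (top_of_set V) (\<phi>1 ` ?N)" using c1 oN by (intro chart_image_openin) auto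
    have zero: "?f x = 0" if "x \<notin> ?K" for x
    proof (cases "x \<in> U")
      case True
      have "\<phi> x \<notin> V \<inter> cball (\<phi> p) r"
      proof
        assume "\<phi> x \<in> V \<inter> cball (\<phi> p) r"
        then have "inv_into U \<phi> (\<phi> x) \<in> ?K" by blast
        then show False using that True c by simp
      qed
      moreover have "\<phi> x \<in> V" using chart_image_V[OF c(1)] True by auto
      ultimately show ?thesis using cutoff_eq_0[of r "\<phi> p" "\<phi> x"] r by auto
    qed simp
    have "Ck_on k V (\<phi>1 ` ?N) (?f \<circ> inv_into U1 \<phi>1)" for k
    proof (rule Ck_on_cong[OF subspace_V o Ck_on_const[of _ _ _ 0]])
      fix y assume "y \<in> \<phi>1 ` ?N"
      then obtain x where x: "x \<in> U1" "x \<notin> ?K" "y = \<phi>1 x" by blast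
      show "0 = (?f \<circ> inv_into U1 \<phi>1) y"
        by (simp only: o_apply x(3) chart_inv[OF c1(1) x(1)] zero[OF x(2)])
    qed
    then show ?thesis using c1 oN False unfolding smooth_on_def by blast
  qed
qed

lemma chart_ball:
  assumes "(U, \<phi>) \<in> \<A>" "p \<in> N" "open N" "N \<subseteq> U"
  obtains R where "R > 0" "V \<inter> ball (\<phi> p) R \<subseteq> \<phi> ` N"
proof -
  have "openin (top_of_set V) (\<phi> ` N)" by (rule chart_image_openin) fact+
  moreover have "\<phi> p \<in> \<phi> ` N" using assms(2) by blast
  ultimately obtain R where "R > 0" "ball (\<phi> p) R \<inter> V \<subseteq> \<phi> ` N"
    unfolding openin_contains_ball by blast
  then show thesis by (intro that[of R]) (simp_all add: Int_commute)
qed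

lemma bump_function:
  assumes "open N" "p \<in> N"
  obtains h :: "'g \<Rightarrow> real" where "(\<lambda>x. complex_of_real (h x)) \<in> Cinf" "\<And>x. h x \<ge> 0" "h p > 0"
    "\<And>x. h x \<noteq> 0 \<Longrightarrow> x \<in> N"
proof -
  obtain U \<phi> where c: "(U, \<phi>) \<in> \<A>" "p \<in> U" using chart_cover .
  obtain R where R: "R > 0" "V \<inter> ball (\<phi> p) R \<subseteq> \<phi> ` (U \<inter> N)"
    using chart_ball[OF c(1), of p "U \<inter> N"] chart_open[OF c(1)] assms c by auto
  define h where "h x = (if x \<in> U then cutoff (\<phi> p) (R/2) (\<phi> x) else 0)" for x
  have "(\<lambda>x. if x \<in> U then cutoff (\<phi> p) (R/2) (\<phi> x) *\<^sub>R (1::complex) else 0) \<in> Cinf"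
    by (rule Cinf_cutoff[OF c, of _ R]) (use R in \<open>auto simp: smooth_on_def Ck_on_const\<close>)
  moreover have "(\<lambda>x. if x \<in> U then cutoff (\<phi> p) (R/2) (\<phi> x) *\<^sub>R (1::complex) else 0) = (\<lambda>x. complex_of_real (h x))"
    by (auto simp: h_def scaleR_conv_of_real)
  ultimately have 1: "(\<lambda>x. complex_of_real (h x)) \<in> Cinf" by simp
  have 2: "x \<in> N" if "h x \<noteq> 0" for x
  proof -
    have x: "x \<in> U" and "cutoff (\<phi> p) (R/2) (\<phi> x) \<noteq> 0" using that by (auto simp: h_def split: if_splits)
    then have "dist (\<phi> p) (\<phi> x) < R/2" using cutoff_eq_0[of "R/2" "\<phi> p" "\<phi> x"] R by force
    then have "\<phi> x \<in> V \<inter> ball (\<phi> p) R" using chart_image_V[OF c(1)] x R by auto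
    then obtain y where "y \<in> U \<inter> N" "\<phi> x = \<phi> y" using R(2) by blast
    then show "x \<in> N" using chart_inv[OF c(1) x] chart_inv[OF c(1), of y] by (metis IntD1 IntD2)
  qed
  show thesis
    by (rule that[OF 1]) (use 2 cutoff_pos[of "R/2" "\<phi> p"] R c in \<open>auto simp: h_def cutoff_nonneg\<close>)
qed

section \<open>Haar measure\<close>

lemma haar_finite: "haar_measure \<mu> \<Longrightarrow> finite_measure \<mu>"
  unfolding haar_measure_def using prob_space.finite_measure by blast

lemma haar_sets: "haar_measure \<mu> \<Longrightarrow> sets \<mu> = sets borel"
  and haar_space: "haar_measure \<mu> \<Longrightarrow> space \<mu> = UNIV"
  unfolding haar_measure_def using sets_eq_imp_space_eq[of \<mu> borel] by auto

lemma haar_sets_restrict: "haar_measure \<mu> \<Longrightarrow> sets \<mu> = sets (restrict_space borel UNIV)"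
  using haar_sets by (simp add: sets_restrict_space_iff set_eq_iff)

lemma haar_integrable:
  fixes f :: "'g \<Rightarrow> 'b::{banach, second_countable_topology}"
  assumes "haar_measure \<mu>" "continuous_on UNIV f"
  shows "integrable \<mu> f"
  by (rule integrable_continuous_compact[OF haar_finite haar_sets_restrict compact_UNIV]) (use assms in auto)

text \<open>The function \<open>f\<close> is arbitrary. If it is not measurable, neither integrand
  is integrable and both integrals are 0 by convention; the continuous inverse
  \<open>\<theta>'\<close> carries non-measurability across.\<close>

lemma integral_preserving:
  fixes f :: "'g \<Rightarrow> complex"
  assumes \<mu>: "sets \<mu> = sets borel" "distr \<mu> borel \<theta> = \<mu>"
    and \<theta>: "continuous_on UNIV \<theta>" "continuous_on UNIV \<theta>'" "\<And>x. \<theta> (\<theta>' x) = x"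
  shows "(\<integral>x. f (\<theta> x) \<partial>\<mu>) = (\<integral>x. f x \<partial>\<mu>)"
proof -
  have m: "\<theta> \<in> measurable \<mu> borel" "\<theta>' \<in> measurable \<mu> \<mu>"
    using borel_measurable_continuous_onI[OF \<theta>(1)] borel_measurable_continuous_onI[OF \<theta>(2)]
      measurable_cong_sets[OF \<mu>(1) refl] measurable_cong_sets[OF \<mu>(1) \<mu>(1)] by blast+
  show ?thesis
  proof (cases "f \<in> borel_measurable borel")
    case True
    have "(\<integral>x. f x \<partial>\<mu>) = (\<integral>x. f x \<partial>(distr \<mu> borel \<theta>))" using \<mu>(2) by simp
    also have "\<dots> = (\<integral>x. f (\<theta> x) \<partial>\<mu>)" by (rule integral_distr[OF m(1) True])
    finally show ?thesis by simp
  next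
    case False
    have eq: "borel_measurable \<mu> = (borel_measurable borel :: ('g \<Rightarrow> complex) set)"
      using measurable_cong_sets[OF \<mu>(1) refl] by blast
    have "\<not> integrable \<mu> f"
      using False eq borel_measurable_integrable by blast
    moreover have "\<not> integrable \<mu> (\<lambda>x. f (\<theta> x))"
    proof
      assume "integrable \<mu> (\<lambda>x. f (\<theta> x))"
      then have "(\<lambda>x. f (\<theta> x)) \<in> borel_measurable \<mu>" by (rule borel_measurable_integrable)
      then have "(\<lambda>x. f (\<theta> (\<theta>' x))) \<in> borel_measurable \<mu>"
        using measurable_compose[OF m(2), of "\<lambda>x. f (\<theta> x)" borel] by blast
      then show False using False eq \<theta>(3) by simp
    qed
    ultimately show ?thesis by (simp add: not_integrable_integral_eq)
  qed
qed

lemma inv_solve [simp]: "x \<otimes> a \<otimes> inv a = x" "x \<otimes> inv a \<otimes> a = x" "inv a \<otimes> (a \<otimes> x) = x" "a \<otimes> (inv a \<otimes> x) = x"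
  by (simp_all add: m_assoc) (simp_all add: m_assoc[symmetric])

lemma haar_right:
  fixes f :: "'g \<Rightarrow> complex"
  shows "haar_measure \<mu> \<Longrightarrow> (\<integral>x. f (x \<otimes> a) \<partial>\<mu>) = (\<integral>x. f x \<partial>\<mu>)"
  by (rule integral_preserving[where \<theta>' = "\<lambda>x. x \<otimes> inv a"])
     (auto simp: haar_measure_def continuous_right)

lemma haar_left:
  fixes f :: "'g \<Rightarrow> complex"
  shows "haar_measure \<mu> \<Longrightarrow> (\<integral>x. f (a \<otimes> x) \<partial>\<mu>) = (\<integral>x. f x \<partial>\<mu>)"
  by (rule integral_preserving[where \<theta>' = "\<lambda>x. inv a \<otimes> x"])
     (auto simp: haar_measure_def continuous_left)

text \<open>If the integral vanished, the open set where g > 0 would be null together with all its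
  right translates; finitely many of these cover the compact group, against total mass 1.\<close>

lemma haar_integral_pos:
  fixes g :: "'g \<Rightarrow> real"
  assumes \<mu>: "haar_measure \<mu>" and g: "continuous_on UNIV g" "\<And>x. g x \<ge> 0" "g p > 0"
  shows "(\<integral>x. g x \<partial>\<mu>) > 0"
proof (rule ccontr)
  assume "\<not> ?thesis"
  moreover have "(\<integral>x. g x \<partial>\<mu>) \<ge> 0" using g by simp
  ultimately have "(\<integral>x. g x \<partial>\<mu>) = 0" by linarith
  then have ae: "AE x in \<mu>. g x = 0"
    using integral_nonneg_eq_0_iff_AE[OF haar_integrable[OF \<mu> g(1)]] g by auto
  define S where "S = g -` {0<..}"
  have S: "open S" unfolding S_def by (rule open_vimage) (use g in auto)
  have null: "emeasure \<mu> S = 0"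
  proof -
    have "AE x in \<mu>. x \<notin> S" using ae by eventually_elim (simp add: S_def)
    then show ?thesis
      using AE_iff_measurable[of S \<mu> "\<lambda>x. x \<notin> S"] S haar_sets[OF \<mu>] haar_space[OF \<mu>] by auto
  qed
  have nullt: "emeasure \<mu> {x. x \<otimes> a \<in> S} = 0" for a
  proof -
    have "emeasure (distr \<mu> borel (\<lambda>x. x \<otimes> a)) S = emeasure \<mu> ((\<lambda>x. x \<otimes> a) -` S \<inter> space \<mu>)"
      by (rule emeasure_distr)
         (use S borel_measurable_continuous_onI[OF continuous_right] measurable_cong_sets[OF haar_sets[OF \<mu>] refl] in auto)
    then show ?thesis using \<mu> null haar_space[OF \<mu>] by (auto simp: haar_measure_def vimage_def)
  qed
  have "UNIV \<subseteq> (\<Union>a\<in>UNIV. {x. x \<otimes> a \<in> S})"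
  proof
    fix x :: 'g
    have "x \<otimes> (inv x \<otimes> p) \<in> S" using g by (simp add: S_def)
    then show "x \<in> (\<Union>a\<in>UNIV. {x. x \<otimes> a \<in> S})" by blast
  qed
  then obtain A where A: "finite A" "UNIV \<subseteq> (\<Union>a\<in>A. {x. x \<otimes> a \<in> S})"
    using compactE_image[OF compact_UNIV, of UNIV "\<lambda>a. {x. x \<otimes> a \<in> S}"] open_right[OF S] by metis
  have "(\<Union>a\<in>A. {x. x \<otimes> a \<in> S}) \<in> null_sets \<mu>"
    using A(1) nullt open_right[OF S] haar_sets[OF \<mu>] by (intro null_sets_UN') (auto simp: countable_finite)
  then have "emeasure \<mu> UNIV = 0" using A(2) by (simp add: top.extremum_unique null_setsD1 UNIV_eq_I)
  moreover have "emeasure \<mu> UNIV = 1"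
    using \<mu> haar_space[OF \<mu>] prob_space.emeasure_space_1 unfolding haar_measure_def by metis
  ultimately show False by simp
qed

text \<open>As y runs over the group, joint regularity is expressed in charts for y. Differentiation
  takes place in the directions (0, v), so the weight \<open>c\<close> in the variable y may be
  merely continuous.\<close>

lemma Ck_param_charts:
  fixes H :: "'e \<Rightarrow> 'g \<Rightarrow> complex"
  assumes c: "continuous_on UNIV c"
    and "\<And>U \<phi>. (U, \<phi>) \<in> \<A> \<Longrightarrow> Ck_on k (V \<times> V) (\<phi> ` U \<times> S) (\<lambda>(b, a). H a (inv_into U \<phi> b))"
  shows "Ck_param k V S UNIV (\<lambda>a y. H a y * c y)"
  using assms(2)
proof (induction k arbitrary: H)
  have cont: "continuous_on (S \<times> UNIV) (\<lambda>(a, y). H a y * c y)"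
    if H: "\<And>U \<phi>. (U, \<phi>) \<in> \<A> \<Longrightarrow> continuous_on (\<phi> ` U \<times> S) (\<lambda>(b, a). H a (inv_into U \<phi> b))"
    for H :: "'e \<Rightarrow> 'g \<Rightarrow> complex"
  proof -
    have "continuous_on (S \<times> UNIV) (\<lambda>(a, y). H a y)"
      unfolding continuous_on_eq_continuous_within
    proof clarify
      fix a y assume a: "a \<in> S"
      obtain U \<phi> where ch: "(U, \<phi>) \<in> \<A>" "y \<in> U" using chart_cover .
      have "continuous_on (S \<times> U) (\<lambda>z. (\<phi> (snd z), fst z))"
        by (intro continuous_intros continuous_on_compose2[OF chart_continuous[OF ch(1)]]) auto
      then have "continuous_on (S \<times> U) (\<lambda>z. (\<lambda>(b, a). H a (inv_into U \<phi> b)) (\<phi> (snd z), fst z))"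
        by (rule continuous_on_compose2[OF H[OF ch(1)]]) auto
      then have "continuous_on (S \<times> U) (\<lambda>(a, y). H a y)"
        by (rule continuous_on_eq) (use ch in auto)
      then have "continuous (at (a, y) within S \<times> U) (\<lambda>(a, y). H a y)"
        using a ch unfolding continuous_on_eq_continuous_within by auto
      moreover have "at (a, y) within S \<times> UNIV = at (a, y) within S \<times> U"
        by (rule at_within_nhd[of _ "UNIV \<times> U"])
           (use ch chart_open[OF ch(1)] in \<open>auto intro: open_Times\<close>)
      ultimately show "continuous (at (a, y) within S \<times> UNIV) (\<lambda>(a, y). H a y)" by simp
    qed
    then have "continuous_on (S \<times> UNIV) (\<lambda>z. H (fst z) (snd z) * c (snd z))"
      unfolding split_beta
      by (intro continuous_on_mult continuous_on_compose2[OF c continuous_on_snd[OF continuous_on_id]]) auto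
    then show ?thesis by (simp add: split_beta)
  qed
  {
    case 0
    then show ?case using cont[of H] by simp
  next
    case (Suc k)
    show ?case
      unfolding Ck_param.simps
    proof (intro conjI ballI exI)
      show "continuous_on (S \<times> UNIV) (\<lambda>(a, y). H a y * c y)"
        by (rule cont) (use Suc.prems in simp)
      fix v assume v: "v \<in> V"
      define H' where "H' a y = dir_deriv v (\<lambda>a. H a y) a" for a y
      have H': "dir_deriv (0, v) (\<lambda>(b, a). H a (inv_into U \<phi> b)) = (\<lambda>(b, a). H' a (inv_into U \<phi> b))" for U \<phi>
        by (auto simp: H'_def dir_deriv_def)
      have 0: "(0, v) \<in> V \<times> V" using v subspace_V Real_Vector_Spaces.subspace_0 by blast
      show "Ck_param k V S UNIV (\<lambda>a y. H' a y * c y)"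
      proof (rule Suc.IH)
        fix U \<phi> assume "(U, \<phi>) \<in> \<A>"
        then have "Ck_on k (V \<times> V) (\<phi> ` U \<times> S) (dir_deriv (0, v) (\<lambda>(b, a). H a (inv_into U \<phi> b)))"
          using Suc.prems 0 by simp
        then show "Ck_on k (V \<times> V) (\<phi> ` U \<times> S) (\<lambda>(b, a). H' a (inv_into U \<phi> b))"
          unfolding H' .
      qed
      fix x y assume x: "x \<in> S"
      obtain U \<phi> where ch: "(U, \<phi>) \<in> \<A>" "y \<in> U" using chart_cover .
      have "((\<lambda>t. (\<lambda>(b, a). H a (inv_into U \<phi> b)) ((\<phi> y, x) + t *\<^sub>R (0, v))) has_vector_derivative
           dir_deriv (0, v) (\<lambda>(b, a). H a (inv_into U \<phi> b)) (\<phi> y, x)) (at 0)"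
        using Ck_on_has_dir_deriv[OF Suc.prems[OF ch(1)] 0, of "(\<phi> y, x)"] ch x by blast
      then have "((\<lambda>t. H (x + t *\<^sub>R v) y) has_vector_derivative H' x y) (at 0)"
        unfolding H' using ch by simp
      then show "((\<lambda>t. H (x + t *\<^sub>R v) y * c y) has_vector_derivative H' x y * c y) (at 0)"
        by (rule bounded_linear.has_vector_derivative[OF bounded_linear_mult_left])
    qed
  }
qed

text \<open>The variable x occurs in the smooth factor only, so differentiation under the integral
  leaves \<open>c\<close> alone. It is applied with \<open>c\<close> a matrix entry that is so far
  known to be continuous only.\<close>

lemma Cinf_convolution:
  assumes \<mu>: "haar_measure \<mu>" and \<psi>: "\<psi> \<in> Cinf" and c: "continuous_on UNIV c"
  shows "(\<lambda>x. \<integral>y. \<psi> (y \<otimes> x) * c y \<partial>\<mu>) \<in> Cinf"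
proof (rule CinfI)
  fix U \<phi> k assume ch: "(U, \<phi>) \<in> \<A>"
  have "Ck_on k V (\<phi> ` U) (\<lambda>a. \<integral>y. \<psi> (y \<otimes> inv_into U \<phi> a) * c y \<partial>\<mu>)"
  proof (rule Ck_on_integral[OF subspace_V chart_image_open[OF ch] haar_finite[OF \<mu>]
        haar_sets_restrict[OF \<mu>] compact_UNIV])
    show "Ck_param k V (\<phi> ` U) UNIV (\<lambda>a y. \<psi> (y \<otimes> inv_into U \<phi> a) * c y)"
    proof (rule Ck_param_charts[OF c])
      fix U' \<phi>' assume ch': "(U', \<phi>') \<in> \<A>"
      have "{(\<phi>' x, \<phi> y) | x y. x \<in> U' \<and> y \<in> U \<and> x \<otimes> y \<in> UNIV} = \<phi>' ` U' \<times> \<phi> ` U" by auto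
      then show "Ck_on k (V \<times> V) (\<phi>' ` U' \<times> \<phi> ` U) (\<lambda>(b, a). \<psi> (inv_into U' \<phi>' b \<otimes> inv_into U \<phi> a))"
        using smooth_on_mult[OF ch' ch open_UNIV, of \<psi> k] \<psi> by (simp add: Cinf_def)
    qed
  qed
  then show "Ck_on k V (\<phi> ` U) ((\<lambda>x. \<integral>y. \<psi> (y \<otimes> x) * c y \<partial>\<mu>) \<circ> inv_into U \<phi>)"
    by (simp add: o_def)
qed

section \<open>Matrix entries of irreducible representations are smooth\<close>

lemma mat_adjoint_index:
  fixes M :: "complex mat"
  assumes "i < dim_col M" "j < dim_row M"
  shows "mat_adjoint M $$ (i, j) = cnj (M $$ (j, i))"
  using assms by (simp add: mat_adjoint_def mat_of_rows_def)

lemma mat_adjoint_carrier: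
  fixes M :: "complex mat"
  shows "M \<in> carrier_mat a b \<Longrightarrow> mat_adjoint M \<in> carrier_mat b a"
  by (auto simp: mat_adjoint_def mat_of_rows_def)

lemma irrep_carrier: "\<xi> \<in> irreps \<Longrightarrow> \<xi> x \<in> carrier_mat (rep_dim \<xi>) (rep_dim \<xi>)"
  by (simp add: irreps_def)

lemma irrep_mult: "\<xi> \<in> irreps \<Longrightarrow> \<xi> (x \<otimes> y) = \<xi> x * \<xi> y"
  by (simp add: irreps_def)

lemma irrep_one: "\<xi> \<in> irreps \<Longrightarrow> \<xi> \<one> = 1\<^sub>m (rep_dim \<xi>)"
  by (simp add: irreps_def)

lemma irrep_continuous:
  "\<xi> \<in> irreps \<Longrightarrow> i < rep_dim \<xi> \<Longrightarrow> j < rep_dim \<xi> \<Longrightarrow> continuous_on UNIV (\<lambda>x. \<xi> x $$ (i, j))"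
  by (simp add: irreps_def)

lemma irrep_inv:
  assumes "\<xi> \<in> irreps"
  shows "\<xi> (inv x) = mat_adjoint (\<xi> x)"
proof -
  let ?d = "rep_dim \<xi>"
  have c: "\<xi> x \<in> carrier_mat ?d ?d" "\<xi> (inv x) \<in> carrier_mat ?d ?d" "mat_adjoint (\<xi> x) \<in> carrier_mat ?d ?d"
    using irrep_carrier[OF assms] mat_adjoint_carrier by auto
  have "\<xi> x * \<xi> (inv x) = 1\<^sub>m ?d"
    using irrep_mult[OF assms, of x "inv x"] irrep_one[OF assms] by simp
  moreover have "mat_adjoint (\<xi> x) * \<xi> x = 1\<^sub>m ?d" using assms by (simp add: irreps_def)
  ultimately have "mat_adjoint (\<xi> x) * 1\<^sub>m ?d = 1\<^sub>m ?d * \<xi> (inv x)"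
    using assoc_mult_mat[OF c(3,1,2)] by simp
  then show ?thesis using c by simp
qed

lemma irrep_mult_index:
  assumes "\<xi> \<in> irreps" "i < rep_dim \<xi>" "j < rep_dim \<xi>"
  shows "\<xi> (x \<otimes> y) $$ (i, j) = (\<Sum>k<rep_dim \<xi>. \<xi> x $$ (i, k) * \<xi> y $$ (k, j))"
  using irrep_carrier[OF assms(1), of x] irrep_carrier[OF assms(1), of y] assms
  by (auto simp: irrep_mult scalar_prod_def atLeast0LessThan intro!: sum.cong)

lemma irrep_inv_index:
  assumes "\<xi> \<in> irreps" "i < rep_dim \<xi>" "j < rep_dim \<xi>"
  shows "\<xi> (inv x) $$ (i, j) = cnj (\<xi> x $$ (j, i))"
  using irrep_carrier[OF assms(1), of x] assms by (auto simp: irrep_inv mat_adjoint_index)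

text \<open>The vectors with smooth orbit map form an invariant subspace, which is not zero as it contains
  all vectors obtained by averaging against a smooth bump function at the unit.\<close>

lemma irrep_smooth:
  assumes \<mu>: "haar_measure \<mu>" and \<xi>: "\<xi> \<in> irreps" and ij: "i < rep_dim \<xi>" "j < rep_dim \<xi>"
  shows "(\<lambda>x. \<xi> x $$ (i, j)) \<in> Cinf"
proof -
  let ?d = "rep_dim \<xi>"
  have car: "\<xi> x \<in> carrier_mat ?d ?d" for x by (rule irrep_carrier[OF \<xi>])
  have d: "?d > 0" using \<xi> by (simp add: irreps_def)
  define W where "W = {v \<in> carrier_vec ?d. \<forall>i<?d. (\<lambda>x. (\<xi> x *\<^sub>v v) $ i) \<in> Cinf}"
  have mv: "(\<xi> x *\<^sub>v v) $ i = (\<Sum>l<?d. \<xi> x $$ (i, l) * v $ l)" if "v \<in> carrier_vec ?d" "i < ?d" for x v i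
    using car[of x] that by (auto simp: scalar_prod_def atLeast0LessThan intro!: sum.cong)
  have sub: "VectorSpace.subspace class_ring W (module_vec TYPE(complex) ?d)"
  proof -
    have "submodule class_ring W (module_vec TYPE(complex) ?d)"
    proof (rule submodule.intro)
      show "module class_ring (module_vec TYPE(complex) ?d)" by (rule vec_module)
    next
      show "W \<subseteq> carrier (module_vec TYPE(complex) ?d)" by (auto simp: W_def module_vec_def)
    next
      fix v w assume "v \<in> W" "w \<in> W"
      moreover have "(\<xi> x *\<^sub>v (v + w)) $ i = (\<xi> x *\<^sub>v v) $ i + (\<xi> x *\<^sub>v w) $ i"
        if "v \<in> carrier_vec ?d" "w \<in> carrier_vec ?d" "i < ?d" for x i
        using mult_add_distrib_mat_vec[OF car that(1,2)] car[of x] that by simp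
      ultimately show "v \<oplus>\<^bsub>module_vec TYPE(complex) ?d\<^esub> w \<in> W"
        unfolding W_def by (auto simp: module_vec_def intro!: Cinf_add)
    next
      show "\<zero>\<^bsub>module_vec TYPE(complex) ?d\<^esub> \<in> W"
        by (auto simp: W_def module_vec_def mv)
    next
      fix c v assume "c \<in> carrier (class_ring :: complex ring)" "v \<in> W"
      moreover have "(\<xi> x *\<^sub>v (c \<cdot>\<^sub>v v)) $ i = c * (\<xi> x *\<^sub>v v) $ i"
        if "v \<in> carrier_vec ?d" "i < ?d" for x i
        using mult_mat_vec[OF car that(1)] car[of x] that by simp
      ultimately show "c \<odot>\<^bsub>module_vec TYPE(complex) ?d\<^esub> v \<in> W"
        unfolding W_def by (auto simp: module_vec_def intro!: Cinf_cmult)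
    qed
    then show ?thesis
      using vec_vs by (intro VectorSpace.subspace.intro)
  qed
  have invar: "\<xi> a *\<^sub>v v \<in> W" if "v \<in> W" for a v
  proof -
    have v: "v \<in> carrier_vec ?d" using that by (simp add: W_def)
    have "\<xi> x *\<^sub>v (\<xi> a *\<^sub>v v) = \<xi> (x \<otimes> a) *\<^sub>v v" for x
      using assoc_mult_mat_vec[OF car car v] irrep_mult[OF \<xi>] by simp
    then show ?thesis
      using that car[of a] v unfolding W_def by (auto intro: Cinf_right)
  qed
  have "W = {0\<^sub>v ?d} \<or> W = carrier_vec ?d"
    using \<xi> sub invar unfolding irreps_def by blast
  moreover have "W \<noteq> {0\<^sub>v ?d}"
  proof -
    \<comment> \<open>On this neighbourhood the corner entry has real part above 1/2, which makes
      the corresponding component of the averaged vector nonzero.\<close>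
    define N where "N = {x. Re (\<xi> x $$ (0, 0)) > 1/2}"
    have "open N" unfolding N_def
      by (intro open_Collect_less continuous_intros irrep_continuous[OF \<xi> d d])
    moreover have "\<one> \<in> N" using irrep_one[OF \<xi>] d by (simp add: N_def)
    ultimately obtain h :: "'g \<Rightarrow> real" where h: "(\<lambda>x. complex_of_real (h x)) \<in> Cinf" "\<And>x. h x \<ge> 0" "h \<one> > 0"
      "\<And>x. h x \<noteq> 0 \<Longrightarrow> x \<in> N"
      using bump_function by blast
    have hc: "continuous_on UNIV h"
      using continuous_on_Re[OF Cinf_continuous[OF h(1)]] by simp
    have ec: "continuous_on UNIV (\<lambda>y. cnj (\<xi> y $$ (k, l)))" if "k < ?d" "l < ?d" for k l
      by (intro continuous_intros irrep_continuous[OF \<xi> that])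
    \<comment> \<open>This is the integral of h(y) \<xi>(y)^* e_0. Applying \<xi>(x) gives \<xi>(y
      x^{-1})^* e_0 under the integral, and the substitution of y x for y moves x into the smooth
      factor h.\<close>
    define v where "v = vec ?d (\<lambda>l. \<integral>y. complex_of_real (h y) * cnj (\<xi> y $$ (0, l)) \<partial>\<mu>)"
    have v: "v \<in> carrier_vec ?d" by (simp add: v_def)
    have int: "integrable \<mu> (\<lambda>y. complex_of_real (h y) * cnj (\<xi> y $$ (0, l)))" if "l < ?d" for l
      by (rule haar_integrable[OF \<mu>]) (intro continuous_intros hc irrep_continuous[OF \<xi> d that])
    have "(\<xi> x *\<^sub>v v) $ i = (\<integral>y. complex_of_real (h (y \<otimes> x)) * cnj (\<xi> y $$ (0, i)) \<partial>\<mu>)" if i: "i < ?d" for x i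
    proof -
      have "(\<xi> x *\<^sub>v v) $ i = (\<Sum>l<?d. \<xi> x $$ (i, l) * (\<integral>y. complex_of_real (h y) * cnj (\<xi> y $$ (0, l)) \<partial>\<mu>))"
        using mv[OF v i] by (simp add: v_def)
      also have "\<dots> = (\<integral>y. (\<Sum>l<?d. \<xi> x $$ (i, l) * (complex_of_real (h y) * cnj (\<xi> y $$ (0, l)))) \<partial>\<mu>)"
        using int by (subst Bochner_Integration.integral_sum) auto
      also have "\<dots> = (\<integral>y. complex_of_real (h y) * cnj (\<xi> (y \<otimes> inv x) $$ (0, i)) \<partial>\<mu>)"
      proof (rule Bochner_Integration.integral_cong[OF refl])
        fix y
        have "cnj (\<xi> (y \<otimes> inv x) $$ (0, i)) = (\<Sum>l<?d. cnj (\<xi> y $$ (0, l)) * \<xi> x $$ (i, l))"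
          using i d by (auto simp: irrep_mult_index[OF \<xi>] irrep_inv_index[OF \<xi>] intro!: sum.cong)
        then show "(\<Sum>l<?d. \<xi> x $$ (i, l) * (complex_of_real (h y) * cnj (\<xi> y $$ (0, l)))) =
            complex_of_real (h y) * cnj (\<xi> (y \<otimes> inv x) $$ (0, i))"
          by (simp add: sum_distrib_left mult_ac)
      qed
      also have "\<dots> = (\<integral>y. complex_of_real (h (y \<otimes> x)) * cnj (\<xi> (y \<otimes> x \<otimes> inv x) $$ (0, i)) \<partial>\<mu>)"
        by (rule haar_right[OF \<mu>, of "\<lambda>y. complex_of_real (h y) * cnj (\<xi> (y \<otimes> inv x) $$ (0, i))" x, symmetric])
      finally show ?thesis by simp
    qed
    then have "v \<in> W"
      using Cinf_convolution[OF \<mu> h(1) ec[OF d]] v unfolding W_def by auto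
    moreover have "v $ 0 \<noteq> 0"
    proof -
      have "(\<integral>y. h y * Re (\<xi> y $$ (0, 0)) \<partial>\<mu>) > 0"
      proof (rule haar_integral_pos[OF \<mu>])
        show "continuous_on UNIV (\<lambda>y. h y * Re (\<xi> y $$ (0, 0)))"
          by (intro continuous_intros hc irrep_continuous[OF \<xi> d d])
        show "h y * Re (\<xi> y $$ (0, 0)) \<ge> 0" for y
          using h(2)[of y] h(4)[of y] by (cases "h y = 0") (auto simp: N_def)
        show "h \<one> * Re (\<xi> \<one> $$ (0, 0)) > 0" using h(3) irrep_one[OF \<xi>] d by simp
      qed
      moreover have "Re (v $ 0) = (\<integral>y. h y * Re (\<xi> y $$ (0, 0)) \<partial>\<mu>)"
        using d integral_Re[OF int[OF d]] by (simp add: v_def)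
      ultimately show ?thesis by auto
    qed
    ultimately show ?thesis using d by (metis index_zero_vec(1) singletonD)
  qed
  ultimately have "unit_vec ?d j \<in> W" by simp
  then have "(\<lambda>x. (\<xi> x *\<^sub>v unit_vec ?d j) $ i) \<in> Cinf" using ij by (simp add: W_def)
  moreover have "(\<xi> x *\<^sub>v unit_vec ?d j) $ i = \<xi> x $$ (i, j)" for x
    using car[of x] ij by (auto simp: scalar_prod_right_unit)
  ultimately show ?thesis by simp
qed

end

section \<open>The Lie algebra has dimension at most the dimension of the group\<close>

text \<open>Independence is stated for an indexed family, so injectivity of \<open>w\<close> is
  extracted first; its image is then an independent set with n elements in a space of dimension
  n.\<close>

lemma independent_family_spans:
  fixes w :: "nat \<Rightarrow> 'a::euclidean_space"
  assumes V: "Real_Vector_Spaces.subspace V" "Real_Vector_Spaces.dim V = n"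
    and w: "\<And>i. i < n \<Longrightarrow> w i \<in> V"
    and ind: "\<And>c :: nat \<Rightarrow> real. (\<Sum>i<n. c i *\<^sub>R w i) = 0 \<Longrightarrow> \<forall>i<n. c i = 0"
    and v: "v \<in> V"
  obtains c :: "nat \<Rightarrow> real" where "v = (\<Sum>i<n. c i *\<^sub>R w i)"
proof -
  have inj: "inj_on w {..<n}"
  proof (rule inj_onI, rule ccontr)
    fix i j assume ij: "i \<in> {..<n}" "j \<in> {..<n}" "w i = w j" "i \<noteq> j"
    let ?c = "\<lambda>k. (if k = i then 1 else 0) - (if k = j then 1 else 0 :: real)"
    have "(\<Sum>k<n. ?c k *\<^sub>R w k) = (\<Sum>k<n. (if k = i then w k else 0)) - (\<Sum>k<n. (if k = j then w k else 0))"
      unfolding sum_subtractf[symmetric] by (intro sum.cong) auto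
    also have "\<dots> = 0" using ij by (simp add: sum.delta)
    finally have "\<forall>k<n. ?c k = 0" by (rule ind)
    then have "?c i = 0" using ij(1) by blast
    then show False using ij by simp
  qed
  have "Real_Vector_Spaces.independent (w ` {..<n})"
  proof
    assume "Real_Vector_Spaces.dependent (w ` {..<n})"
    then obtain u where u: "\<exists>v\<in>w ` {..<n}. u v \<noteq> 0" "(\<Sum>v\<in>w ` {..<n}. u v *\<^sub>R v) = 0"
      using Real_Vector_Spaces.dependent_finite[of "w ` {..<n}"] by auto
    then have "(\<Sum>i<n. u (w i) *\<^sub>R w i) = 0" by (simp add: sum.reindex[OF inj])
    then have "\<forall>i<n. u (w i) = 0" by (rule ind)
    then show False using u by auto
  qed
  then have "V \<subseteq> Real_Vector_Spaces.span (w ` {..<n})"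
    using V w by (intro card_ge_dim_independent) (auto simp: card_image[OF inj])
  then have "v \<in> Real_Vector_Spaces.span (w ` {..<n})" using v by auto
  then obtain u where "v = (\<Sum>v\<in>w ` {..<n}. u v *\<^sub>R v)"
    using Real_Vector_Spaces.span_finite[of "w ` {..<n}"] by auto
  then have "v = (\<Sum>i<n. u (w i) *\<^sub>R w i)" by (simp add: sum.reindex[OF inj])
  then show thesis by (rule that)
qed

context compact_lie_group
begin

text \<open>This is \<open>lie_algebra\<close> without the normalisation outside
  \<open>Cinf\<close>, so that membership of a bracket or of a combination is decided on smooth
  functions.\<close>

definition lie_field :: "'g operator \<Rightarrow> bool" where
  "lie_field Y \<longleftrightarrow> linear_op Y \<and> left_invariant Y \<and>
     (\<forall>f\<in>Cinf. \<forall>g\<in>Cinf. Y (\<lambda>x. f x * g x) = (\<lambda>x. Y f x * g x + f x * Y g x)) \<and>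
     (\<forall>f\<in>Cinf. Y (\<lambda>x. cnj (f x)) = (\<lambda>x. cnj (Y f x)))"

lemma lie_algebra_lie_field: "Y \<in> lie_algebra \<Longrightarrow> lie_field Y"
  by (simp add: lie_algebra_def lie_field_def)

lemma linear_op_Cinf: "linear_op P \<Longrightarrow> f \<in> Cinf \<Longrightarrow> P f \<in> Cinf"
  and linear_op_add: "linear_op P \<Longrightarrow> f \<in> Cinf \<Longrightarrow> g \<in> Cinf \<Longrightarrow> P (\<lambda>x. f x + g x) = (\<lambda>x. P f x + P g x)"
  and linear_op_cmult: "linear_op P \<Longrightarrow> f \<in> Cinf \<Longrightarrow> P (\<lambda>x. c * f x) = (\<lambda>x. c * P f x)"
  by (simp_all add: linear_op_def)

lemma linear_op_zero: "linear_op P \<Longrightarrow> P (\<lambda>x. 0) = (\<lambda>x. 0)"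
  using linear_op_cmult[of P "\<lambda>x. 0" 0] by simp

lemma linear_op_sum:
  assumes P: "linear_op P" and f: "\<And>i. i \<in> I \<Longrightarrow> f i \<in> Cinf"
  shows "P (\<lambda>x. \<Sum>i\<in>I. f i x) = (\<lambda>x. \<Sum>i\<in>I. P (f i) x)"
  using f
proof (induction I rule: infinite_finite_induct)
  case (insert i I)
  then have "P (\<lambda>x. f i x + (\<Sum>i\<in>I. f i x)) = (\<lambda>x. P (f i) x + P (\<lambda>x. \<Sum>i\<in>I. f i x) x)"
    by (intro linear_op_add[OF P] Cinf_sum) auto
  with insert show ?case by simp
qed (simp_all add: linear_op_zero[OF P])

lemma lie_field_linear: "lie_field Y \<Longrightarrow> linear_op Y"
  by (simp add: lie_field_def)

lemma lie_field_mult: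
  "lie_field Y \<Longrightarrow> f \<in> Cinf \<Longrightarrow> g \<in> Cinf \<Longrightarrow> Y (\<lambda>x. f x * g x) = (\<lambda>x. Y f x * g x + f x * Y g x)"
  by (simp add: lie_field_def)

lemma lie_field_left: "lie_field Y \<Longrightarrow> f \<in> Cinf \<Longrightarrow> Y f x = Y (\<lambda>y. f (x \<otimes> y)) \<one>"
  by (simp add: lie_field_def left_invariant_def)

text \<open>Hadamard's lemma in a chart at the unit, multiplied by the square of a cutoff function so that
  both factors of each summand are smooth on the whole group.\<close>

lemma lie_field_coordinates:
  assumes B: "orthonormal_basis V B"
  obtains \<theta> where "\<And>b. b \<in> B \<Longrightarrow> \<theta> b \<in> Cinf" "\<And>b x. cnj (\<theta> b x) = \<theta> b x"
    "\<And>f. f \<in> Cinf \<Longrightarrow> \<exists>\<gamma>. \<forall>Y. lie_field Y \<longrightarrow> Y f \<one> = (\<Sum>b\<in>B. \<gamma> b * Y (\<theta> b) \<one>)"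
proof -
  obtain U \<phi> where c: "(U, \<phi>) \<in> \<A>" "\<one> \<in> U" using chart_cover .
  obtain R where R: "R > 0" "V \<inter> ball (\<phi> \<one>) R \<subseteq> \<phi> ` U"
    using chart_ball[OF c(1) c(2) chart_open[OF c(1)]] by blast
  define p where "p = \<phi> \<one>"
  have pV: "p \<in> V" using chart_image_V[OF c(1)] c(2) by (auto simp: p_def)
  let ?ct = "cutoff p (R/2)"
  let ?U = "V \<inter> ball p R"
  have oU: "openin (top_of_set V) ?U" by (rule openin_Int_ball)
  define cut where "cut g x = (if x \<in> U then ?ct (\<phi> x) *\<^sub>R g (\<phi> x) else 0)" for g :: "'e \<Rightarrow> complex" and x
  have cutC: "cut g \<in> Cinf" if "smooth_on V ?U g" for g
    unfolding cut_def p_def by (rule Cinf_cutoff[OF c]) (use R that in \<open>auto simp: p_def\<close>)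
  \<comment> \<open>Cut-off coordinate functions centred at the unit: real, zero at the unit, and
    smooth on the whole group.\<close>
  define \<theta> where "\<theta> b = cut (\<lambda>a. complex_of_real (inner (a - p) b))" for b
  define C where "C = cut (\<lambda>a. 1)"
  define \<kappa> where "\<kappa> = complex_of_real (?ct p)"
  have \<kappa>: "\<kappa> \<noteq> 0" using cutoff_pos[of "R/2" p] R by (simp add: \<kappa>_def)
  have \<theta>C: "\<theta> b \<in> Cinf" for b
    unfolding \<theta>_def
  proof (rule cutC, unfold smooth_on_def, rule allI)
    fix k
    have "bounded_linear (\<lambda>a. complex_of_real (inner a b))"
      by (intro bounded_linear_compose[OF bounded_linear_of_real] bounded_linear_inner_left)
    from Ck_on_affine[OF subspace_V oU this, of k "- complex_of_real (inner p b)"]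
    show "Ck_on k V ?U (\<lambda>a. complex_of_real (inner (a - p) b))" by (simp add: inner_diff_left)
  qed
  have CC: "C \<in> Cinf" unfolding C_def by (rule cutC) (simp add: smooth_on_def Ck_on_const)
  have C1: "C \<one> = \<kappa>" using c by (simp add: C_def cut_def \<kappa>_def p_def scaleR_conv_of_real)
  have \<theta>1: "\<theta> b \<one> = 0" for b by (simp add: \<theta>_def cut_def p_def)
  have "\<exists>\<gamma>. \<forall>Y. lie_field Y \<longrightarrow> Y f \<one> = (\<Sum>b\<in>B. \<gamma> b * Y (\<theta> b) \<one>)" if f: "f \<in> Cinf" for f
  proof -
    have "smooth_on V ?U (f \<circ> inv_into U \<phi>)"
      using Cinf_chart[OF f c(1)] Ck_on_subset R(2) unfolding smooth_on_def p_def by blast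
    from hadamard[OF subspace_V pV B this] obtain g where
      g: "\<And>b. b \<in> B \<Longrightarrow> smooth_on V ?U (g b)"
      and F: "\<And>a. a \<in> ?U \<Longrightarrow> (f \<circ> inv_into U \<phi>) a = (f \<circ> inv_into U \<phi>) p + (\<Sum>b\<in>B. inner (a - p) b *\<^sub>R g b a)"
      by blast
    have G: "cut (g b) \<in> Cinf" if "b \<in> B" for b by (rule cutC[OF g[OF that]])
    \<comment> \<open>The remainder terms are products of two cut-off factors, which is why f - f(e)
      is multiplied by the square of \<open>C\<close>. Outside the ball all cut-off functions are 0
      and so are both sides.\<close>
    have eq: "C x * (C x * f x) = C x * (C x * f \<one>) + (\<Sum>b\<in>B. \<theta> b x * cut (g b) x)" for x
    proof (cases "x \<in> U \<and> \<phi> x \<in> ?U")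
      case True
      then have "f x = f \<one> + (\<Sum>b\<in>B. inner (\<phi> x - p) b *\<^sub>R g b (\<phi> x))"
        using F[of "\<phi> x"] c by (simp add: p_def)
      moreover have "\<theta> b x * cut (g b) x = C x * (C x * (inner (\<phi> x - p) b *\<^sub>R g b (\<phi> x)))" for b
        using True by (simp add: \<theta>_def C_def cut_def scaleR_conv_of_real)
      ultimately show ?thesis by (simp add: distrib_left sum_distrib_left)
    next
      case False
      then have "x \<in> U \<longrightarrow> dist p (\<phi> x) \<ge> R/2"
        using chart_image_V[OF c(1)] R(1) by auto
      then have "cut h x = 0" for h
        using cutoff_eq_0[of "R/2" p "\<phi> x"] R by (auto simp: cut_def)
      then show ?thesis by (simp add: \<theta>_def C_def)
    qed
    \<comment> \<open>Leibniz at the unit: the terms containing \<open>Y C\<close> occur on both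
      sides, the vanishing of \<open>\<theta> b\<close> there removes one half of each summand, and
      \<kappa>^2 times the value of \<open>Y f\<close> remains.\<close>
    have "Y f \<one> = (\<Sum>b\<in>B. (cut (g b) \<one> / (\<kappa> * \<kappa>)) * Y (\<theta> b) \<one>)" if Y: "lie_field Y" for Y
    proof -
      have lin: "linear_op Y" by (rule lie_field_linear[OF Y])
      have "Y (\<lambda>x. C x * (C x * f x)) = Y (\<lambda>x. C x * (C x * f \<one>) + (\<Sum>b\<in>B. \<theta> b x * cut (g b) x))"
        using eq by simp
      also have "\<dots> = (\<lambda>x. Y (\<lambda>x. C x * (C x * f \<one>)) x + Y (\<lambda>x. \<Sum>b\<in>B. \<theta> b x * cut (g b) x) x)"
        by (rule linear_op_add[OF lin]) (intro Cinf_mult Cinf_sum CC \<theta>C G Cinf_const; assumption)+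
      also have "Y (\<lambda>x. \<Sum>b\<in>B. \<theta> b x * cut (g b) x) = (\<lambda>x. \<Sum>b\<in>B. Y (\<lambda>x. \<theta> b x * cut (g b) x) x)"
        by (rule linear_op_sum[OF lin]) (intro Cinf_mult \<theta>C G)
      finally have e: "Y (\<lambda>x. C x * (C x * f x)) \<one> = Y (\<lambda>x. C x * (C x * f \<one>)) \<one> + (\<Sum>b\<in>B. Y (\<lambda>x. \<theta> b x * cut (g b) x) \<one>)"
        by (simp add: fun_eq_iff)
      have k: "Y (\<lambda>x. f \<one>) = (\<lambda>x. 0)"
      proof -
        have "Y (\<lambda>x. 1 * 1) = (\<lambda>x. Y (\<lambda>x. 1) x * 1 + 1 * Y (\<lambda>x. 1) x)"
          by (rule lie_field_mult[OF Y]) auto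
        then have "Y (\<lambda>x. 1) x = 0" for x by (simp add: fun_eq_iff)
        moreover have "Y (\<lambda>x. f \<one> * 1) = (\<lambda>x. f \<one> * Y (\<lambda>x. 1) x)"
          by (rule linear_op_cmult[OF lin]) simp
        ultimately show ?thesis by simp
      qed
      have "Y (\<lambda>x. C x * (C x * f x)) \<one> = Y C \<one> * (\<kappa> * f \<one>) + \<kappa> * (Y C \<one> * f \<one> + \<kappa> * Y f \<one>)"
        using lie_field_mult[OF Y CC Cinf_mult[OF CC f]] lie_field_mult[OF Y CC f] C1 by simp
      moreover have "Y (\<lambda>x. C x * (C x * f \<one>)) \<one> = Y C \<one> * (\<kappa> * f \<one>) + \<kappa> * (Y C \<one> * f \<one>)"
        using lie_field_mult[OF Y CC Cinf_mult[OF CC Cinf_const[of "f \<one>"]]]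
          lie_field_mult[OF Y CC Cinf_const[of "f \<one>"]] C1 k by simp
      moreover have "Y (\<lambda>x. \<theta> b x * cut (g b) x) \<one> = Y (\<theta> b) \<one> * cut (g b) \<one>" if "b \<in> B" for b
        using lie_field_mult[OF Y \<theta>C G[OF that]] \<theta>1 by simp
      ultimately have "\<kappa> * (\<kappa> * Y f \<one>) = (\<Sum>b\<in>B. Y (\<theta> b) \<one> * cut (g b) \<one>)"
        using e by (simp add: algebra_simps)
      moreover have "(\<Sum>b\<in>B. (cut (g b) \<one> / (\<kappa> * \<kappa>)) * Y (\<theta> b) \<one>) = (\<Sum>b\<in>B. Y (\<theta> b) \<one> * cut (g b) \<one>) / (\<kappa> * \<kappa>)"
        unfolding sum_divide_distrib by (intro sum.cong) (auto simp: mult.commute)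
      ultimately show ?thesis using \<kappa> by (metis mult.assoc nonzero_mult_div_cancel_left no_zero_divisors)
    qed
    then show ?thesis by (intro exI[of _ "\<lambda>b. cut (g b) \<one> / (\<kappa> * \<kappa>)"] allI impI)
  qed
  moreover have "cnj (\<theta> b x) = \<theta> b x" for b x
    by (simp add: \<theta>_def cut_def scaleR_conv_of_real)
  ultimately show thesis using that \<theta>C by blast
qed

lemma frame_lie_field: "left_invariant_frame X \<Longrightarrow> i < n \<Longrightarrow> lie_field (X i)"
  unfolding left_invariant_frame_def using lie_algebra_lie_field by blast

text \<open>By Hadamard's lemma a field is determined at the unit by its values on n coordinate
  functions, and then everywhere by left invariance. Fields thus embed linearly into the
  n-dimensional \<open>V\<close>, where the images of the frame form a basis.\<close>

lemma frame_spans: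
  assumes X: "left_invariant_frame X" and Y: "lie_field Y"
  obtains c :: "nat \<Rightarrow> real" where "\<And>f. f \<in> Cinf \<Longrightarrow> Y f = (\<lambda>x. \<Sum>i<n. complex_of_real (c i) * X i f x)"
proof -
  obtain B where B: "orthonormal_basis V B" using orthonormal_basis_exists[OF subspace_V] .
  obtain \<theta> where \<theta>: "\<And>b. b \<in> B \<Longrightarrow> \<theta> b \<in> Cinf" "\<And>b x. cnj (\<theta> b x) = \<theta> b x"
    "\<And>f. f \<in> Cinf \<Longrightarrow> \<exists>\<gamma>. \<forall>Y. lie_field Y \<longrightarrow> Y f \<one> = (\<Sum>b\<in>B. \<gamma> b * Y (\<theta> b) \<one>)"
    using lie_field_coordinates[OF B] by blast
  have fB: "finite B" and BV: "B \<subseteq> V" using B by (auto simp: orthonormal_basis_def)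
  have BB: "inner a b = (if a = b then 1 else 0)" if "a \<in> B" "b \<in> B" for a b
    using B that by (simp add: orthonormal_basis_def)
  \<comment> \<open>The tangent vector at the unit. Its coordinates
    \<open>Y (\<theta> b) \<one>\<close> are real because \<open>Y\<close> commutes with complex
    conjugation and \<open>\<theta> b\<close> is real; this is what makes the coefficients
    real.\<close>
  define l where "l Y = (\<Sum>b\<in>B. Re (Y (\<theta> b) \<one>) *\<^sub>R b)" for Y :: "'g operator"
  have lV: "l Y \<in> V" for Y
    unfolding l_def using BV by (intro Real_Vector_Spaces.subspace_sum[OF subspace_V] Real_Vector_Spaces.subspace_scale[OF subspace_V]) auto
  have lb: "complex_of_real (inner (l Y) b) = Y (\<theta> b) \<one>" if "lie_field Y" "b \<in> B" for Y b
  proof -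
    have "inner (l Y) b = (\<Sum>a\<in>B. Re (Y (\<theta> a) \<one>) * inner a b)"
      by (simp add: l_def inner_sum_left)
    also have "\<dots> = (\<Sum>a\<in>B. if a = b then Re (Y (\<theta> a) \<one>) else 0)"
      using that BB by (intro sum.cong) auto
    also have "\<dots> = Re (Y (\<theta> b) \<one>)" using that fB by simp
    finally have 1: "inner (l Y) b = Re (Y (\<theta> b) \<one>)" .
    have "Y (\<theta> b) \<one> = Y (\<lambda>x. cnj (\<theta> b x)) \<one>" by (simp only: \<theta>(2))
    also have "\<dots> = cnj (Y (\<theta> b) \<one>)"
      using that(1) \<theta>(1)[OF that(2)] unfolding lie_field_def by metis
    finally have "Y (\<theta> b) \<one> = cnj (Y (\<theta> b) \<one>)" .
    from arg_cong[OF this, of Im] have "Im (Y (\<theta> b) \<one>) = 0" by simp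
    then show ?thesis using 1 by (simp add: complex_eq_iff)
  qed
  text \<open>A linear relation between tangent vectors at the unit is one between the fields.\<close>
  have key: "Y f x = (\<Sum>i<n. complex_of_real (c i) * X i f x)"
    if Y: "lie_field Y" and rel: "l Y = (\<Sum>i<n. c i *\<^sub>R l (X i))" and f: "f \<in> Cinf" for Y c f x
  proof -
    have 1: "Y h \<one> = (\<Sum>i<n. complex_of_real (c i) * X i h \<one>)" if "h \<in> Cinf" for h
    proof -
      obtain \<gamma> where \<gamma>: "\<And>Y. lie_field Y \<Longrightarrow> Y h \<one> = (\<Sum>b\<in>B. \<gamma> b * Y (\<theta> b) \<one>)"
        using \<theta>(3)[OF \<open>h \<in> Cinf\<close>] by blast
      have "Y (\<theta> b) \<one> = (\<Sum>i<n. complex_of_real (c i) * X i (\<theta> b) \<one>)" if "b \<in> B" for b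
      proof -
        have "Y (\<theta> b) \<one> = complex_of_real (inner (l Y) b)" using lb[OF Y that] by simp
        also have "\<dots> = (\<Sum>i<n. complex_of_real (c i) * complex_of_real (inner (l (X i)) b))"
          unfolding rel by (simp add: inner_sum_left)
        also have "\<dots> = (\<Sum>i<n. complex_of_real (c i) * X i (\<theta> b) \<one>)"
          using lb[OF frame_lie_field[OF X] that] by simp
        finally show ?thesis .
      qed
      then have "Y h \<one> = (\<Sum>b\<in>B. \<Sum>i<n. \<gamma> b * (complex_of_real (c i) * X i (\<theta> b) \<one>))"
        using \<gamma>[OF Y] by (simp add: sum_distrib_left)
      also have "\<dots> = (\<Sum>i<n. complex_of_real (c i) * (\<Sum>b\<in>B. \<gamma> b * X i (\<theta> b) \<one>))"
        by (subst sum.swap) (simp add: sum_distrib_left mult_ac)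
      also have "\<dots> = (\<Sum>i<n. complex_of_real (c i) * X i h \<one>)"
        using \<gamma>[OF frame_lie_field[OF X]] by simp
      finally show ?thesis .
    qed
    have "Y f x = Y (\<lambda>y. f (x \<otimes> y)) \<one>" by (rule lie_field_left[OF Y f])
    also have "\<dots> = (\<Sum>i<n. complex_of_real (c i) * X i (\<lambda>y. f (x \<otimes> y)) \<one>)"
      by (rule 1[OF Cinf_left[OF f]])
    also have "\<dots> = (\<Sum>i<n. complex_of_real (c i) * X i f x)"
      using lie_field_left[OF frame_lie_field[OF X] f, symmetric] by simp
    finally show ?thesis .
  qed
  \<comment> \<open>A linear relation between the tangent vectors of the frame is \<open>key\<close>
    for the zero field, so their independence follows from that of the frame.\<close>
  have zero: "lie_field (\<lambda>f x. 0)"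
    by (simp add: lie_field_def linear_op_def left_invariant_def)
  obtain c where "l Y = (\<Sum>i<n. c i *\<^sub>R l (X i))"
  proof (rule independent_family_spans[OF subspace_V dim_V, of "\<lambda>i. l (X i)" "l Y"])
    fix c :: "nat \<Rightarrow> real" assume "(\<Sum>i<n. c i *\<^sub>R l (X i)) = 0"
    then have "l (\<lambda>f x. 0) = (\<Sum>i<n. c i *\<^sub>R l (X i))" by (simp add: l_def)
    from key[OF zero this] have "\<forall>f\<in>Cinf. \<forall>x. (\<Sum>i<n. complex_of_real (c i) * X i f x) = 0" by simp
    then show "\<forall>i<n. c i = 0" using X by (auto simp: left_invariant_frame_def)
  qed (use lV in auto)
  then show thesis using key[OF Y] that by blast
qed

section \<open>Ordered monomials span the algebra generated by a frame\<close>

text \<open>The Leibniz rule survives because the mixed terms \<open>Y f * Z g\<close> and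
  \<open>Z f * Y g\<close> cancel. Hence a commutator of two letters can be replaced by single
  letters.\<close>

lemma lie_field_bracket:
  assumes Y: "lie_field Y" and Z: "lie_field Z"
  shows "lie_field (\<lambda>f x. Y (Z f) x - Z (Y f) x)"
proof -
  have lY: "linear_op Y" and lZ: "linear_op Z" using Y Z lie_field_linear by auto
  note C = linear_op_Cinf[OF lY] linear_op_Cinf[OF lZ]
  have "linear_op (\<lambda>f x. Y (Z f) x - Z (Y f) x)"
    unfolding linear_op_def
  proof (intro conjI ballI allI)
    fix f g c assume f: "f \<in> Cinf"
    show "(\<lambda>x. Y (Z f) x - Z (Y f) x) \<in> Cinf"
      using C f by (intro Cinf_diff) blast+
    show "(\<lambda>x. Y (Z (\<lambda>x. c * f x)) x - Z (Y (\<lambda>x. c * f x)) x) = (\<lambda>x. c * (Y (Z f) x - Z (Y f) x))"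
      using C f by (simp add: linear_op_cmult[OF lY] linear_op_cmult[OF lZ] right_diff_distrib)
    assume "g \<in> Cinf"
    then show "(\<lambda>x. Y (Z (\<lambda>x. f x + g x)) x - Z (Y (\<lambda>x. f x + g x)) x) =
        (\<lambda>x. (Y (Z f) x - Z (Y f) x) + (Y (Z g) x - Z (Y g) x))"
      using C f by (simp add: linear_op_add[OF lY] linear_op_add[OF lZ] add_diff_add)
  qed
  moreover have "left_invariant (\<lambda>f x. Y (Z f) x - Z (Y f) x)"
    using Y Z C unfolding lie_field_def left_invariant_def by simp
  moreover have "(\<lambda>x. Y (Z (\<lambda>x. f x * g x)) x - Z (Y (\<lambda>x. f x * g x)) x) =
     (\<lambda>x. (Y (Z f) x - Z (Y f) x) * g x + f x * (Y (Z g) x - Z (Y g) x))" if "f \<in> Cinf" "g \<in> Cinf" for f g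
    using that C by (simp add: lie_field_mult[OF Y] lie_field_mult[OF Z] linear_op_add[OF lY]
        linear_op_add[OF lZ] Cinf_mult algebra_simps)
  moreover have "(\<lambda>x. Y (Z (\<lambda>x. cnj (f x))) x - Z (Y (\<lambda>x. cnj (f x))) x) =
      (\<lambda>x. cnj (Y (Z f) x - Z (Y f) x))" if "f \<in> Cinf" for f
    using Y Z C that unfolding lie_field_def by simp
  ultimately show ?thesis unfolding lie_field_def by blast
qed

definition word :: "(nat \<Rightarrow> 'g operator) \<Rightarrow> nat list \<Rightarrow> 'g operator" where
  "word X w = foldr (\<lambda>i F. X i \<circ> F) w id"

lemma word_Nil [simp]: "word X [] f = f"
  and word_Cons [simp]: "word X (i # w) f = X i (word X w f)"
  by (simp_all add: word_def)

text \<open>Operators that agree on \<open>Cinf\<close> with a complex combination of words of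
  length strictly below \<open>k\<close>; thus \<open>word_span X (length w)\<close> is the space of
  lower-order remainders for \<open>w\<close>. Equality is asked on smooth functions only, where
  linearity is available.\<close>

inductive word_span :: "(nat \<Rightarrow> 'g operator) \<Rightarrow> nat \<Rightarrow> 'g operator \<Rightarrow> bool" for X k where
  zero: "\<forall>f\<in>Cinf. P f = (\<lambda>x. 0) \<Longrightarrow> word_span X k P"
| add: "word_span X k P \<Longrightarrow> length w < k \<Longrightarrow> set w \<subseteq> {..<n} \<Longrightarrow>
     \<forall>f\<in>Cinf. Q f = (\<lambda>x. P f x + c * word X w f x) \<Longrightarrow> word_span X k Q"

lemma word_Cinf: "(\<And>i. i < n \<Longrightarrow> linear_op (X i)) \<Longrightarrow> set w \<subseteq> {..<n} \<Longrightarrow> f \<in> Cinf \<Longrightarrow> word X w f \<in> Cinf"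
proof (induction w)
  case (Cons i w)
  then show ?case using linear_op_Cinf[of "X i" "word X w f"] by simp
qed simp

lemma word_span_Cinf:
  assumes "\<And>i. i < n \<Longrightarrow> linear_op (X i)" "word_span X k P" "f \<in> Cinf"
  shows "P f \<in> Cinf"
  using assms(2)
  by (induction rule: word_span.induct)
     (use assms in \<open>auto intro!: Cinf_add Cinf_cmult word_Cinf\<close>)

lemma word_span_cong:
  "word_span X k P \<Longrightarrow> \<forall>f\<in>Cinf. Q f = P f \<Longrightarrow> word_span X k Q"
  by (induction arbitrary: Q rule: word_span.induct) (auto intro: word_span.intros)

lemma word_span_mono:
  "word_span X k P \<Longrightarrow> k \<le> k' \<Longrightarrow> word_span X k' P"
proof (induction rule: word_span.induct)
  case (add P w Q c)
  then show ?case by (intro word_span.add[of X k' P w Q c]) auto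
qed (rule word_span.zero)

lemma word_span_word:
  assumes "length w < k" "set w \<subseteq> {..<n}"
  shows "word_span X k (word X w)"
  by (rule word_span.add[OF word_span.zero[of "\<lambda>f x. 0"] assms, where c = 1]) auto

lemma word_span_add:
  assumes "word_span X k Q" "word_span X k P"
  shows "word_span X k (\<lambda>f x. P f x + Q f x)"
  using assms(1)
proof (induction rule: word_span.induct)
  case (zero Q)
  then show ?case by (intro word_span_cong[OF assms(2)]) auto
next
  case (add Q w R c)
  show ?case
    by (rule word_span.add[OF add.IH add.hyps(2,3), where c = c]) (use add in \<open>auto simp: add.assoc\<close>)
qed

lemma word_span_cmult:
  assumes "word_span X k P"
  shows "word_span X k (\<lambda>f x. a * P f x)"
  using assms
proof (induction rule: word_span.induct)
  case (zero P)
  then show ?case by (intro word_span.zero) auto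
next
  case (add P w Q c)
  show ?case
    by (rule word_span.add[OF add.IH add.hyps(2,3), where c = "a * c"]) (use add in \<open>auto simp: algebra_simps\<close>)
qed

lemma word_span_sum:
  "(\<And>i. i \<in> I \<Longrightarrow> word_span X k (P i)) \<Longrightarrow> word_span X k (\<lambda>f x. \<Sum>i\<in>I. P i f x)"
proof (induction I rule: infinite_finite_induct)
  case (insert i I)
  then have "word_span X k (\<lambda>f x. P i f x + (\<Sum>i\<in>I. P i f x))" by (intro word_span_add) auto
  then show ?case by (rule word_span_cong) (use insert in auto)
qed (auto intro: word_span.zero)

lemma word_span_compose:
  assumes X: "\<And>i. i < n \<Longrightarrow> linear_op (X i)" and i: "i < n" and "word_span X k P"
  shows "word_span X (Suc k) (\<lambda>f. X i (P f))"
  using assms(3)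
proof (induction rule: word_span.induct)
  case (zero P)
  then show ?case using linear_op_zero[OF X[OF i]] by (intro word_span.zero) auto
next
  case (add P w Q c)
  have "X i (Q f) = (\<lambda>x. X i (P f) x + c * word X (i # w) f x)" if f: "f \<in> Cinf" for f
    using add f word_span_Cinf[OF X add.hyps(1) f] word_Cinf[OF X add.hyps(3) f]
    by (simp add: linear_op_add[OF X[OF i]] linear_op_cmult[OF X[OF i]] Cinf_cmult)
  then show ?case
    using add i by (intro word_span.add[OF add.IH, of "i # w"]) auto
qed

text \<open>Any field is a combination of the n letters, so composing with it on the left raises the
  length bound by one only.\<close>

lemma word_span_lie_field:
  assumes X: "left_invariant_frame X" and Y: "lie_field Y" and P: "word_span X k P"
  shows "word_span X (Suc k) (\<lambda>f. Y (P f))"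
proof -
  have lin: "linear_op (X i)" if "i < n" for i
    using frame_lie_field[OF X that] lie_field_linear by blast
  obtain c :: "nat \<Rightarrow> real" where c: "\<And>f. f \<in> Cinf \<Longrightarrow> Y f = (\<lambda>x. \<Sum>i<n. complex_of_real (c i) * X i f x)"
    using frame_spans[OF X Y] by blast
  have "word_span X (Suc k) (\<lambda>f x. \<Sum>i<n. complex_of_real (c i) * X i (P f) x)"
    by (intro word_span_sum word_span_cmult word_span_compose[OF lin _ P]) auto
  then show ?thesis
    by (rule word_span_cong) (use c word_span_Cinf[OF lin P] in auto)
qed

text \<open>Moving \<open>X x\<close> to the right past a smaller letter \<open>X y\<close> leaves
  their commutator, again a field and so a combination of single letters: the remainder has words
  with at least one letter fewer.\<close>

lemma word_insort:
  assumes X: "left_invariant_frame X" and "x < n" "set w \<subseteq> {..<n}"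
  obtains D where "word_span X (length (x # w)) D"
    "\<And>f. f \<in> Cinf \<Longrightarrow> word X (x # w) f = (\<lambda>z. word X (insort x w) f z + D f z)"
  using assms(3)
proof (induction w arbitrary: thesis)
  case Nil
  show ?case by (rule Nil(1)[of "\<lambda>f x. 0"]) (auto intro: word_span.zero)
next
  case (Cons y w)
  have lin: "linear_op (X i)" if "i < n" for i
    using frame_lie_field[OF X that] lie_field_linear by blast
  show ?case
  proof (cases "x \<le> y")
    case True
    show ?thesis by (rule Cons.prems(1)[of "\<lambda>f x. 0"]) (use True in \<open>auto intro: word_span.zero\<close>)
  next
    case False
    have y: "y < n" and w: "set w \<subseteq> {..<n}" using Cons.prems by auto
    obtain D where D: "word_span X (length (x # w)) D"
      "\<And>f. f \<in> Cinf \<Longrightarrow> word X (x # w) f = (\<lambda>z. word X (insort x w) f z + D f z)"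
      using Cons.IH w by blast
    let ?Z = "\<lambda>f z. X x (X y f) z - X y (X x f) z"
    have Z: "lie_field ?Z"
      by (rule lie_field_bracket[OF frame_lie_field[OF X \<open>x < n\<close>] frame_lie_field[OF X y]])
    have 1: "word_span X (length (x # y # w)) (\<lambda>f. ?Z (word X w f))"
      using word_span_lie_field[OF X Z word_span_word[of w "Suc (length w)"]] w by simp
    have 2: "word_span X (length (x # y # w)) (\<lambda>f. X y (D f))"
      using word_span_compose[OF lin y D(1)] by simp
    have "word X (x # y # w) f = (\<lambda>z. word X (insort x (y # w)) f z + (?Z (word X w f) z + X y (D f) z))"
      if f: "f \<in> Cinf" for f
    proof -
      have "set (insort x w) \<subseteq> {..<n}" using w \<open>x < n\<close> by (auto simp: set_insort_key)
      then have "X y (word X (x # w) f) = (\<lambda>z. X y (word X (insort x w) f) z + X y (D f) z)"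
        using D(2)[OF f] linear_op_add[OF lin[OF y] word_Cinf[OF lin _ f] word_span_Cinf[OF lin D(1) f]] by simp
      then show ?thesis using False by (simp add: fun_eq_iff)
    qed
    from Cons.prems(1)[OF word_span_add[OF 2 1] this] show ?thesis .
  qed
qed

text \<open>Insertion sort: the tail is sorted, then the head is inserted. Both operations leave
  remainders made of words shorter than the whole.\<close>

lemma word_sort:
  assumes X: "left_invariant_frame X" and "set w \<subseteq> {..<n}"
  obtains D where "word_span X (length w) D"
    "\<And>f. f \<in> Cinf \<Longrightarrow> word X w f = (\<lambda>z. word X (sort w) f z + D f z)"
  using assms(2)
proof (induction w arbitrary: thesis)
  case Nil
  show ?case by (rule Nil(1)[of "\<lambda>f x. 0"]) (auto intro: word_span.zero)
next
  case (Cons x w)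
  have lin: "linear_op (X i)" if "i < n" for i
    using frame_lie_field[OF X that] lie_field_linear by blast
  have x: "x < n" and w: "set w \<subseteq> {..<n}" using Cons.prems by auto
  obtain D where D: "word_span X (length w) D"
    "\<And>f. f \<in> Cinf \<Longrightarrow> word X w f = (\<lambda>z. word X (sort w) f z + D f z)"
    using Cons.IH w by blast
  obtain E where E: "word_span X (length (x # sort w)) E"
    "\<And>f. f \<in> Cinf \<Longrightarrow> word X (x # sort w) f = (\<lambda>z. word X (insort x (sort w)) f z + E f z)"
    using word_insort[OF X x, of "sort w"] w by auto
  have 1: "word_span X (length (x # w)) (\<lambda>f. X x (D f))"
    using word_span_compose[OF lin x D(1)] by simp
  have 2: "word_span X (length (x # w)) E" using E(1) by simp
  have "word X (x # w) f = (\<lambda>z. word X (sort (x # w)) f z + (E f z + X x (D f) z))" if f: "f \<in> Cinf" for f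
  proof -
    have "X x (word X w f) = (\<lambda>z. X x (word X (sort w) f) z + X x (D f) z)"
      using D(2)[OF f] linear_op_add[OF lin[OF x] word_Cinf[OF lin _ f] word_span_Cinf[OF lin D(1) f]] w by simp
    then show ?thesis using E(2)[OF f] by (simp add: fun_eq_iff)
  qed
  from Cons.prems(1)[OF word_span_add[OF 1 2] this] show ?case .
qed

lemma word_append: "word X (v @ w) f = word X v (word X w f)"
  by (induction v) auto

lemma word_replicate: "word X (replicate k i) f = (X i ^^ k) f"
  by (induction k) auto

lemma partial_eq_word: "partial X \<beta> f = word X (concat (map (\<lambda>i. replicate (\<beta> i) i) [0..<n])) f"
proof -
  have "foldr (\<lambda>i F. (X i ^^ \<beta> i) \<circ> F) is id f = word X (concat (map (\<lambda>i. replicate (\<beta> i) i) is)) f" for "is"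
    by (induction "is") (auto simp: word_append word_replicate)
  then show ?thesis by (simp add: partial_def)
qed

lemma sort_eq_concat_replicate:
  assumes "set w \<subseteq> {..<m}"
  shows "sort w = concat (map (\<lambda>i. replicate (count_list w i) i) [0..<m])"
proof (rule properties_for_sort)
  show "sorted (concat (map (\<lambda>i. replicate (count_list w i) i) [0..<m]))"
    by (induction m) (auto simp: sorted_append)
  have "count (mset (concat (map (\<lambda>i. replicate (count_list w i) i) [0..<k]))) j =
      (if j < k then count_list w j else 0)" for j k
    by (induction k) auto
  moreover have "count_list w j = 0" if "\<not> j < m" for j
    using assms that by (intro count_notin) auto
  ultimately show "mset (concat (map (\<lambda>i. replicate (count_list w i) i) [0..<m])) = mset w"
    by (intro multiset_eqI) (auto simp: count_mset)
qed

text \<open>A vector space of operators, membership in which depends on the action on smooth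
  functions only. The instance of interest is the set of all \<open>P\<close> satisfying one symbol
  estimate.\<close>

definition op_space :: "'g operator set \<Rightarrow> bool" where
  "op_space S \<longleftrightarrow> (\<forall>P\<in>S. \<forall>Q\<in>S. (\<lambda>f x. P f x + Q f x) \<in> S) \<and>
     (\<forall>P\<in>S. \<forall>c. (\<lambda>f x. c * P f x) \<in> S) \<and>
     (\<forall>P\<in>S. \<forall>Q. (\<forall>f\<in>Cinf. Q f = P f) \<longrightarrow> Q \<in> S)"

text \<open>Induction on the length bound: on smooth functions a word is the ordered monomial
  \<open>partial X (count_list w)\<close> plus a remainder of shorter words, which lies in
  \<open>S\<close> by induction.\<close>

lemma ordered_monomials_span:
  assumes X: "left_invariant_frame X" and S: "op_space S" and part: "\<And>\<beta>. partial X \<beta> \<in> S"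
    and P: "word_span X k P"
  shows "P \<in> S"
proof -
  have add: "(\<lambda>f x. P f x + Q f x) \<in> S" if "P \<in> S" "Q \<in> S" for P Q
    using S that unfolding op_space_def by blast
  have cmult: "(\<lambda>f x. c * P f x) \<in> S" if "P \<in> S" for P c
    using S that unfolding op_space_def by blast
  have cong: "Q \<in> S" if "P \<in> S" "\<And>f. f \<in> Cinf \<Longrightarrow> Q f = P f" for P Q
    using S that unfolding op_space_def by blast
  have span: "P \<in> S" if words: "\<And>w. length w < k \<Longrightarrow> set w \<subseteq> {..<n} \<Longrightarrow> word X w \<in> S"
    and "word_span X k P" for k P
    using that(2)
  proof (induction rule: word_span.induct)
    case (zero P)
    show ?case by (rule cong[OF cmult[OF part, where c = 0]]) (use zero in auto)
  next
    case (add P w Q c)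
    show ?case
      by (rule cong[OF \<open>\<And>Q P. P \<in> S \<Longrightarrow> Q \<in> S \<Longrightarrow> (\<lambda>f x. P f x + Q f x) \<in> S\<close>[OF add.IH cmult[OF words[OF add.hyps(2,3)], of c]]])
         (use add in auto)
  qed
  have "word X w \<in> S" if "length w < k" "set w \<subseteq> {..<n}" for w k
    using that
  proof (induction k arbitrary: w)
    case (Suc k)
    obtain D where D: "word_span X (length w) D"
      "\<And>f. f \<in> Cinf \<Longrightarrow> word X w f = (\<lambda>z. word X (sort w) f z + D f z)"
      using word_sort[OF X Suc.prems(2)] by blast
    have "D \<in> S"
      by (rule span[OF Suc.IH]) (use word_span_mono[OF D(1), of k] Suc.prems(1) in auto)
    moreover have "partial X (count_list w) f = word X (sort w) f" for f
      by (simp add: partial_eq_word sort_eq_concat_replicate[OF Suc.prems(2)])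
    ultimately show ?case
      using cong[OF add[OF part[of "count_list w"] \<open>D \<in> S\<close>], of "word X w"] D(2) by simp
  qed simp
  then show ?thesis using span P by blast
qed

text \<open>As \<open>S\<close> contains ordered monomials of every degree, it is enough to expand a
  monomial in \<open>Y\<close> into words in \<open>X\<close> of some bounded length.\<close>

lemma partial_in_op_space:
  assumes X: "left_invariant_frame X" and S: "op_space S" and part: "\<And>\<beta>. partial X \<beta> \<in> S"
    and Y: "\<And>i. i < n \<Longrightarrow> lie_field (Y i)"
  shows "partial Y \<beta> \<in> S"
proof -
  have "\<exists>k. word_span X k (word Y w)" if "set w \<subseteq> {..<n}" for w
    using that
  proof (induction w)
    case Nil
    have "word Y [] = word X []" by (simp add: word_def)
    then show ?case using word_span_word[of "[]" 1 X] by (metis empty_subsetI length_greater_0_conv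
        less_one list.set(1) list.size(3))
  next
    case (Cons i w)
    then obtain k where "word_span X k (word Y w)" by auto
    then have "word_span X (Suc k) (\<lambda>f. Y i (word Y w f))"
      using Cons.prems by (intro word_span_lie_field[OF X Y]) auto
    moreover have "word Y (i # w) = (\<lambda>f. Y i (word Y w f))" by auto
    ultimately show ?case by auto
  qed
  moreover have "partial Y \<beta> = word Y (concat (map (\<lambda>i. replicate (\<beta> i) i) [0..<n]))"
    using partial_eq_word by blast
  moreover have "set (concat (map (\<lambda>i. replicate (\<beta> i) i) [0..<n])) \<subseteq> {..<n}"
    by auto
  ultimately obtain k where "word_span X k (partial Y \<beta>)" by metis
  then show ?thesis by (rule ordered_monomials_span[OF X S part])
qed

section \<open>Operator norm\<close>

abbreviation vnorm :: "nat \<Rightarrow> complex vec \<Rightarrow> real" where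
  "vnorm d v \<equiv> L2_set (\<lambda>i. cmod (vec_index v i)) {..<d}"

lemma mat_vec_index:
  fixes M :: "complex mat"
  assumes "M \<in> carrier_mat d d" "v \<in> carrier_vec d" "i < d"
  shows "(M *\<^sub>v v) $ i = (\<Sum>j<d. M $$ (i, j) * v $ j)"
  using assms by (auto simp: scalar_prod_def atLeast0LessThan intro!: sum.cong)

lemma mat_mult_index:
  fixes M :: "complex mat"
  assumes "M \<in> carrier_mat d d" "N \<in> carrier_mat d d" "i < d" "j < d"
  shows "(M * N) $$ (i, j) = (\<Sum>k<d. M $$ (i, k) * N $$ (k, j))"
  using assms by (auto simp: scalar_prod_def atLeast0LessThan intro!: sum.cong)

lemma mat_mult3_index:
  fixes M :: "complex mat"
  assumes "L \<in> carrier_mat d d" "M \<in> carrier_mat d d" "N \<in> carrier_mat d d" "i < d" "j < d"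
  shows "(L * M * N) $$ (i, j) = (\<Sum>l<d. \<Sum>k<d. L $$ (i, k) * M $$ (k, l) * N $$ (l, j))"
  unfolding mat_mult_index[OF mult_carrier_mat[OF assms(1,2)] assms(3,4,5)]
proof (rule sum.cong[OF refl])
  fix l assume "l \<in> {..<d}"
  then have "l < d" by simp
  then show "(L * M) $$ (i, l) * N $$ (l, j) = (\<Sum>k<d. L $$ (i, k) * M $$ (k, l) * N $$ (l, j))"
    by (simp only: mat_mult_index[OF assms(1,2,4)] sum_distrib_right)
qed

lemma vnorm_unitary:
  fixes U :: "complex mat"
  assumes U: "U \<in> carrier_mat d d" "mat_adjoint U * U = 1\<^sub>m d" and v: "v \<in> carrier_vec d"
  shows "vnorm d (U *\<^sub>v v) = vnorm d v"
proof -
  have orth: "(\<Sum>i<d. cnj (U $$ (i, l)) * U $$ (i, k)) = (if l = k then 1 else 0)" if "l < d" "k < d" for l k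
  proof -
    have "(mat_adjoint U * U) $$ (l, k) = (\<Sum>i<d. cnj (U $$ (i, l)) * U $$ (i, k))"
      unfolding mat_mult_index[OF mat_adjoint_carrier[OF U(1)] U(1) that]
      using U(1) that by (auto simp: mat_adjoint_index intro!: sum.cong)
    then show ?thesis using U(2) that by simp
  qed
  have sq: "complex_of_real (\<Sum>i<d. (cmod (vec_index w i))\<^sup>2) = (\<Sum>i<d. w $ i * cnj (w $ i))" for w :: "complex vec"
    by (simp only: of_real_sum complex_norm_square)
  have "(\<Sum>i<d. (U *\<^sub>v v) $ i * cnj ((U *\<^sub>v v) $ i)) =
      (\<Sum>i<d. \<Sum>k<d. \<Sum>l<d. v $ k * cnj (v $ l) * (cnj (U $$ (i, l)) * U $$ (i, k)))"
    using mat_vec_index[OF U(1) v] by (simp add: sum_product mult_ac)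
  also have "\<dots> = (\<Sum>k<d. \<Sum>l<d. \<Sum>i<d. v $ k * cnj (v $ l) * (cnj (U $$ (i, l)) * U $$ (i, k)))"
    by (subst sum.swap, rule sum.cong[OF refl], subst sum.swap) rule
  also have "\<dots> = (\<Sum>k<d. \<Sum>l<d. v $ k * cnj (v $ l) * (if l = k then 1 else 0))"
    using orth by (simp add: sum_distrib_left[symmetric])
  also have "\<dots> = (\<Sum>k<d. v $ k * cnj (v $ k))"
  proof (rule sum.cong[OF refl])
    fix k assume "k \<in> {..<d}"
    moreover have "(\<Sum>l<d. v $ k * cnj (v $ l) * (if l = k then 1 else 0)) =
        (\<Sum>l<d. if l = k then v $ k * cnj (v $ l) else 0)" by (rule sum.cong) auto
    ultimately show "(\<Sum>l<d. v $ k * cnj (v $ l) * (if l = k then 1 else 0)) = v $ k * cnj (v $ k)"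
      by (simp only: sum.delta finite_lessThan if_True)
  qed
  finally have "(\<Sum>i<d. (cmod (vec_index (U *\<^sub>v v) i))\<^sup>2) = (\<Sum>i<d. (cmod (vec_index v i))\<^sup>2)"
    using sq[of "U *\<^sub>v v"] sq[of v] of_real_eq_iff by metis
  then show ?thesis by (simp add: L2_set_def)
qed

lemma mat_adjoint_adjoint:
  fixes U :: "complex mat"
  shows "mat_adjoint (mat_adjoint U) = U"
proof -
  have "mat_adjoint U \<in> carrier_mat (dim_col U) (dim_row U)" by (rule mat_adjoint_carrier) auto
  then show ?thesis
    by (intro eq_matI) (auto simp: mat_adjoint_index mat_adjoint_def mat_of_rows_def)
qed

lemma unitary_adjoint:
  fixes U :: "complex mat"
  assumes "U \<in> carrier_mat d d" "mat_adjoint U * U = 1\<^sub>m d"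
  shows "U * mat_adjoint U = 1\<^sub>m d"
  using mat_mult_left_right_inverse[OF mat_adjoint_carrier[OF assms(1)] assms] .

definition op_values :: "nat \<Rightarrow> complex mat \<Rightarrow> real set" where
  "op_values d M = {vnorm d (M *\<^sub>v v) | v. v \<in> carrier_vec d \<and> vnorm d v \<le> 1}"

lemma op_norm_eq: "M \<in> carrier_mat d d \<Longrightarrow> op_norm M = Sup (op_values d M)"
  unfolding op_norm_def op_values_def by auto

lemma op_values_unitary_conj:
  assumes M: "M \<in> carrier_mat d d" and U: "U \<in> carrier_mat d d" "mat_adjoint U * U = 1\<^sub>m d"
  shows "op_values d (mat_adjoint U * M * U) \<subseteq> op_values d M"
proof
  fix r assume "r \<in> op_values d (mat_adjoint U * M * U)"
  then obtain v where v: "v \<in> carrier_vec d" "vnorm d v \<le> 1" "r = vnorm d ((mat_adjoint U * M * U) *\<^sub>v v)"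
    unfolding op_values_def by blast
  have U': "mat_adjoint U \<in> carrier_mat d d" by (rule mat_adjoint_carrier[OF U(1)])
  have w: "U *\<^sub>v v \<in> carrier_vec d" using U v by auto
  have "(mat_adjoint U * M * U) *\<^sub>v v = mat_adjoint U *\<^sub>v (M *\<^sub>v (U *\<^sub>v v))"
    using U U' M v w by (metis assoc_mult_mat_vec mult_carrier_mat)
  moreover have "mat_adjoint (mat_adjoint U) * mat_adjoint U = 1\<^sub>m d"
    using unitary_adjoint[OF U] by (simp add: mat_adjoint_adjoint)
  moreover have "M *\<^sub>v (U *\<^sub>v v) \<in> carrier_vec d" using M w by auto
  ultimately have "r = vnorm d (M *\<^sub>v (U *\<^sub>v v))"
    using v(3) vnorm_unitary[OF U'] by simp
  moreover have "vnorm d (U *\<^sub>v v) \<le> 1" using vnorm_unitary[OF U v(1)] v(2) by simp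
  ultimately show "r \<in> op_values d M" using w unfolding op_values_def by blast
qed

text \<open>The inclusion between the sets of values is used twice, the second time for the
  conjugated matrix and the adjoint of \<open>U\<close>; the sets are then equal, not only their
  suprema.\<close>

lemma op_norm_unitary_conj:
  assumes M: "M \<in> carrier_mat d d" and U: "U \<in> carrier_mat d d" "mat_adjoint U * U = 1\<^sub>m d"
  shows "op_norm (mat_adjoint U * M * U) = op_norm M"
proof -
  let ?U = "mat_adjoint U"
  have U': "?U \<in> carrier_mat d d" by (rule mat_adjoint_carrier[OF U(1)])
  have UU: "U * ?U = 1\<^sub>m d" by (rule unitary_adjoint[OF U])
  have c: "?U * M * U \<in> carrier_mat d d" using U U' M by auto
  have "mat_adjoint ?U * (?U * M * U) * ?U = U * (?U * M * U) * ?U" by (simp add: mat_adjoint_adjoint)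
  also have "\<dots> = (U * ?U) * M * (U * ?U)"
    using U(1) U' M by (smt (verit) assoc_mult_mat mult_carrier_mat)
  also have "\<dots> = M" using UU M by simp
  finally have "op_values d M \<subseteq> op_values d (?U * M * U)"
    using op_values_unitary_conj[OF c U'] UU by (simp add: mat_adjoint_adjoint)
  then have "op_values d M = op_values d (?U * M * U)"
    using op_values_unitary_conj[OF M U] by blast
  then show ?thesis using op_norm_eq[OF M] op_norm_eq[OF c] by simp
qed

text \<open>A crude bound by the sum of the moduli of all entries, so that \<open>Sup\<close> is a
  genuine least upper bound.\<close>

lemma op_values_bdd:
  assumes M: "M \<in> carrier_mat d d"
  shows "bdd_above (op_values d M)"
proof (rule bdd_aboveI)
  fix r assume "r \<in> op_values d M"
  then obtain v where v: "v \<in> carrier_vec d" "vnorm d v \<le> 1" "r = vnorm d (M *\<^sub>v v)"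
    unfolding op_values_def by blast
  have vj: "cmod (v $ j) \<le> 1" if "j < d" for j
    using member_le_L2_set[of "{..<d}" j "\<lambda>i. cmod (v $ i)"] that v(2) by simp
  have "r \<le> (\<Sum>i<d. cmod ((M *\<^sub>v v) $ i))"
    unfolding v(3) by (rule L2_set_le_sum) simp
  also have "\<dots> \<le> (\<Sum>i<d. \<Sum>j<d. cmod (M $$ (i, j)))"
  proof (rule sum_mono)
    fix i assume "i \<in> {..<d}"
    then have "cmod ((M *\<^sub>v v) $ i) \<le> (\<Sum>j<d. cmod (M $$ (i, j) * v $ j))"
      using mat_vec_index[OF M v(1)] norm_sum by simp
    also have "\<dots> \<le> (\<Sum>j<d. cmod (M $$ (i, j)) * 1)"
      unfolding norm_mult using vj by (intro sum_mono mult_left_mono) auto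
    finally show "cmod ((M *\<^sub>v v) $ i) \<le> (\<Sum>j<d. cmod (M $$ (i, j)))" by simp
  qed
  finally show "r \<le> (\<Sum>i<d. \<Sum>j<d. cmod (M $$ (i, j)))" .
qed

lemma op_norm_combination:
  assumes M: "M \<in> carrier_mat d d" and N: "N \<in> carrier_mat d d"
  shows "op_norm (a \<cdot>\<^sub>m M + b \<cdot>\<^sub>m N) \<le> cmod a * op_norm M + cmod b * op_norm N"
proof -
  have c: "a \<cdot>\<^sub>m M + b \<cdot>\<^sub>m N \<in> carrier_mat d d" using M N by auto
  have le: "vnorm d (K *\<^sub>v v) \<le> op_norm K" if "K \<in> carrier_mat d d" "v \<in> carrier_vec d" "vnorm d v \<le> 1" for K v
    unfolding op_norm_eq[OF that(1)]
    by (rule cSup_upper[OF _ op_values_bdd[OF that(1)]]) (use that in \<open>auto simp: op_values_def\<close>)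
  show ?thesis
    unfolding op_norm_eq[OF c]
  proof (rule cSup_least)
    have "0\<^sub>v d \<in> carrier_vec d" "vnorm d (0\<^sub>v d) \<le> 1" by (auto simp: L2_set_def)
    then show "op_values d (a \<cdot>\<^sub>m M + b \<cdot>\<^sub>m N) \<noteq> {}" unfolding op_values_def by blast
    fix r assume "r \<in> op_values d (a \<cdot>\<^sub>m M + b \<cdot>\<^sub>m N)"
    then obtain v where v: "v \<in> carrier_vec d" "vnorm d v \<le> 1" "r = vnorm d ((a \<cdot>\<^sub>m M + b \<cdot>\<^sub>m N) *\<^sub>v v)"
      unfolding op_values_def by blast
    have e: "((a \<cdot>\<^sub>m M + b \<cdot>\<^sub>m N) *\<^sub>v v) $ i = a * (M *\<^sub>v v) $ i + b * (N *\<^sub>v v) $ i" if "i < d" for i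
      unfolding mat_vec_index[OF c v(1) that] mat_vec_index[OF M v(1) that] mat_vec_index[OF N v(1) that]
        sum_distrib_left sum.distrib[symmetric]
      using M N that by (intro sum.cong) (auto simp: algebra_simps)
    have "r \<le> L2_set (\<lambda>i. cmod a * cmod ((M *\<^sub>v v) $ i) + cmod b * cmod ((N *\<^sub>v v) $ i)) {..<d}"
      unfolding v(3)
    proof (rule L2_set_mono)
      fix i assume "i \<in> {..<d}"
      then show "cmod (((a \<cdot>\<^sub>m M + b \<cdot>\<^sub>m N) *\<^sub>v v) $ i) \<le> cmod a * cmod ((M *\<^sub>v v) $ i) + cmod b * cmod ((N *\<^sub>v v) $ i)"
        using e[of i] norm_triangle_ineq[of "a * (M *\<^sub>v v) $ i" "b * (N *\<^sub>v v) $ i"] by (simp add: norm_mult)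
    qed simp
    also have "\<dots> \<le> L2_set (\<lambda>i. cmod a * cmod ((M *\<^sub>v v) $ i)) {..<d} + L2_set (\<lambda>i. cmod b * cmod ((N *\<^sub>v v) $ i)) {..<d}"
      by (rule L2_set_triangle_ineq)
    also have "\<dots> = cmod a * vnorm d (M *\<^sub>v v) + cmod b * vnorm d (N *\<^sub>v v)"
      by (simp add: L2_set_right_distrib)
    also have "\<dots> \<le> cmod a * op_norm M + cmod b * op_norm N"
      using le[OF M v(1,2)] le[OF N v(1,2)] by (intro add_mono mult_left_mono) auto
    finally show "r \<le> cmod a * op_norm M + cmod b * op_norm N" .
  qed
qed

section \<open>Transport of operators and distributions along diffeomorphisms\<close>

text \<open>A diffeomorphism, encoded by an explicit inverse and by the pull-back of smooth
  functions, as operators and distributions see it.\<close>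

definition smooth_bij :: "('g \<Rightarrow> 'g) \<Rightarrow> ('g \<Rightarrow> 'g) \<Rightarrow> bool" where
  "smooth_bij \<theta> \<theta>' \<longleftrightarrow> (\<forall>x. \<theta> (\<theta>' x) = x \<and> \<theta>' (\<theta> x) = x) \<and>
     (\<forall>f\<in>Cinf. (\<lambda>x. f (\<theta> x)) \<in> Cinf \<and> (\<lambda>x. f (\<theta>' x)) \<in> Cinf)"

definition push :: "('g \<Rightarrow> 'g) \<Rightarrow> ('g \<Rightarrow> 'g) \<Rightarrow> 'g operator \<Rightarrow> 'g operator" where
  "push \<theta> \<theta>' P = (\<lambda>f x. P (\<lambda>y. f (\<theta> y)) (\<theta>' x))"

definition conjugation :: "'g \<Rightarrow> 'g \<Rightarrow> 'g" where
  "conjugation a x = inv a \<otimes> x \<otimes> a"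

lemma conj_conj [simp]: "conjugation a (conjugation (inv a) x) = x" "conjugation (inv a) (conjugation a x) = x"
  by (simp_all add: conjugation_def m_assoc)

lemma conj_one_iff [simp]: "conjugation a x = \<one> \<longleftrightarrow> x = \<one>"
proof -
  have "conjugation b \<one> = \<one>" for b by (simp add: conjugation_def)
  then show ?thesis by (metis conj_conj(2))
qed

lemma Cinf_conj: "f \<in> Cinf \<Longrightarrow> (\<lambda>x. f (conjugation a x)) \<in> Cinf"
  unfolding conjugation_def using Cinf_left[OF Cinf_right[of f a], of "inv a"] by simp

lemma smooth_bij_right: "smooth_bij (\<lambda>x. x \<otimes> a) (\<lambda>x. x \<otimes> inv a)"
  by (simp add: smooth_bij_def Cinf_right)

lemma smooth_bij_conj: "smooth_bij (conjugation a) (conjugation (inv a))"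
  by (simp add: smooth_bij_def Cinf_conj)

lemma right_push_eq: "right_push a = push (\<lambda>x. x \<otimes> a) (\<lambda>x. x \<otimes> inv a)"
  by (simp add: right_push_def push_def fun_eq_iff)

lemma push_linear: "smooth_bij \<theta> \<theta>' \<Longrightarrow> linear_op P \<Longrightarrow> linear_op (push \<theta> \<theta>' P)"
  unfolding linear_op_def push_def smooth_bij_def by simp

lemma push_commutator:
  assumes "smooth_bij \<theta> \<theta>'"
  shows "commutator (push \<theta> \<theta>' P) g = push \<theta> \<theta>' (commutator P (\<lambda>x. g (\<theta> x)))"
  using assms by (simp add: commutator_def push_def smooth_bij_def fun_eq_iff)

text \<open>The commutator of a pushed operator with g is the push of the commutator with g o
  \<theta>, so the recursive definition of order carries over.\<close>

lemma push_diff_op: "smooth_bij \<theta> \<theta>' \<Longrightarrow> diff_op k P \<Longrightarrow> diff_op k (push \<theta> \<theta>' P)"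
proof (induction k arbitrary: P)
  case 0
  then have "commutator P (\<lambda>x. g (\<theta> x)) (\<lambda>x. f (\<theta> x)) = (\<lambda>x. 0)" if "g \<in> Cinf" "f \<in> Cinf" for f g
    using that by (simp add: smooth_bij_def)
  then show ?case
    using 0 push_linear[OF 0(1)] by (simp add: push_commutator[OF 0(1)]) (simp add: push_def)
next
  case (Suc k)
  then have "\<forall>g\<in>Cinf. (\<lambda>x. g (\<theta> x)) \<in> Cinf" by (simp add: smooth_bij_def)
  then show ?case
    using Suc push_linear[OF Suc.prems(1)] by (simp add: push_commutator[OF Suc.prems(1)])
qed

lemma push_push: "smooth_bij \<theta> \<theta>' \<Longrightarrow> push \<theta>' \<theta> (push \<theta> \<theta>' P) = P"
  by (simp add: push_def smooth_bij_def)

lemma right_push_right_push: "right_push a (right_push (inv a) P) = P" "right_push (inv a) (right_push a P) = P"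
  by (simp_all add: right_push_def)

lemma left_invariantD:
  "left_invariant P \<Longrightarrow> f \<in> Cinf \<Longrightarrow> P (\<lambda>x. f (a \<otimes> x)) = (\<lambda>x. P f (a \<otimes> x))"
  by (simp add: left_invariant_def)

lemma right_push_left_invariant:
  assumes "left_invariant P"
  shows "left_invariant (right_push a P)"
  unfolding left_invariant_def right_push_def
proof (intro ballI allI ext)
  fix f b x assume "f \<in> Cinf"
  then have "P (\<lambda>y. f (b \<otimes> y \<otimes> a)) = (\<lambda>x. P (\<lambda>y. f (y \<otimes> a)) (b \<otimes> x))"
    using left_invariantD[OF assms Cinf_right[of f a], of b] by blast
  then show "P (\<lambda>y. f (b \<otimes> (y \<otimes> a))) (x \<otimes> inv a) = P (\<lambda>y. f (y \<otimes> a)) (b \<otimes> x \<otimes> inv a)"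
    by (simp add: m_assoc)
qed

lemma right_push_LDiff: "P \<in> LDiff k \<Longrightarrow> right_push a P \<in> LDiff k"
  unfolding LDiff_def using push_diff_op[OF smooth_bij_right] right_push_left_invariant
  by (auto simp: right_push_eq[symmetric])

lemma right_push_lie_algebra:
  assumes "X \<in> lie_algebra"
  shows "right_push a X \<in> lie_algebra"
proof -
  have "linear_op (right_push a X)" "left_invariant (right_push a X)"
    using assms push_linear[OF smooth_bij_right] right_push_left_invariant
    by (auto simp: right_push_eq[symmetric] lie_algebra_def)
  moreover have "(\<lambda>y. f (y \<otimes> a)) \<notin> Cinf" if "f \<notin> Cinf" for f
    using Cinf_right[of "\<lambda>y. f (y \<otimes> a)" "inv a"] that by auto
  ultimately show ?thesis
    using assms Cinf_right unfolding lie_algebra_def by (simp add: right_push_def)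
qed

text \<open>Conjugation consists of a left translation, which a left-invariant operator absorbs into
  the point of evaluation, and a right translation, which becomes a push-forward. Properties at the
  unit of q composed with conjugation are thereby moved from q to \<open>P\<close>.\<close>

lemma left_invariant_conj:
  assumes "left_invariant P" "q \<in> Cinf"
  shows "P (\<lambda>x. q (conjugation a x)) \<one> = right_push a P q \<one>"
proof -
  have "P (\<lambda>x. q (inv a \<otimes> x \<otimes> a)) = (\<lambda>x. P (\<lambda>y. q (y \<otimes> a)) (inv a \<otimes> x))"
    by (rule left_invariantD[OF assms(1) Cinf_right[OF assms(2)]])
  then show ?thesis by (simp add: conjugation_def right_push_def)
qed

text \<open>Right push-forward maps \<open>LDiff j\<close> to itself, so the conditions for the
  conjugated function are among those for q.\<close>

lemma vanishes_of_order_conj: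
  assumes "vanishes_of_order l q"
  shows "vanishes_of_order l (\<lambda>x. q (conjugation a x))"
proof -
  have q: "q \<in> Cinf" using assms by (simp add: vanishes_of_order_def)
  have "P (\<lambda>x. q (conjugation a x)) \<one> = 0" if "j < l" "P \<in> LDiff j" for j P
  proof -
    have "P (\<lambda>x. q (conjugation a x)) \<one> = right_push a P q \<one>"
      using that q by (intro left_invariant_conj) (auto simp: LDiff_def)
    then show ?thesis
      using assms right_push_LDiff[OF that(2)] that(1) by (simp add: vanishes_of_order_def)
  qed
  then show ?thesis using Cinf_conj[OF q] by (simp add: vanishes_of_order_def)
qed

text \<open>\<open>right_push a\<close> acts on the Lie algebra as a bijection (the adjoint action),
  so the two families of differentials satisfy the same linear relations.\<close>

lemma differentials_independent_conj:
  assumes "\<And>j. j \<in> J \<Longrightarrow> q j \<in> Cinf"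
  shows "differentials_independent (\<lambda>j x. q j (conjugation a x)) J \<longleftrightarrow> differentials_independent q J"
proof -
  have eq: "X (\<lambda>x. q j (conjugation a x)) \<one> = right_push a X (q j) \<one>" if "X \<in> lie_algebra" "j \<in> J" for X j
    using that assms by (intro left_invariant_conj) (auto simp: lie_algebra_def)
  have "(\<forall>X\<in>lie_algebra. (\<Sum>j\<in>J. c j * X (\<lambda>x. q j (conjugation a x)) \<one>) = 0) \<longleftrightarrow>
      (\<forall>X\<in>lie_algebra. (\<Sum>j\<in>J. c j * X (q j) \<one>) = 0)" (is "?l \<longleftrightarrow> ?r") for c
  proof
    assume l: ?l
    show ?r
    proof
      fix X assume X: "X \<in> lie_algebra"
      have Y: "right_push (inv a) X \<in> lie_algebra" by (rule right_push_lie_algebra[OF X])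
      have "(\<Sum>j\<in>J. c j * right_push a (right_push (inv a) X) (q j) \<one>) =
          (\<Sum>j\<in>J. c j * right_push (inv a) X (\<lambda>x. q j (conjugation a x)) \<one>)"
        by (intro sum.cong refl) (simp only: eq[OF Y])
      also have "\<dots> = 0" using bspec[OF l Y] .
      finally have "(\<Sum>j\<in>J. c j * right_push a (right_push (inv a) X) (q j) \<one>) = 0" .
      then show "(\<Sum>j\<in>J. c j * X (q j) \<one>) = 0" by (simp add: right_push_right_push)
    qed
  next
    assume r: ?r
    show ?l
    proof
      fix X assume X: "X \<in> lie_algebra"
      have "(\<Sum>j\<in>J. c j * X (\<lambda>x. q j (conjugation a x)) \<one>) = (\<Sum>j\<in>J. c j * right_push a X (q j) \<one>)"
        by (intro sum.cong refl) (simp only: eq[OF X])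
      also have "\<dots> = 0" using bspec[OF r right_push_lie_algebra[OF X]] .
      finally show "(\<Sum>j\<in>J. c j * X (\<lambda>x. q j (conjugation a x)) \<one>) = 0" .
    qed
  qed
  then show ?thesis unfolding differentials_independent_def by simp
qed

lemma admissible_conj:
  assumes "admissible K q"
  shows "admissible K (\<lambda>j x. q j (conjugation a x))"
proof -
  have C: "q j \<in> Cinf" if "j < K" for j using assms that by (simp add: admissible_def vanishes_of_order_def)
  have "\<exists>X\<in>lie_algebra. X (\<lambda>x. q j (conjugation a x)) \<one> \<noteq> 0" if "j < K" for j
  proof -
    obtain X where X: "X \<in> lie_algebra" "X (q j) \<one> \<noteq> 0" using assms \<open>j < K\<close> unfolding admissible_def by blast
    have Y: "right_push (inv a) X \<in> lie_algebra" by (rule right_push_lie_algebra[OF X(1)])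
    have "right_push (inv a) X (\<lambda>x. q j (conjugation a x)) \<one> = right_push a (right_push (inv a) X) (q j) \<one>"
      using Y C[OF that] by (intro left_invariant_conj) (auto simp: lie_algebra_def)
    then show ?thesis using X Y by (metis right_push_right_push(1))
  qed
  moreover have "differentials_rank K (\<lambda>j x. q j (conjugation a x)) = differentials_rank K q"
  proof -
    have "J \<subseteq> {..<K} \<and> differentials_independent (\<lambda>j x. q j (conjugation a x)) J \<longleftrightarrow>
        J \<subseteq> {..<K} \<and> differentials_independent q J" for J
      using differentials_independent_conj[of J q a] C by blast
    then show ?thesis by (simp add: differentials_rank_def)
  qed
  ultimately show ?thesis
    using assms vanishes_of_order_conj by (simp add: admissible_def)
qed

lemma strongly_admissible_conj:
  assumes "strongly_admissible K q"
  shows "strongly_admissible K (\<lambda>j x. q j (conjugation a x))"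
proof -
  have "(\<forall>j<K. q j x = 0) \<longleftrightarrow> x = \<one>" for x
    using assms by (auto simp: strongly_admissible_def set_eq_iff)
  then have "(\<forall>j<K. q j (conjugation a x) = 0) \<longleftrightarrow> x = \<one>" for x by simp
  then have "(\<Inter>j<K. {x. q j (conjugation a x) = 0}) = {\<one>}" by auto
  then show ?thesis using assms admissible_conj by (simp add: strongly_admissible_def)
qed

lemma foldr_hom: "(\<And>i F. h (s i F) = s' i (h F)) \<Longrightarrow> h (foldr s is b) = foldr s' is (h b)"
  by (induction "is") simp_all

lemma foldr_closed: "(\<And>i F. i \<in> set is \<Longrightarrow> Q F \<Longrightarrow> Q (s i F)) \<Longrightarrow> Q b \<Longrightarrow> Q (foldr s is b)"
  by (induction "is") simp_all

lemma right_push_partial: "right_push a (partial X \<beta>) = partial (\<lambda>i. right_push a (X i)) \<beta>"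
proof -
  have comp: "right_push a (P \<circ> Q) = right_push a P \<circ> right_push a Q" for P Q
    by (auto simp: right_push_def)
  have id: "right_push a id = id" by (auto simp: right_push_def)
  have pow: "right_push a (P ^^ k) = right_push a P ^^ k" for P k
    by (induction k) (simp_all only: funpow.simps comp id)
  show ?thesis
    unfolding partial_def
    by (subst foldr_hom[of "right_push a" _ "\<lambda>i F. (right_push a (X i) ^^ \<beta> i) \<circ> F"])
       (simp_all only: comp id pow)
qed

lemma partial_linear:
  assumes "\<And>i. i < n \<Longrightarrow> linear_op (X i)"
  shows "linear_op (partial X \<beta>)"
proof -
  have comp: "linear_op (P \<circ> Q)" if "linear_op P" "linear_op Q" for P Q
    using that unfolding linear_op_def by simp
  have id: "linear_op id" by (simp add: linear_op_def)
  have pow: "linear_op (P ^^ k)" if "linear_op P" for P k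
    by (induction k) (simp_all only: funpow.simps comp id that)
  show ?thesis
    unfolding partial_def
    by (rule foldr_closed[of _ linear_op, OF comp[OF pow[OF assms]] id]) simp_all
qed

lemma LDiff_linear: "P \<in> LDiff k \<Longrightarrow> linear_op P"
  unfolding LDiff_def by (cases k) auto

section \<open>Distributions and difference operators\<close>

text \<open>The algebraic part of \<open>distribution\<close>, which is what the computation of a
  Fourier coefficient of \<open>times_dist q f\<close> calls for.\<close>

definition lin_dist :: "'g dist \<Rightarrow> bool" where
  "lin_dist T \<longleftrightarrow> (\<forall>f\<in>Cinf. \<forall>g\<in>Cinf. T (\<lambda>x. f x + g x) = T f + T g) \<and>
     (\<forall>f\<in>Cinf. \<forall>c. T (\<lambda>x. c * f x) = c * T f)"

lemma distribution_lin: "distribution T \<Longrightarrow> lin_dist T"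
  by (simp add: distribution_def lin_dist_def)

lemma lin_dist_sum:
  assumes T: "lin_dist T" and f: "\<And>i. i \<in> I \<Longrightarrow> f i \<in> Cinf"
  shows "T (\<lambda>x. \<Sum>i\<in>I. c i * f i x) = (\<Sum>i\<in>I. c i * T (f i))"
  using f
proof (induction I rule: infinite_finite_induct)
  have "T (\<lambda>x. c * f x) = c * T f" if "f \<in> Cinf" for c f
    using T that by (simp add: lin_dist_def)
  from this[OF Cinf_const[of 0], of 0] have zero: "T (\<lambda>x. 0) = 0" by simp
  {
  case (insert i I)
  then have "T (\<lambda>x. c i * f i x + (\<Sum>i\<in>I. c i * f i x)) = T (\<lambda>x. c i * f i x) + T (\<lambda>x. \<Sum>i\<in>I. c i * f i x)"
    using T by (simp add: lin_dist_def Cinf_cmult Cinf_sum)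
  then show ?case using insert T by (simp add: lin_dist_def)
next
  case (infinite I)
  then show ?case using zero by simp
next
  case empty
  then show ?case using zero by simp
  }
qed

lemma lin_dist_times: "lin_dist T \<Longrightarrow> q \<in> Cinf \<Longrightarrow> lin_dist (times_dist q T)"
  unfolding lin_dist_def times_dist_def
proof (intro conjI ballI allI)
  fix f g c assume T: "(\<forall>f\<in>Cinf. \<forall>g\<in>Cinf. T (\<lambda>x. f x + g x) = T f + T g) \<and> (\<forall>f\<in>Cinf. \<forall>c. T (\<lambda>x. c * f x) = c * T f)"
    and q: "q \<in> Cinf" and f: "f \<in> Cinf"
  have "(\<lambda>x. q x * (c * f x)) = (\<lambda>x. c * (q x * f x))" by (simp add: fun_eq_iff)
  then show "T (\<lambda>x. q x * (c * f x)) = c * T (\<lambda>x. q x * f x)" using T Cinf_mult[OF q f] by simp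
  assume g: "g \<in> Cinf"
  show "T (\<lambda>x. q x * (f x + g x)) = T (\<lambda>x. q x * f x) + T (\<lambda>x. q x * g x)"
    using T Cinf_mult[OF q f] Cinf_mult[OF q g] by (simp add: distrib_left)
qed

lemma range_bdd:
  assumes "f \<in> Cinf"
  shows "bdd_above (range (\<lambda>x. cmod (f x)))"
proof -
  have "compact (range (\<lambda>x. cmod (f x)))"
    using compact_continuous_image[OF continuous_on_norm[OF Cinf_continuous[OF assms]] compact_UNIV] .
  then show ?thesis by (intro bounded_imp_bdd_above compact_imp_bounded)
qed

lemma diff_op_linear: "diff_op k P \<Longrightarrow> linear_op P"
  by (cases k) auto

text \<open>In the continuity bound each differential operator is replaced by its push-forward. A
  supremum over the group does not change under reparametrisation, and injectivity of the push lets
  the sum be reindexed.\<close>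

lemma distribution_conj:
  assumes "distribution T"
  shows "distribution (\<lambda>h. T (\<lambda>x. h (conjugation a x)))"
proof -
  from assms obtain C :: real and \<P> where \<P>: "finite \<P>" "\<And>P. P \<in> \<P> \<Longrightarrow> \<exists>k. diff_op k P"
    "\<And>f. f \<in> Cinf \<Longrightarrow> cmod (T f) \<le> C * (\<Sum>P\<in>\<P>. SUP x. cmod (P f x))"
    unfolding distribution_def by blast
  let ?p = "push (conjugation a) (conjugation (inv a))"
  have inj: "inj_on ?p \<P>"
    by (rule inj_on_inverseI) (rule push_push[OF smooth_bij_conj])
  have sup: "(SUP x. cmod (?p P f x)) = (SUP x. cmod (P (\<lambda>x. f (conjugation a x)) x))" for P f
  proof -
    have "range (conjugation (inv a)) = UNIV"
      by (rule surjI[of _ "conjugation a"]) simp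
    then have "range (\<lambda>x. cmod (?p P f x)) = (\<lambda>x. cmod (P (\<lambda>x. f (conjugation a x)) x)) ` UNIV"
      unfolding push_def using image_image[of "\<lambda>x. cmod (P (\<lambda>x. f (conjugation a x)) x)" "conjugation (inv a)" UNIV] by simp
    then show ?thesis by simp
  qed
  have "cmod (T (\<lambda>x. f (conjugation a x))) \<le> C * (\<Sum>P\<in>?p ` \<P>. SUP x. cmod (P f x))" if "f \<in> Cinf" for f
    using \<P>(3)[OF Cinf_conj[OF that]] by (simp add: sum.reindex[OF inj] sup)
  moreover have "\<exists>k. diff_op k P" if P: "P \<in> ?p ` \<P>" for P
  proof -
    obtain P' where P': "P = ?p P'" "P' \<in> \<P>" using P by (rule imageE)
    obtain k where "diff_op k P'" using \<P>(2)[OF P'(2)] by (rule exE)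
    then show ?thesis unfolding P'(1) using push_diff_op[OF smooth_bij_conj] by (intro exI[of _ k])
  qed
  ultimately have "\<exists>(C::real) \<P>. finite \<P> \<and> (\<forall>P\<in>\<P>. \<exists>k. diff_op k P) \<and>
        (\<forall>f\<in>Cinf. cmod (T (\<lambda>x. f (conjugation a x))) \<le> C * (\<Sum>P\<in>\<P>. SUP x. cmod (P f x)))"
    using \<P>(1) by (intro exI[of _ C] exI[of _ "?p ` \<P>"]) auto
  then show ?thesis
    using assms Cinf_conj unfolding distribution_def by simp
qed

lemma distribution_combination:
  assumes "distribution S" "distribution T"
  shows "distribution (\<lambda>h. a * S h + b * T h)"
proof -
  from assms(1) obtain C :: real and \<P> where \<P>: "finite \<P>" "\<And>P. P \<in> \<P> \<Longrightarrow> \<exists>k. diff_op k P"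
    "\<And>f. f \<in> Cinf \<Longrightarrow> cmod (S f) \<le> C * (\<Sum>P\<in>\<P>. SUP x. cmod (P f x))"
    unfolding distribution_def by blast
  from assms(2) obtain D :: real and \<Q> where \<Q>: "finite \<Q>" "\<And>P. P \<in> \<Q> \<Longrightarrow> \<exists>k. diff_op k P"
    "\<And>f. f \<in> Cinf \<Longrightarrow> cmod (T f) \<le> D * (\<Sum>P\<in>\<Q>. SUP x. cmod (P f x))"
    unfolding distribution_def by blast
  have sup: "(SUP x. cmod (P f x)) \<ge> 0" if "f \<in> Cinf" "P \<in> \<P> \<union> \<Q>" for P f
  proof -
    have "P f \<in> Cinf" using that \<P>(2) \<Q>(2) diff_op_linear linear_op_Cinf by blast
    then have "cmod (P f \<one>) \<le> (SUP x. cmod (P f x))" by (intro cSUP_upper range_bdd) auto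
    then show ?thesis using norm_ge_zero order_trans by blast
  qed
  \<comment> \<open>The constants may be negative and the two sets of operators may overlap;
    absolute values and the sum over the union dominate both bounds.\<close>
  have bound: "E * (\<Sum>P\<in>\<R>. SUP x. cmod (P f x)) \<le> \<bar>E\<bar> * (\<Sum>P\<in>\<P> \<union> \<Q>. SUP x. cmod (P f x))"
    if "\<R> \<subseteq> \<P> \<union> \<Q>" "f \<in> Cinf" for E \<R> f
  proof -
    have "(\<Sum>P\<in>\<R>. SUP x. cmod (P f x)) \<le> (\<Sum>P\<in>\<P> \<union> \<Q>. SUP x. cmod (P f x))"
      using \<P>(1) \<Q>(1) that sup by (intro sum_mono2) auto
    moreover have "0 \<le> (\<Sum>P\<in>\<R>. SUP x. cmod (P f x))"
      using that sup by (intro sum_nonneg) auto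
    ultimately show ?thesis by (intro mult_mono) auto
  qed
  have "cmod (a * S f + b * T f) \<le> (cmod a * \<bar>C\<bar> + cmod b * \<bar>D\<bar>) * (\<Sum>P\<in>\<P> \<union> \<Q>. SUP x. cmod (P f x))"
    if f: "f \<in> Cinf" for f
  proof -
    let ?s = "\<Sum>P\<in>\<P> \<union> \<Q>. SUP x. cmod (P f x)"
    have "cmod (S f) \<le> \<bar>C\<bar> * ?s" "cmod (T f) \<le> \<bar>D\<bar> * ?s"
      using \<P>(3)[OF f] \<Q>(3)[OF f] bound[OF _ f, of \<P> C] bound[OF _ f, of \<Q> D] by auto
    then have "cmod a * cmod (S f) + cmod b * cmod (T f) \<le> cmod a * (\<bar>C\<bar> * ?s) + cmod b * (\<bar>D\<bar> * ?s)"
      by (intro add_mono mult_left_mono) auto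
    then show ?thesis
      using norm_triangle_ineq[of "a * S f" "b * T f"] by (simp add: norm_mult algebra_simps)
  qed
  moreover have "finite (\<P> \<union> \<Q>)" "\<forall>P\<in>\<P> \<union> \<Q>. \<exists>k. diff_op k P" using \<P> \<Q> by auto
  ultimately have "\<exists>(C::real) \<P>. finite \<P> \<and> (\<forall>P\<in>\<P>. \<exists>k. diff_op k P) \<and>
        (\<forall>f\<in>Cinf. cmod (a * S f + b * T f) \<le> C * (\<Sum>P\<in>\<P>. SUP x. cmod (P f x)))"
    by blast
  moreover have "\<forall>f\<in>Cinf. \<forall>g\<in>Cinf. a * S (\<lambda>x. f x + g x) + b * T (\<lambda>x. f x + g x) = a * S f + b * T f + (a * S g + b * T g)"
    "\<forall>f\<in>Cinf. \<forall>c. a * S (\<lambda>x. c * f x) + b * T (\<lambda>x. c * f x) = c * (a * S f + b * T f)"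
    using assms unfolding distribution_def by (simp_all add: algebra_simps)
  ultimately show ?thesis unfolding distribution_def by blast
qed


section \<open>Difference operators as relations on matrix-valued functions of
  representations\<close>

definition rep_eq :: "('g rep \<Rightarrow> complex mat) \<Rightarrow> ('g rep \<Rightarrow> complex mat) \<Rightarrow> bool" where
  "rep_eq \<tau> \<eta> \<longleftrightarrow> (\<forall>\<xi>\<in>irreps. \<tau> \<xi> = \<eta> \<xi>)"

text \<open>The binary operation \<open>\<Psi>\<close> maps pairs of arguments of the relation \<open>D\<close> to arguments of \<open>D'\<close>, and
  the corresponding values to values, where only the restrictions to irreducible representations matter.
  Unlike the relations themselves this is stable under composition.\<close>

definition transfers ::
  "(('g rep \<Rightarrow> complex mat) \<Rightarrow> ('g rep \<Rightarrow> complex mat) \<Rightarrow> ('g rep \<Rightarrow> complex mat)) \<Rightarrow>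
   (('g rep \<Rightarrow> complex mat) \<times> ('g rep \<Rightarrow> complex mat)) set \<Rightarrow>
   (('g rep \<Rightarrow> complex mat) \<times> ('g rep \<Rightarrow> complex mat)) set \<Rightarrow> bool" where
  "transfers \<Psi> D D' \<longleftrightarrow> (\<forall>\<tau> \<tau>' \<eta> \<eta>' \<omega>. (\<tau>, \<tau>') \<in> D \<longrightarrow> (\<eta>, \<eta>') \<in> D \<longrightarrow> rep_eq \<omega> (\<Psi> \<tau> \<eta>) \<longrightarrow>
     (\<exists>\<omega>'. rep_eq \<omega>' (\<Psi> \<tau>' \<eta>') \<and> (\<omega>, \<omega>') \<in> D'))"

lemma transfersD:
  assumes "transfers \<Psi> D D'" "(\<tau>, \<tau>') \<in> D" "(\<eta>, \<eta>') \<in> D" "rep_eq \<omega> (\<Psi> \<tau> \<eta>)"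
  obtains \<omega>' where "rep_eq \<omega>' (\<Psi> \<tau>' \<eta>')" "(\<omega>, \<omega>') \<in> D'"
  using assms unfolding transfers_def by blast

lemma transfers_Id: "transfers \<Psi> Id Id"
  by (simp add: transfers_def)

lemma transfers_relcomp:
  assumes "transfers \<Psi> D D'" "transfers \<Psi> E E'"
  shows "transfers \<Psi> (D O E) (D' O E')"
  unfolding transfers_def
proof (intro allI impI)
  fix \<tau> \<tau>' \<eta> \<eta>' \<omega>
  assume 1: "(\<tau>, \<tau>') \<in> D O E" and 2: "(\<eta>, \<eta>') \<in> D O E" and \<omega>: "rep_eq \<omega> (\<Psi> \<tau> \<eta>)"
  obtain t where t: "(\<tau>, t) \<in> D" "(t, \<tau>') \<in> E" using 1 by (rule relcompEpair)
  obtain h where h: "(\<eta>, h) \<in> D" "(h, \<eta>') \<in> E" using 2 by (rule relcompEpair)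
  obtain w where w: "rep_eq w (\<Psi> t h)" "(\<omega>, w) \<in> D'" using transfersD[OF assms(1), OF t(1) h(1) \<omega>] .
  obtain \<omega>' where "rep_eq \<omega>' (\<Psi> \<tau>' \<eta>')" "(w, \<omega>') \<in> E'" using transfersD[OF assms(2), OF t(2) h(2) w(1)] .
  then show "\<exists>\<omega>'. rep_eq \<omega>' (\<Psi> \<tau>' \<eta>') \<and> (\<omega>, \<omega>') \<in> D' O E'" using relcompI[OF w(2)] by (intro exI conjI)
qed

lemma transfers_relpow:
  "transfers \<Psi> D D' \<Longrightarrow> transfers \<Psi> (D ^^ k) (D' ^^ k)"
  by (induction k) (simp_all add: transfers_Id transfers_relcomp)

lemma transfers_difference_power:
  assumes "\<And>i. i < n \<Longrightarrow> transfers \<Psi> (difference (q i)) (difference (q' i))"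
  shows "transfers \<Psi> (difference_power q \<alpha>) (difference_power q' \<alpha>)"
proof -
  have "transfers \<Psi> (foldr (\<lambda>i R. R O (difference (q i) ^^ \<alpha> i)) is Id) (foldr (\<lambda>i R. R O (difference (q' i) ^^ \<alpha> i)) is Id)"
    if "set is \<subseteq> {..<n}" for "is"
    using that
  proof (induction "is")
    case Nil
    then show ?case by (simp add: transfers_Id)
  next
    case (Cons i "is")
    then show ?case using assms[of i] by (simp add: transfers_relcomp transfers_relpow)
  qed
  moreover have "set [0..<n] \<subseteq> {..<n}" by auto
  ultimately show ?thesis unfolding difference_power_def by blast
qed

definition rep_carrier :: "('g rep \<Rightarrow> complex mat) \<Rightarrow> bool" where
  "rep_carrier \<tau> \<longleftrightarrow> (\<forall>\<xi>\<in>irreps. \<tau> \<xi> \<in> carrier_mat (rep_dim \<xi>) (rep_dim \<xi>))"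

lemma fourier_carrier: "fourier T \<xi> \<in> carrier_mat (rep_dim \<xi>) (rep_dim \<xi>)"
  by (simp add: fourier_def)

lemma apply_x_carrier: "rep_carrier (apply_x P \<sigma> x)"
  by (simp add: rep_carrier_def apply_x_def)

text \<open>The zeroth power of a difference operator is \<open>Id\<close>, whose values need not be
  Fourier coefficients; the matrix sizes are therefore carried over from the argument
  \<open>apply_x P \<sigma> x\<close>.\<close>

definition preserves_carrier :: "(('g rep \<Rightarrow> complex mat) \<times> ('g rep \<Rightarrow> complex mat)) set \<Rightarrow> bool" where
  "preserves_carrier D \<longleftrightarrow> (\<forall>(\<tau>, \<tau>')\<in>D. rep_carrier \<tau> \<longrightarrow> rep_carrier \<tau>')"

lemma preserves_carrier_difference: "preserves_carrier (difference q)"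
  unfolding preserves_carrier_def difference_def rep_carrier_def using fourier_carrier by auto

lemma preserves_carrier_relcomp:
  "preserves_carrier D \<Longrightarrow> preserves_carrier E \<Longrightarrow> preserves_carrier (D O E)"
  unfolding preserves_carrier_def by blast

lemma preserves_carrier_difference_power: "preserves_carrier (difference_power q \<alpha>)"
proof -
  have Id: "preserves_carrier Id" by (auto simp: preserves_carrier_def)
  have pow: "preserves_carrier (difference (q i) ^^ k)" for i k
    by (induction k) (simp_all add: Id preserves_carrier_relcomp preserves_carrier_difference)
  show ?thesis
    unfolding difference_power_def
    by (rule foldr_closed[of _ preserves_carrier]) (simp_all add: Id pow preserves_carrier_relcomp)
qed

lemma irrep_entry_Cinf:
  assumes "haar_measure \<mu>" "\<xi> \<in> irreps" "i < rep_dim \<xi>" "j < rep_dim \<xi>"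
  shows "(\<lambda>x. mat_adjoint (\<xi> x) $$ (i, j)) \<in> Cinf"
proof -
  have "(\<lambda>x. mat_adjoint (\<xi> x) $$ (i, j)) = (\<lambda>x. cnj (\<xi> x $$ (j, i)))"
  proof
    show "mat_adjoint (\<xi> x) $$ (i, j) = cnj (\<xi> x $$ (j, i))" for x
      using irrep_carrier[OF assms(2), of x] assms(3,4) by (simp add: mat_adjoint_index)
  qed
  then show ?thesis using Cinf_cnj[OF irrep_smooth[OF assms(1,2,4,3)]] by simp
qed

text \<open>From \<xi>(u^{-1} x u)^* = \<xi>(u)^* \<xi>(x)^* \<xi>(u): each entry is a fixed
  combination of entries of \<xi>(x)^*, and these are smooth, so \<open>T\<close> is linear on
  them.\<close>

lemma fourier_conj:
  assumes \<mu>: "haar_measure \<mu>" and \<xi>: "\<xi> \<in> irreps" and T: "lin_dist T"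
  shows "fourier (\<lambda>h. T (\<lambda>x. h (conjugation u x))) \<xi> = mat_adjoint (\<xi> u) * fourier T \<xi> * \<xi> u"
proof -
  let ?d = "rep_dim \<xi>"
  have car: "\<xi> x \<in> carrier_mat ?d ?d" for x by (rule irrep_carrier[OF \<xi>])
  have car': "mat_adjoint (\<xi> x) \<in> carrier_mat ?d ?d" for x by (rule mat_adjoint_carrier[OF car])
  have F: "fourier T \<xi> \<in> carrier_mat ?d ?d" by (rule fourier_carrier)
  show ?thesis
  proof (rule eq_matI)
    fix i j
    assume "i < dim_row (mat_adjoint (\<xi> u) * fourier T \<xi> * \<xi> u)" "j < dim_col (mat_adjoint (\<xi> u) * fourier T \<xi> * \<xi> u)"
    then have ij: "i < ?d" "j < ?d" using car[of u] car'[of u] by auto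
    define c where "c z = mat_adjoint (\<xi> u) $$ (i, snd z) * \<xi> u $$ (fst z, j)" for z :: "nat \<times> nat"
    define f where "f z = (\<lambda>x. mat_adjoint (\<xi> x) $$ (snd z, fst z))" for z :: "nat \<times> nat"
    have "mat_adjoint (\<xi> (conjugation u x)) = mat_adjoint (\<xi> u) * mat_adjoint (\<xi> x) * \<xi> u" for x
    proof -
      have "inv (conjugation u x) = inv u \<otimes> inv x \<otimes> u" by (simp add: conjugation_def inv_mult_group m_assoc)
      then show ?thesis by (simp add: irrep_inv[OF \<xi>, symmetric] irrep_mult[OF \<xi>])
    qed
    then have "mat_adjoint (\<xi> (conjugation u x)) $$ (i, j) = (\<Sum>l<?d. \<Sum>k<?d. c (l, k) * f (l, k) x)" for x
      using mat_mult3_index[OF car' car' car ij, of u x u] by (simp add: c_def f_def mult_ac)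
    then have "fourier (\<lambda>h. T (\<lambda>x. h (conjugation u x))) \<xi> $$ (i, j) = T (\<lambda>x. \<Sum>z\<in>{..<?d} \<times> {..<?d}. c z * f z x)"
      using ij by (simp add: fourier_def sum.cartesian_product)
    also have "\<dots> = (\<Sum>z\<in>{..<?d} \<times> {..<?d}. c z * T (f z))"
      by (rule lin_dist_sum[OF T]) (auto simp: f_def intro!: irrep_entry_Cinf[OF \<mu> \<xi>])
    also have "\<dots> = (\<Sum>l<?d. \<Sum>k<?d. c (l, k) * T (f (l, k)))"
      by (simp add: sum.cartesian_product)
    also have "\<dots> = (\<Sum>l<?d. \<Sum>k<?d. mat_adjoint (\<xi> u) $$ (i, k) * fourier T \<xi> $$ (k, l) * \<xi> u $$ (l, j))"
      by (intro sum.cong refl) (simp add: c_def f_def fourier_def mult_ac)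
    also have "\<dots> = (mat_adjoint (\<xi> u) * fourier T \<xi> * \<xi> u) $$ (i, j)"
      by (rule mat_mult3_index[OF car' F car ij, symmetric])
    finally show "fourier (\<lambda>h. T (\<lambda>x. h (conjugation u x))) \<xi> $$ (i, j) = (mat_adjoint (\<xi> u) * fourier T \<xi> * \<xi> u) $$ (i, j)" .
  qed (use car[of u] car'[of u] in \<open>auto simp: fourier_def\<close>)
qed

lemma differenceE:
  assumes "(\<tau>, \<tau>') \<in> difference q"
  obtains f where "distribution f"
    "\<forall>\<xi>\<in>irreps. \<tau> \<xi> = fourier f \<xi> \<and> \<tau>' \<xi> = fourier (times_dist q f) \<xi>"
  using assms unfolding difference_def by auto

lemma differenceI:
  assumes "distribution f"
    "\<And>\<xi>. \<xi> \<in> irreps \<Longrightarrow> \<tau> \<xi> = fourier f \<xi> \<and> \<tau>' \<xi> = fourier (times_dist q f) \<xi>"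
  shows "(\<tau>, \<tau>') \<in> difference q"
  using assms unfolding difference_def by auto

definition conj_values :: "'g \<Rightarrow> ('g rep \<Rightarrow> complex mat) \<Rightarrow> 'g rep \<Rightarrow> complex mat" where
  "conj_values u \<tau> \<xi> = mat_adjoint (\<xi> u) * \<tau> \<xi> * \<xi> u"

text \<open>If \<open>f\<close> has the coefficients \<tau>, the functional g sending h to f(h o c),
  with c the conjugation by \<open>u\<close>, has the conjugated ones; and q g arises in the same
  way from (q o c) f.\<close>

lemma transfers_conj:
  assumes \<mu>: "haar_measure \<mu>" and q: "q \<in> Cinf"
  shows "transfers (\<lambda>\<tau> \<eta>. conj_values u \<tau>) (difference (\<lambda>x. q (conjugation u x))) (difference q)"
  unfolding transfers_def
proof (intro allI impI)
  fix \<tau> \<tau>' \<eta> \<eta>' \<omega>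
  assume 1: "(\<tau>, \<tau>') \<in> difference (\<lambda>x. q (conjugation u x))" and \<omega>: "rep_eq \<omega> (conj_values u \<tau>)"
  obtain f where f: "distribution f" and
    eq: "\<forall>\<xi>\<in>irreps. \<tau> \<xi> = fourier f \<xi> \<and> \<tau>' \<xi> = fourier (times_dist (\<lambda>x. q (conjugation u x)) f) \<xi>"
    by (rule differenceE[OF 1])
  let ?g = "\<lambda>h. f (\<lambda>x. h (conjugation u x))"
  have t: "times_dist q ?g = (\<lambda>h. times_dist (\<lambda>x. q (conjugation u x)) f (\<lambda>x. h (conjugation u x)))"
    by (simp add: times_dist_def)
  have "\<omega> \<xi> = fourier ?g \<xi> \<and> conj_values u \<tau>' \<xi> = fourier (times_dist q ?g) \<xi>" if "\<xi> \<in> irreps" for \<xi>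
    using \<omega> bspec[OF eq that] that fourier_conj[OF \<mu> that distribution_lin[OF f]]
      fourier_conj[OF \<mu> that lin_dist_times[OF distribution_lin[OF f] Cinf_conj[OF q]]]
    unfolding t by (simp add: rep_eq_def conj_values_def)
  then have "(\<omega>, conj_values u \<tau>') \<in> difference q"
    by (rule differenceI[OF distribution_conj[OF f]])
  then show "\<exists>\<omega>'. rep_eq \<omega>' (conj_values u \<tau>') \<and> (\<omega>, \<omega>') \<in> difference q"
    by (auto simp: rep_eq_def)
qed

definition combine :: "complex \<Rightarrow> complex \<Rightarrow> ('g rep \<Rightarrow> complex mat) \<Rightarrow> ('g rep \<Rightarrow> complex mat) \<Rightarrow> 'g rep \<Rightarrow> complex mat" where
  "combine a b \<tau> \<eta> \<xi> = a \<cdot>\<^sub>m \<tau> \<xi> + b \<cdot>\<^sub>m \<eta> \<xi>"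

lemma transfers_combine: "transfers (combine a b) (difference q) (difference q)"
  unfolding transfers_def
proof (intro allI impI)
  fix \<tau> \<tau>' \<eta> \<eta>' \<omega>
  assume 1: "(\<tau>, \<tau>') \<in> difference q" and 2: "(\<eta>, \<eta>') \<in> difference q" and \<omega>: "rep_eq \<omega> (combine a b \<tau> \<eta>)"
  obtain f where f: "distribution f"
    "\<forall>\<xi>\<in>irreps. \<tau> \<xi> = fourier f \<xi> \<and> \<tau>' \<xi> = fourier (times_dist q f) \<xi>"
    by (rule differenceE[OF 1])
  obtain g where g: "distribution g"
    "\<forall>\<xi>\<in>irreps. \<eta> \<xi> = fourier g \<xi> \<and> \<eta>' \<xi> = fourier (times_dist q g) \<xi>"
    by (rule differenceE[OF 2])
  let ?h = "\<lambda>h. a * f h + b * g h"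
  have lin: "fourier (\<lambda>h. a * S h + b * T h) \<xi> = a \<cdot>\<^sub>m fourier S \<xi> + b \<cdot>\<^sub>m fourier T \<xi>" for S T \<xi>
    by (intro eq_matI) (simp_all add: fourier_def)
  have t: "times_dist q ?h = (\<lambda>h. a * times_dist q f h + b * times_dist q g h)"
    by (simp add: times_dist_def)
  have "\<omega> \<xi> = fourier ?h \<xi> \<and> combine a b \<tau>' \<eta>' \<xi> = fourier (times_dist q ?h) \<xi>" if "\<xi> \<in> irreps" for \<xi>
    using \<omega> bspec[OF f(2) that] bspec[OF g(2) that] that unfolding t lin by (simp add: rep_eq_def combine_def)
  then have "(\<omega>, combine a b \<tau>' \<eta>') \<in> difference q"
    by (rule differenceI[OF distribution_combination[OF f(1) g(1)]])
  then show "\<exists>\<omega>'. rep_eq \<omega>' (combine a b \<tau>' \<eta>') \<and> (\<omega>, \<omega>') \<in> difference q"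
    by (auto simp: rep_eq_def)
qed

section \<open>Symbol estimates\<close>

lemma dual_irreps: "\<Xi> \<in> dual \<Longrightarrow> \<xi> \<in> \<Xi> \<Longrightarrow> \<xi> \<in> irreps"
  unfolding dual_def quotient_def rep_equiv_def by auto

definition smooth_symbol :: "('g \<Rightarrow> 'g rep \<Rightarrow> complex mat) \<Rightarrow> bool" where
  "smooth_symbol \<sigma> \<longleftrightarrow> (\<forall>\<xi>\<in>irreps. (\<forall>x. \<sigma> x \<xi> \<in> carrier_mat (rep_dim \<xi>) (rep_dim \<xi>)) \<and>
     (\<forall>i<rep_dim \<xi>. \<forall>j<rep_dim \<xi>. (\<lambda>x. \<sigma> x \<xi> $$ (i, j)) \<in> Cinf))"

lemma is_symbol_smooth: "is_symbol \<mu> A \<sigma> \<Longrightarrow> smooth_symbol \<sigma>"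
  unfolding is_symbol_def smooth_symbol_def by blast

lemma symbol_estimateE:
  assumes "symbol_estimate ip \<sigma> D P r"
  obtains C \<tau> where "\<And>x. (apply_x P \<sigma> x, \<tau> x) \<in> D"
    "\<And>x \<Xi> \<xi>. \<Xi> \<in> dual \<Longrightarrow> \<xi> \<in> \<Xi> \<Longrightarrow> op_norm (\<tau> x \<xi>) \<le> C * bracket ip \<xi> powr r"
proof -
  obtain C where "\<forall>x. \<exists>\<tau>. (apply_x P \<sigma> x, \<tau>) \<in> D \<and>
     (\<forall>\<Xi>\<in>dual. \<forall>\<xi>\<in>\<Xi>. op_norm (\<tau> \<xi>) \<le> C * bracket ip \<xi> powr r)"
    using assms unfolding symbol_estimate_def by (elim exE)
  from choice[OF this] obtain \<tau> where \<tau>: "\<forall>x. (apply_x P \<sigma> x, \<tau> x) \<in> D \<and>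
     (\<forall>\<Xi>\<in>dual. \<forall>\<xi>\<in>\<Xi>. op_norm (\<tau> x \<xi>) \<le> C * bracket ip \<xi> powr r)"
    by (elim exE)
  show thesis by (rule that[of \<tau> C]) (simp_all add: \<tau>)
qed

lemma symbol_estimateI:
  assumes "\<And>x. \<exists>\<tau>. (apply_x P \<sigma> x, \<tau>) \<in> D \<and>
     (\<forall>\<xi>\<in>irreps. \<forall>\<Xi>\<in>dual. \<xi> \<in> \<Xi> \<longrightarrow> op_norm (\<tau> \<xi>) \<le> C * bracket ip \<xi> powr r)"
  shows "symbol_estimate ip \<sigma> D P r"
proof -
  have "\<exists>\<tau>. (apply_x P \<sigma> x, \<tau>) \<in> D \<and> (\<forall>\<Xi>\<in>dual. \<forall>\<xi>\<in>\<Xi>. op_norm (\<tau> \<xi>) \<le> C * bracket ip \<xi> powr r)" for x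
    using assms[of x] dual_irreps by (elim exE) (rule exI, fast)
  then show ?thesis unfolding symbol_estimate_def by (intro exI[of _ C] allI)
qed

lemma preserves_carrierD: "preserves_carrier D \<Longrightarrow> (\<tau>, \<tau>') \<in> D \<Longrightarrow> rep_carrier \<tau> \<Longrightarrow> rep_carrier \<tau>'"
  unfolding preserves_carrier_def by fast

text \<open>Values of the relation at the two given arguments are combined; the transfer property
  yields a value at the argument built from \<open>R\<close> that agrees with the combination on
  irreducible representations, where the norms are measured.\<close>

lemma symbol_estimate_combination:
  assumes \<sigma>: "smooth_symbol \<sigma>" and D: "transfers (combine a b) D D" "preserves_carrier D"
    and P: "symbol_estimate ip \<sigma> D P r" and Q: "symbol_estimate ip \<sigma> D Q r"
    and R: "\<And>f. f \<in> Cinf \<Longrightarrow> R f = (\<lambda>x. a * P f x + b * Q f x)"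
  shows "symbol_estimate ip \<sigma> D R r"
proof -
  obtain C \<tau> where \<tau>: "\<And>x. (apply_x P \<sigma> x, \<tau> x) \<in> D"
    "\<And>x \<Xi> \<xi>. \<Xi> \<in> dual \<Longrightarrow> \<xi> \<in> \<Xi> \<Longrightarrow> op_norm (\<tau> x \<xi>) \<le> C * bracket ip \<xi> powr r"
    using symbol_estimateE[OF P] by metis
  obtain C' \<eta> where \<eta>: "\<And>x. (apply_x Q \<sigma> x, \<eta> x) \<in> D"
    "\<And>x \<Xi> \<xi>. \<Xi> \<in> dual \<Longrightarrow> \<xi> \<in> \<Xi> \<Longrightarrow> op_norm (\<eta> x \<xi>) \<le> C' * bracket ip \<xi> powr r"
    using symbol_estimateE[OF Q] by metis
  show ?thesis
  proof (rule symbol_estimateI)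
    fix x
    have "rep_eq (apply_x R \<sigma> x) (combine a b (apply_x P \<sigma> x) (apply_x Q \<sigma> x))"
      unfolding rep_eq_def combine_def apply_x_def using \<sigma> R
      by (intro ballI eq_matI) (auto simp: smooth_symbol_def)
    then obtain \<omega> where \<omega>: "rep_eq \<omega> (combine a b (\<tau> x) (\<eta> x))" "(apply_x R \<sigma> x, \<omega>) \<in> D"
      by (rule transfersD[OF D(1), OF \<tau>(1) \<eta>(1)])
    have car: "rep_carrier (\<tau> x)" "rep_carrier (\<eta> x)"
      using preserves_carrierD[OF D(2) \<tau>(1) apply_x_carrier] preserves_carrierD[OF D(2) \<eta>(1) apply_x_carrier] .
    have "op_norm (\<omega> \<xi>) \<le> (cmod a * C + cmod b * C') * bracket ip \<xi> powr r"
      if irr: "\<xi> \<in> irreps" and \<xi>: "\<Xi> \<in> dual" "\<xi> \<in> \<Xi>" for \<Xi> \<xi>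
    proof -
      have "op_norm (\<omega> \<xi>) = op_norm (a \<cdot>\<^sub>m \<tau> x \<xi> + b \<cdot>\<^sub>m \<eta> x \<xi>)"
        using \<omega>(1) irr by (simp add: rep_eq_def combine_def)
      also have "\<dots> \<le> cmod a * op_norm (\<tau> x \<xi>) + cmod b * op_norm (\<eta> x \<xi>)"
        using car irr by (intro op_norm_combination[where d = "rep_dim \<xi>"]) (auto simp: rep_carrier_def)
      also have "\<dots> \<le> cmod a * (C * bracket ip \<xi> powr r) + cmod b * (C' * bracket ip \<xi> powr r)"
        using \<tau>(2)[OF \<xi>] \<eta>(2)[OF \<xi>] by (intro add_mono mult_left_mono) auto
      finally show ?thesis by (simp add: algebra_simps)
    qed
    then show "\<exists>\<tau>. (apply_x R \<sigma> x, \<tau>) \<in> D \<and> (\<forall>\<xi>\<in>irreps. \<forall>\<Xi>\<in>dual. \<xi> \<in> \<Xi> \<longrightarrow>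
        op_norm (\<tau> \<xi>) \<le> (cmod a * C + cmod b * C') * bracket ip \<xi> powr r)"
      using \<omega>(2) by (intro exI[of _ \<omega>]) simp
  qed
qed

text \<open>Sums, multiples and replacement by an operator equal on \<open>Cinf\<close> are the
  coefficient pairs (1, 1), (c, 0) and (1, 0) of one combination.\<close>

lemma symbol_estimate_op_space:
  assumes \<sigma>: "smooth_symbol \<sigma>"
  shows "op_space {P. symbol_estimate ip \<sigma> (difference_power q \<alpha>) P r}"
proof -
  have t: "transfers (combine a b) (difference_power q \<alpha>) (difference_power q \<alpha>)" for a b
    by (rule transfers_difference_power) (rule transfers_combine)
  let ?E = "\<lambda>P. symbol_estimate ip \<sigma> (difference_power q \<alpha>) P r"
  have add: "?E (\<lambda>f x. P f x + Q f x)" if "?E P" "?E Q" for P Q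
    by (rule symbol_estimate_combination[OF \<sigma> t[of 1 1] preserves_carrier_difference_power that]) simp
  have cmult: "?E (\<lambda>f x. c * P f x)" if "?E P" for P c
    by (rule symbol_estimate_combination[OF \<sigma> t[of c 0] preserves_carrier_difference_power that that]) simp
  have cong: "?E Q" if "?E P" "\<forall>f\<in>Cinf. Q f = P f" for P Q
    by (rule symbol_estimate_combination[OF \<sigma> t[of 1 0] preserves_carrier_difference_power that(1) that(1)])
       (use that(2) in simp)
  show ?thesis
    unfolding op_space_def using add cmult cong by simp
qed

section \<open>The symbol and the kernel of the translated operator\<close>

definition translated_symbol :: "'g \<Rightarrow> ('g \<Rightarrow> 'g rep \<Rightarrow> complex mat) \<Rightarrow> 'g \<Rightarrow> 'g rep \<Rightarrow> complex mat" where
  "translated_symbol u \<sigma> x \<xi> = mat_adjoint (\<xi> u) * \<sigma> (x \<otimes> inv u) \<xi> * \<xi> u"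

lemma translated_symbol_index:
  assumes "smooth_symbol \<sigma>" "\<xi> \<in> irreps" "i < rep_dim \<xi>" "j < rep_dim \<xi>"
  shows "translated_symbol u \<sigma> x \<xi> $$ (i, j) = (\<Sum>z\<in>{..<rep_dim \<xi>} \<times> {..<rep_dim \<xi>}.
      (mat_adjoint (\<xi> u) $$ (i, snd z) * \<xi> u $$ (fst z, j)) * \<sigma> (x \<otimes> inv u) \<xi> $$ (snd z, fst z))"
proof -
  let ?d = "rep_dim \<xi>"
  have c: "\<xi> u \<in> carrier_mat ?d ?d" "\<sigma> (x \<otimes> inv u) \<xi> \<in> carrier_mat ?d ?d"
    using irrep_carrier[OF assms(2)] assms(1,2) by (auto simp: smooth_symbol_def)
  show ?thesis
    unfolding translated_symbol_def mat_mult3_index[OF mat_adjoint_carrier[OF c(1)] c(2,1) assms(3,4)]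
      sum.cartesian_product
    by (intro sum.cong refl) (auto simp: mult_ac)
qed

text \<open>Applying \<open>P\<close> at x to the map y to \<sigma>(y u^{-1}) is applying
  \<open>right_push (inv u) P\<close> to \<sigma> at x u^{-1}. The estimate is uniform in the point
  and unitary conjugation preserves the norm, so the constant stays the same.\<close>

lemma symbol_estimate_translated:
  assumes \<sigma>: "smooth_symbol \<sigma>" and P: "linear_op P"
    and D: "transfers (\<lambda>\<tau> \<eta>. conj_values u \<tau>) D D'" "preserves_carrier D"
    and est: "symbol_estimate ip \<sigma> D (right_push (inv u) P) r"
  shows "symbol_estimate ip (translated_symbol u \<sigma>) D' P r"
proof -
  obtain C \<tau> where \<tau>: "\<And>x. (apply_x (right_push (inv u) P) \<sigma> x, \<tau> x) \<in> D"
    "\<And>x \<Xi> \<xi>. \<Xi> \<in> dual \<Longrightarrow> \<xi> \<in> \<Xi> \<Longrightarrow> op_norm (\<tau> x \<xi>) \<le> C * bracket ip \<xi> powr r"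
    using symbol_estimateE[OF est] by metis
  show ?thesis
  proof (rule symbol_estimateI)
    fix x
    let ?y = "x \<otimes> inv u"
    let ?a = "apply_x (right_push (inv u) P) \<sigma> ?y"
    have "rep_eq (apply_x P (translated_symbol u \<sigma>) x) (conj_values u ?a)"
      unfolding rep_eq_def
    proof
      fix \<xi> assume \<xi>: "\<xi> \<in> irreps"
      let ?d = "rep_dim \<xi>"
      have car: "\<xi> u \<in> carrier_mat ?d ?d" "mat_adjoint (\<xi> u) \<in> carrier_mat ?d ?d" "?a \<xi> \<in> carrier_mat ?d ?d"
        using irrep_carrier[OF \<xi>] mat_adjoint_carrier apply_x_carrier \<xi> by (auto simp: rep_carrier_def)
      show "apply_x P (translated_symbol u \<sigma>) x \<xi> = conj_values u ?a \<xi>"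
      proof (rule eq_matI)
        fix i j assume "i < dim_row (conj_values u ?a \<xi>)" "j < dim_col (conj_values u ?a \<xi>)"
        then have ij: "i < ?d" "j < ?d" using car by (auto simp: conj_values_def)
        define c where "c z = mat_adjoint (\<xi> u) $$ (i, snd z) * \<xi> u $$ (fst z, j)" for z :: "nat \<times> nat"
        have S: "(\<lambda>y. \<sigma> (y \<otimes> inv u) \<xi> $$ (k, l)) \<in> Cinf" if "k < ?d" "l < ?d" for k l
          using \<sigma> \<xi> that Cinf_right[of "\<lambda>y. \<sigma> y \<xi> $$ (k, l)" "inv u"] by (simp add: smooth_symbol_def)
        have "apply_x P (translated_symbol u \<sigma>) x \<xi> $$ (i, j) = P (\<lambda>y. translated_symbol u \<sigma> y \<xi> $$ (i, j)) x"
          using ij by (simp add: apply_x_def)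
        also have "\<dots> = P (\<lambda>y. \<Sum>z\<in>{..<?d} \<times> {..<?d}. c z * \<sigma> (y \<otimes> inv u) \<xi> $$ (snd z, fst z)) x"
          using translated_symbol_index[OF \<sigma> \<xi> ij] by (simp add: c_def)
        also have "\<dots> = (\<Sum>z\<in>{..<?d} \<times> {..<?d}. P (\<lambda>y. c z * \<sigma> (y \<otimes> inv u) \<xi> $$ (snd z, fst z)) x)"
          by (subst linear_op_sum[OF P]) (auto intro!: Cinf_cmult S)
        also have "\<dots> = (\<Sum>z\<in>{..<?d} \<times> {..<?d}. c z * P (\<lambda>y. \<sigma> (y \<otimes> inv u) \<xi> $$ (snd z, fst z)) x)"
          by (intro sum.cong refl, subst linear_op_cmult[OF P]) (auto intro!: S)
        also have "\<dots> = (\<Sum>z\<in>{..<?d} \<times> {..<?d}. c z * ?a \<xi> $$ (snd z, fst z))"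
          by (intro sum.cong refl) (auto simp: apply_x_def right_push_def)
        also have "\<dots> = (\<Sum>l<?d. \<Sum>k<?d. mat_adjoint (\<xi> u) $$ (i, k) * ?a \<xi> $$ (k, l) * \<xi> u $$ (l, j))"
          unfolding sum.cartesian_product by (intro sum.cong refl) (auto simp: c_def mult_ac)
        also have "\<dots> = conj_values u ?a \<xi> $$ (i, j)"
          unfolding conj_values_def by (rule mat_mult3_index[OF car(2,3,1) ij, symmetric])
        finally show "apply_x P (translated_symbol u \<sigma>) x \<xi> $$ (i, j) = conj_values u ?a \<xi> $$ (i, j)" .
      qed (use car in \<open>auto simp: conj_values_def apply_x_def\<close>)
    qed
    then obtain \<omega> where \<omega>: "rep_eq \<omega> (conj_values u (\<tau> ?y))" "(apply_x P (translated_symbol u \<sigma>) x, \<omega>) \<in> D'"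
      by (rule transfersD[OF D(1), OF \<tau>(1) \<tau>(1)])
    have car: "rep_carrier (\<tau> ?y)" by (rule preserves_carrierD[OF D(2) \<tau>(1) apply_x_carrier])
    have "op_norm (\<omega> \<xi>) \<le> C * bracket ip \<xi> powr r"
      if irr: "\<xi> \<in> irreps" and \<xi>: "\<Xi> \<in> dual" "\<xi> \<in> \<Xi>" for \<Xi> \<xi>
    proof -
      have "op_norm (mat_adjoint (\<xi> u) * \<tau> ?y \<xi> * \<xi> u) = op_norm (\<tau> ?y \<xi>)"
        by (rule op_norm_unitary_conj[where d = "rep_dim \<xi>"])
           (use car irr in \<open>auto simp: rep_carrier_def irreps_def\<close>)
      then show ?thesis using \<omega>(1) irr \<tau>(2)[OF \<xi>] by (simp add: rep_eq_def conj_values_def)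
    qed
    then show "\<exists>\<tau>. (apply_x P (translated_symbol u \<sigma>) x, \<tau>) \<in> D' \<and>
        (\<forall>\<xi>\<in>irreps. \<forall>\<Xi>\<in>dual. \<xi> \<in> \<Xi> \<longrightarrow> op_norm (\<tau> \<xi>) \<le> C * bracket ip \<xi> powr r)"
      using \<omega>(2) by (intro exI[of _ \<omega>]) simp
  qed
qed

text \<open>For functions the formula follows from (A_u \<xi>)(x) = (A \<xi>)(x u^{-1}) \<xi>(u) and
  \<xi>(x)^* = \<xi>(u)^* \<xi>(x u^{-1})^*. As \<open>A\<close> has values in distributions, it is
  verified after pairing with h, pulling out finite combinations of smooth matrix entries.\<close>

lemma is_symbol_translated:
  assumes \<mu>: "haar_measure \<mu>" and A: "continuous_operator A" and sym: "is_symbol \<mu> A \<sigma>"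
  shows "is_symbol \<mu> (translated_operator u A) (translated_symbol u \<sigma>)"
  unfolding is_symbol_def
proof (intro ballI conjI allI impI)
  note \<sigma> = is_symbol_smooth[OF sym]
  fix \<xi> assume \<xi>: "\<xi> \<in> irreps"
  let ?d = "rep_dim \<xi>"
  let ?I = "{..<?d} \<times> {..<?d}"
  have car: "\<xi> x \<in> carrier_mat ?d ?d" for x by (rule irrep_carrier[OF \<xi>])
  show "translated_symbol u \<sigma> x \<xi> \<in> carrier_mat ?d ?d" for x
    using \<sigma> \<xi> car[of u] mat_adjoint_carrier[OF car[of u]]
    by (auto simp: translated_symbol_def smooth_symbol_def intro!: mult_carrier_mat)
  fix i j assume ij: "i < ?d" "j < ?d"
  define c where "c z = mat_adjoint (\<xi> u) $$ (i, snd z) * \<xi> u $$ (fst z, j)" for z :: "nat \<times> nat"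
  have S: "(\<lambda>y. \<sigma> y \<xi> $$ (k, l)) \<in> Cinf" if "k < ?d" "l < ?d" for k l
    using \<sigma> \<xi> that by (simp add: smooth_symbol_def)
  have idx: "translated_symbol u \<sigma> x \<xi> $$ (i, j) = (\<Sum>z\<in>?I. c z * \<sigma> (x \<otimes> inv u) \<xi> $$ (snd z, fst z))" for x
    using translated_symbol_index[OF \<sigma> \<xi> ij] by (simp add: c_def)
  show "(\<lambda>x. translated_symbol u \<sigma> x \<xi> $$ (i, j)) \<in> Cinf"
    unfolding idx by (intro Cinf_sum Cinf_cmult Cinf_right[where f = "\<lambda>y. \<sigma> y \<xi> $$ (snd _, fst _)"] S) auto
  fix h assume h: "h \<in> Cinf"
  let ?h = "\<lambda>x. h (x \<otimes> u)"
  have hC: "?h \<in> Cinf" by (rule Cinf_right[OF h])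
  define e where "e k l = (\<lambda>x. \<xi> x $$ (k, l))" for k l
  define e' where "e' k l = (\<lambda>x. mat_adjoint (\<xi> x) $$ (k, l))" for k l
  have eC: "e k l \<in> Cinf" if "k < ?d" "l < ?d" for k l
    unfolding e_def by (rule irrep_smooth[OF \<mu> \<xi> that])
  have e'C: "e' k l \<in> Cinf" if "k < ?d" "l < ?d" for k l
    unfolding e'_def by (rule irrep_entry_Cinf[OF \<mu> \<xi> that])
  have Alin: "lin_dist (A f)" if "f \<in> Cinf" for f
    using A that distribution_lin unfolding continuous_operator_def by blast
  have Alin': "lin_dist (\<lambda>f. A f H)" if "H \<in> Cinf" for H
    using A that distribution_lin unfolding continuous_operator_def by blast
  \<comment> \<open>Invariance under right translation removes the shift from \<sigma> and puts it
    on h.\<close>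
  have "(\<integral>x. translated_symbol u \<sigma> x \<xi> $$ (i, j) * h x \<partial>\<mu>)
      = (\<integral>x. translated_symbol u \<sigma> (x \<otimes> u) \<xi> $$ (i, j) * h (x \<otimes> u) \<partial>\<mu>)"
    by (rule haar_right[OF \<mu>, of "\<lambda>x. translated_symbol u \<sigma> x \<xi> $$ (i, j) * h x" u, symmetric])
  also have "\<dots> = (\<integral>x. (\<Sum>z\<in>?I. c z * (\<sigma> x \<xi> $$ (snd z, fst z) * ?h x)) \<partial>\<mu>)"
    unfolding idx by (simp add: sum_distrib_right mult.assoc)
  also have "\<dots> = (\<Sum>z\<in>?I. c z * (\<integral>x. \<sigma> x \<xi> $$ (snd z, fst z) * ?h x \<partial>\<mu>))"
  proof -
    have "integrable \<mu> (\<lambda>x. \<sigma> x \<xi> $$ (snd z, fst z) * ?h x)" if "z \<in> ?I" for z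
      using that by (intro haar_integrable[OF \<mu>] Cinf_continuous Cinf_mult S hC) auto
    then show ?thesis by (subst Bochner_Integration.integral_sum) auto
  qed
  also have "\<dots> = (\<Sum>z\<in>?I. c z * (\<Sum>k<?d. A (e k (fst z)) (\<lambda>x. e' (snd z) k x * ?h x)))"
  proof (intro sum.cong refl)
    fix z assume z: "z \<in> ?I"
    have "(\<integral>x. \<sigma> x \<xi> $$ (snd z, fst z) * ?h x \<partial>\<mu>) =
           (\<Sum>k<?d. times_dist (\<lambda>x. mat_adjoint (\<xi> x) $$ (snd z, k)) (A (\<lambda>x. \<xi> x $$ (k, fst z))) ?h)"
      using sym \<xi> hC z unfolding is_symbol_def by auto
    then show "c z * (\<integral>x. \<sigma> x \<xi> $$ (snd z, fst z) * ?h x \<partial>\<mu>) =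
        c z * (\<Sum>k<?d. A (e k (fst z)) (\<lambda>x. e' (snd z) k x * ?h x))"
      by (simp add: times_dist_def e_def e'_def)
  qed
  also have "\<dots> = (\<Sum>k<?d. \<Sum>z\<in>?I. c z * A (e k (fst z)) (\<lambda>x. e' (snd z) k x * ?h x))"
    unfolding sum_distrib_left by (rule sum.swap)
  also have "\<dots> = (\<Sum>k<?d. times_dist (\<lambda>x. mat_adjoint (\<xi> x) $$ (i, k)) (translated_operator u A (\<lambda>x. \<xi> x $$ (k, j))) h)"
  proof (rule sum.cong[OF refl])
    fix k assume "k \<in> {..<?d}"
    then have k: "k < ?d" by simp
    \<comment> \<open>The test function that reaches \<open>A\<close> once the translations are
      unfolded. It splits over the entries of \<xi>(u)^*, while the argument of \<open>A\<close>
      splits over those of \<xi>(u).\<close>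
    define H where "H = (\<lambda>x. mat_adjoint (\<xi> (x \<otimes> u)) $$ (i, k) * h (x \<otimes> u))"
    have Heq: "H = (\<lambda>x. \<Sum>p<?d. mat_adjoint (\<xi> u) $$ (i, p) * (e' p k x * ?h x))"
    proof
      fix x
      have "mat_adjoint (\<xi> (x \<otimes> u)) = mat_adjoint (\<xi> u) * mat_adjoint (\<xi> x)"
        by (simp add: irrep_inv[OF \<xi>, symmetric] irrep_mult[OF \<xi>, symmetric] inv_mult_group)
      then have "mat_adjoint (\<xi> (x \<otimes> u)) $$ (i, k) = (\<Sum>p<?d. mat_adjoint (\<xi> u) $$ (i, p) * mat_adjoint (\<xi> x) $$ (p, k))"
        using mat_mult_index[OF mat_adjoint_carrier[OF car] mat_adjoint_carrier[OF car] ij(1) k] by simp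
      then show "H x = (\<Sum>p<?d. mat_adjoint (\<xi> u) $$ (i, p) * (e' p k x * ?h x))"
        by (simp add: H_def e'_def sum_distrib_right mult.assoc)
    qed
    have HC: "H \<in> Cinf" unfolding Heq using k by (intro Cinf_sum Cinf_cmult Cinf_mult e'C hC) auto
    have "times_dist (\<lambda>x. mat_adjoint (\<xi> x) $$ (i, k)) (translated_operator u A (\<lambda>x. \<xi> x $$ (k, j))) h
        = A (\<lambda>x. \<xi> (x \<otimes> u) $$ (k, j)) H"
      by (simp add: times_dist_def translated_operator_def dist_comp_inv_def o_def H_def)
    also have "(\<lambda>x. \<xi> (x \<otimes> u) $$ (k, j)) = (\<lambda>x. \<Sum>l<?d. \<xi> u $$ (l, j) * e k l x)"
      using irrep_mult_index[OF \<xi> k ij(2)] by (simp add: e_def mult.commute)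
    also have "A (\<lambda>x. \<Sum>l<?d. \<xi> u $$ (l, j) * e k l x) H = (\<Sum>l<?d. \<xi> u $$ (l, j) * A (e k l) H)"
      by (rule lin_dist_sum[OF Alin'[OF HC]]) (use k eC in auto)
    also have "\<dots> = (\<Sum>l<?d. \<xi> u $$ (l, j) * (\<Sum>p<?d. mat_adjoint (\<xi> u) $$ (i, p) * A (e k l) (\<lambda>x. e' p k x * ?h x)))"
    proof (rule sum.cong[OF refl])
      fix l assume "l \<in> {..<?d}"
      then have "A (e k l) H = (\<Sum>p<?d. mat_adjoint (\<xi> u) $$ (i, p) * A (e k l) (\<lambda>x. e' p k x * ?h x))"
        unfolding Heq using k by (intro lin_dist_sum Alin eC Cinf_mult e'C hC) auto
      then show "\<xi> u $$ (l, j) * A (e k l) H = \<xi> u $$ (l, j) * (\<Sum>p<?d. mat_adjoint (\<xi> u) $$ (i, p) * A (e k l) (\<lambda>x. e' p k x * ?h x))"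
        by simp
    qed
    also have "\<dots> = (\<Sum>z\<in>?I. c z * A (e k (fst z)) (\<lambda>x. e' (snd z) k x * ?h x))"
      unfolding sum_distrib_left sum.cartesian_product
      by (intro sum.cong refl) (auto simp: c_def mult_ac)
    finally show "(\<Sum>z\<in>?I. c z * A (e k (fst z)) (\<lambda>x. e' (snd z) k x * ?h x)) =
        times_dist (\<lambda>x. mat_adjoint (\<xi> x) $$ (i, k)) (translated_operator u A (\<lambda>x. \<xi> x $$ (k, j))) h"
      by simp
  qed
  finally show "(\<integral>x. translated_symbol u \<sigma> x \<xi> $$ (i, j) * h x \<partial>\<mu>) =
     (\<Sum>k<?d. times_dist (\<lambda>x. mat_adjoint (\<xi> x) $$ (i, k)) (translated_operator u A (\<lambda>x. \<xi> x $$ (k, j))) h)" .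
qed

lemma continuous_conj: "continuous_on UNIV (conjugation a)"
proof -
  have "continuous_on UNIV ((\<lambda>x. x \<otimes> a) \<circ> (\<lambda>x. inv a \<otimes> x))"
    by (rule continuous_on_compose[OF continuous_left]) (rule continuous_on_subset[OF continuous_right], simp)
  moreover have "(\<lambda>x. x \<otimes> a) \<circ> (\<lambda>x. inv a \<otimes> x) = conjugation a" by (auto simp: conjugation_def)
  ultimately show ?thesis by simp
qed

lemma haar_conj:
  fixes f :: "'g \<Rightarrow> complex"
  assumes "haar_measure \<mu>"
  shows "(\<integral>x. f (conjugation a x) \<partial>\<mu>) = (\<integral>x. f x \<partial>\<mu>)"
  unfolding conjugation_def
  using haar_left[OF assms, of "\<lambda>x. f (x \<otimes> a)" "inv a"] haar_right[OF assms, of f a] by simp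

text \<open>Conjugation is a homeomorphism that fixes the unit and preserves smooth functions and
  Haar measure, so a smooth density of \<open>T\<close> near the conjugated point yields one near
  x.\<close>

lemma sing_supp_conj:
  assumes \<mu>: "haar_measure \<mu>" and T: "sing_supp \<mu> T \<subseteq> {\<one>}"
  shows "sing_supp \<mu> (\<lambda>h. T (\<lambda>x. h (conjugation u x))) \<subseteq> {\<one>}"
proof
  fix x assume x: "x \<in> sing_supp \<mu> (\<lambda>h. T (\<lambda>x. h (conjugation u x)))"
  show "x \<in> {\<one>}"
  proof (rule ccontr)
    assume "x \<notin> {\<one>}"
    then have "conjugation (inv u) x \<notin> sing_supp \<mu> T" using T by (metis conj_one_iff singletonD singletonI subsetD)
    then obtain W f where W: "open W" "conjugation (inv u) x \<in> W" and f: "smooth_fun_on W f"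
      "\<And>h. h \<in> Cinf \<Longrightarrow> closure {x. h x \<noteq> 0} \<subseteq> W \<Longrightarrow> T h = (\<integral>x. f x * h x \<partial>\<mu>)"
      unfolding sing_supp_def by blast
    let ?W = "{z. conjugation (inv u) z \<in> W}"
    let ?f = "\<lambda>z. f (conjugation (inv u) z)"
    have oW: "open ?W"
      using open_vimage[OF W(1) continuous_conj, of "inv u"] by (simp add: vimage_def)
    have sm: "smooth_fun_on ?W ?f"
      using smooth_fun_on_left[OF open_right[OF W(1)] smooth_fun_on_right[OF W(1) f(1), of "inv u"], of "inv (inv u)"]
      by (simp add: conjugation_def)
    have eq: "T (\<lambda>x. h (conjugation u x)) = (\<integral>x. ?f x * h x \<partial>\<mu>)" if h: "h \<in> Cinf" "closure {x. h x \<noteq> 0} \<subseteq> ?W" for h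
    proof -
      have "closed (conjugation u -` closure {x. h x \<noteq> 0})"
        by (rule closed_vimage[OF closed_closure continuous_conj])
      then have "closure {x. h (conjugation u x) \<noteq> 0} \<subseteq> conjugation u -` closure {x. h x \<noteq> 0}"
        by (intro closure_minimal) (auto intro: closure_subset[THEN subsetD])
      also have "\<dots> \<subseteq> W" using h(2) by fastforce
      finally have "T (\<lambda>x. h (conjugation u x)) = (\<integral>x. f x * h (conjugation u x) \<partial>\<mu>)"
        by (rule f(2)[OF Cinf_conj[OF h(1)]])
      also have "\<dots> = (\<integral>x. ?f x * h x \<partial>\<mu>)"
        using haar_conj[OF \<mu>, of "\<lambda>x. ?f x * h x" u] by simp
      finally show ?thesis .
    qed
    have "x \<in> ?W" using W(2) by simp
    moreover have "open ?W \<and> (\<exists>f. smooth_fun_on ?W f \<and>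
        (\<forall>h\<in>Cinf. closure {x. h x \<noteq> 0} \<subseteq> ?W \<longrightarrow> T (\<lambda>x. h (conjugation u x)) = (\<integral>x. f x * h x \<partial>\<mu>)))"
      using oW sm eq by blast
    ultimately show False using x unfolding sing_supp_def by blast
  qed
qed

text \<open>The kernel is R(x u^{-1}, u z u^{-1}), written as a functional of h. It is correct
  because x (u^{-1} z u)^{-1} = (x u^{-1}) z^{-1} u.\<close>

lemma right_kernel_translated:
  assumes \<mu>: "haar_measure \<mu>" and R: "right_kernel \<mu> A R"
  shows "right_kernel \<mu> (translated_operator u A) (\<lambda>x h. R (x \<otimes> inv u) (\<lambda>z. h (conjugation u z)))"
  unfolding right_kernel_def
proof (intro conjI allI ballI)
  show "distribution (\<lambda>h. R (x \<otimes> inv u) (\<lambda>z. h (conjugation u z)))" for x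
    using R distribution_conj unfolding right_kernel_def by blast
  fix f assume f: "f \<in> Cinf"
  let ?f = "\<lambda>x. f (x \<otimes> u)"
  let ?F = "\<lambda>x. R x (\<lambda>z. ?f (x \<otimes> inv z))"
  have "?F \<in> Cinf \<and> (\<forall>h\<in>Cinf. A ?f h = (\<integral>x. ?F x * h x \<partial>\<mu>))"
    by (rule bspec[OF conjunct2[OF R[unfolded right_kernel_def]] Cinf_right[OF f]])
  then have F: "?F \<in> Cinf" "\<And>h. h \<in> Cinf \<Longrightarrow> A ?f h = (\<integral>x. ?F x * h x \<partial>\<mu>)"
    by auto
  have eq: "R (x \<otimes> inv u) (\<lambda>z. f (x \<otimes> inv (conjugation u z))) = ?F (x \<otimes> inv u)" for x
    by (simp add: conjugation_def inv_mult_group m_assoc)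
  show "(\<lambda>x. R (x \<otimes> inv u) (\<lambda>z. f (x \<otimes> inv (conjugation u z)))) \<in> Cinf"
    unfolding eq by (rule Cinf_right[OF F(1)])
  fix h assume h: "h \<in> Cinf"
  have "translated_operator u A f h = A ?f (\<lambda>x. h (x \<otimes> u))"
    by (simp add: translated_operator_def dist_comp_inv_def o_def)
  also have "\<dots> = (\<integral>x. ?F x * h (x \<otimes> u) \<partial>\<mu>)" by (rule F(2)[OF Cinf_right[OF h]])
  also have "\<dots> = (\<integral>x. ?F (x \<otimes> inv u) * h x \<partial>\<mu>)"
    using haar_right[OF \<mu>, of "\<lambda>x. ?F (x \<otimes> inv u) * h x" u] by simp
  finally show "translated_operator u A f h = (\<integral>x. R (x \<otimes> inv u) (\<lambda>z. f (x \<otimes> inv (conjugation u z))) * h x \<partial>\<mu>)"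
    unfolding eq .
qed

section \<open>Invariance of the conditions\<close>

text \<open>The estimate is assumed for all \<beta> at once, with \<alpha> and r fixed, because
  expressing the pushed frame by \<open>X\<close> produces monomials with other
  multi-indices.\<close>

lemma symbol_estimate_partial_translated:
  assumes \<mu>: "haar_measure \<mu>" and X: "left_invariant_frame X" and \<sigma>: "smooth_symbol \<sigma>"
    and q: "\<And>i. i < n \<Longrightarrow> q i \<in> Cinf"
    and est: "\<And>\<beta>. symbol_estimate ip \<sigma> (difference_power (\<lambda>i x. q i (conjugation u x)) \<alpha>) (partial X \<beta>) r"
  shows "symbol_estimate ip (translated_symbol u \<sigma>) (difference_power q \<alpha>) (partial X \<beta>) r"
proof (rule symbol_estimate_translated[OF \<sigma>])
  have XL: "X i \<in> lie_algebra" if "i < n" for i using X that by (simp add: left_invariant_frame_def)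
  show "linear_op (partial X \<beta>)"
    by (rule partial_linear) (use XL in \<open>simp add: lie_algebra_def\<close>)
  show "transfers (\<lambda>\<tau> \<eta>. conj_values u \<tau>) (difference_power (\<lambda>i x. q i (conjugation u x)) \<alpha>) (difference_power q \<alpha>)"
    by (rule transfers_difference_power) (rule transfers_conj[OF \<mu> q])
  show "preserves_carrier (difference_power (\<lambda>i x. q i (conjugation u x)) \<alpha>)"
    by (rule preserves_carrier_difference_power)
  let ?S = "{P. symbol_estimate ip \<sigma> (difference_power (\<lambda>i x. q i (conjugation u x)) \<alpha>) P r}"
  have "partial (\<lambda>i. right_push (inv u) (X i)) \<beta> \<in> ?S"
    by (rule partial_in_op_space[OF X symbol_estimate_op_space[OF \<sigma>]])
       (use est lie_algebra_lie_field[OF right_push_lie_algebra[OF XL]] in auto)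
  then show "symbol_estimate ip \<sigma> (difference_power (\<lambda>i x. q i (conjugation u x)) \<alpha>) (right_push (inv u) (partial X \<beta>)) r"
    by (simp add: right_push_partial)
qed

text \<open>Condition (B) ranges over all left-invariant operators and all vanishing functions, so
  the pushed operator and the conjugated function are again among them.\<close>

lemma condition_B_translated:
  assumes \<mu>: "haar_measure \<mu>" and A: "continuous_operator A" and B: "condition_B \<mu> ip m A"
  shows "condition_B \<mu> ip m (translated_operator u A)"
proof -
  obtain \<sigma> where sym: "is_symbol \<mu> A \<sigma>" and
    est: "\<And>k l P q. P \<in> LDiff k \<Longrightarrow> vanishes_of_order l q \<Longrightarrow> symbol_estimate ip \<sigma> (difference q) P (m - real l)"
    using B unfolding condition_B_def by blast
  have "symbol_estimate ip (translated_symbol u \<sigma>) (difference q) P (m - real l)"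
    if P: "P \<in> LDiff k" and q: "vanishes_of_order l q" for k l P q
  proof (rule symbol_estimate_translated[OF is_symbol_smooth[OF sym] LDiff_linear[OF P]])
    show "transfers (\<lambda>\<tau> \<eta>. conj_values u \<tau>) (difference (\<lambda>x. q (conjugation u x))) (difference q)"
      by (rule transfers_conj[OF \<mu>]) (use q in \<open>simp add: vanishes_of_order_def\<close>)
    show "preserves_carrier (difference (\<lambda>x. q (conjugation u x)))" by (rule preserves_carrier_difference)
    show "symbol_estimate ip \<sigma> (difference (\<lambda>x. q (conjugation u x))) (right_push (inv u) P) (m - real l)"
      by (rule est[OF right_push_LDiff[OF P] vanishes_of_order_conj[OF q]])
  qed
  then show ?thesis
    using is_symbol_translated[OF \<mu> A sym] unfolding condition_B_def by blast
qed

text \<open>Condition (C) ranges over all admissible selections; the estimate for the conjugated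
  selection, which is again admissible, gives the one for q.\<close>

lemma condition_C_translated:
  assumes \<mu>: "haar_measure \<mu>" and X: "left_invariant_frame X" and A: "continuous_operator A"
    and C: "condition_C \<mu> ip X m A"
  shows "condition_C \<mu> ip X m (translated_operator u A)"
proof -
  obtain \<sigma> where sym: "is_symbol \<mu> A \<sigma>" and
    est: "\<And>q \<alpha> \<beta>. admissible n q \<Longrightarrow>
      symbol_estimate ip \<sigma> (difference_power q \<alpha>) (partial X \<beta>) (m - real (\<Sum>i<n. \<alpha> i))"
    using C unfolding condition_C_def by blast
  obtain R where R: "right_kernel \<mu> A R" "\<And>x. sing_supp \<mu> (R x) \<subseteq> {\<one>}"
    using C unfolding condition_C_def by blast
  have "symbol_estimate ip (translated_symbol u \<sigma>) (difference_power q \<alpha>) (partial X \<beta>) (m - real (\<Sum>i<n. \<alpha> i))"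
    if "admissible n q" for q \<alpha> \<beta>
    by (rule symbol_estimate_partial_translated[OF \<mu> X is_symbol_smooth[OF sym] _ est[OF admissible_conj[OF that]]])
       (use that in \<open>simp add: admissible_def vanishes_of_order_def\<close>)
  then show ?thesis
    using is_symbol_translated[OF \<mu> A sym] right_kernel_translated[OF \<mu> R(1), of u] sing_supp_conj[OF \<mu> R(2)]
    unfolding condition_C_def by blast
qed

lemma condition_D_translated:
  assumes \<mu>: "haar_measure \<mu>" and X: "left_invariant_frame X" and A: "continuous_operator A"
    and D: "condition_D \<mu> ip X m A"
  shows "condition_D \<mu> ip X m (translated_operator u A)"
proof -
  obtain \<sigma> q where sym: "is_symbol \<mu> A \<sigma>" and q: "strongly_admissible n q" and
    est: "\<And>\<alpha> \<beta>. symbol_estimate ip \<sigma> (difference_power q \<alpha>) (partial X \<beta>) (m - real (\<Sum>i<n. \<alpha> i))"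
    using D unfolding condition_D_def by blast
  \<comment> \<open>The selection is conjugated by the inverse, so that the conjugation by
    \<open>u\<close> in the transfer cancels it and the estimates given for \<open>q\<close>
    apply.\<close>
  let ?q = "\<lambda>i x. q i (conjugation (inv u) x)"
  have q': "strongly_admissible n ?q" by (rule strongly_admissible_conj[OF q])
  have "symbol_estimate ip (translated_symbol u \<sigma>) (difference_power ?q \<alpha>) (partial X \<beta>) (m - real (\<Sum>i<n. \<alpha> i))" for \<alpha> \<beta>
    by (rule symbol_estimate_partial_translated[OF \<mu> X is_symbol_smooth[OF sym]])
       (use q' est in \<open>simp_all add: strongly_admissible_def admissible_def vanishes_of_order_def\<close>)
  then show ?thesis
    using is_symbol_translated[OF \<mu> A sym] q' unfolding condition_D_def by blast
qed

end

theorem corollary2p3: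
  fixes G :: "'g::{t2_space, second_countable_topology} monoid"
    and n :: nat
    and V :: "'e::euclidean_space set"
    and \<A> :: "('g, 'e) chart set"
    and \<mu> :: "'g measure"
    and ip :: "'g operator \<Rightarrow> 'g operator \<Rightarrow> real"
    and X :: "nat \<Rightarrow> 'g operator"
    and m :: real
    and A :: "('g \<Rightarrow> complex) \<Rightarrow> 'g dist"
    and u :: 'g
  assumes "compact_lie_group G n V \<A>"
    and "compact_lie_group.haar_measure G \<mu>"
    and "compact_lie_group.biinvariant_metric G V \<A> ip"
    and "compact_lie_group.left_invariant_frame G n V \<A> X"
    and "compact_lie_group.continuous_operator V \<A> A"
  shows "(compact_lie_group.condition_B G n V \<A> \<mu> ip m A \<longrightarrow>
            compact_lie_group.condition_B G n V \<A> \<mu> ip m (compact_lie_group.translated_operator G u A)) \<and>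
         (compact_lie_group.condition_C G n V \<A> \<mu> ip X m A \<longrightarrow>
            compact_lie_group.condition_C G n V \<A> \<mu> ip X m (compact_lie_group.translated_operator G u A)) \<and>
         (compact_lie_group.condition_D G n V \<A> \<mu> ip X m A \<longrightarrow>
            compact_lie_group.condition_D G n V \<A> \<mu> ip X m (compact_lie_group.translated_operator G u A))"
proof -
  interpret compact_lie_group G n V \<A> by fact
  show ?thesis
    using condition_B_translated[OF assms(2,5)] condition_C_translated[OF assms(2,4,5)]
      condition_D_translated[OF assms(2,4,5)] by blast
qed

end
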